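(* Let $X=(X_n,\,n\ge1)$ be a regenerative process with values in a measurable space $(\mathcal{X},\mathscr{X})$, and let $(S_n,\,n\ge0)$ be a random walk modulated by $X$ with increment distributions $(F_x,\,x\in\mathcal{X})$, as described in the context. Suppose that conditions (D1), (D2), (D3) below hold for some reference distribution $F$ on $\mathbb{R}$ with finite mean and some measurable function $c:\mathcal{X}\to[0,1]$, that $F^{\mathrm{I}}\in\mathcal{S}$, and that $\kappa<0$. Then, with $M=\sup_{n\ge0}S_n$, $$\lim_{y\to\infty}\frac{P(M>y)}{\overline{F^{\mathrm{I}}}(y)}=\frac{C}{a}.$$ The conditions are: (D1) $\overline{F_x}(y)\le\overline{F}(y)$ for all $y\in\mathbb{R}$ and all $x\in\mathcal{X}$; (D2) $\overline{F_x^{\mathrm{I}}}(y)\sim c(x)\,\overline{F^{\mathrm{I}}}(y)$ as $y\to\infty$, for every $x\in\mathcal{X}$; (D3) $a:=-\int_{\mathcal{X}}a_x\,\pi(dx)$ is finite and strictly positive.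
   Context: For a distribution function $G$ on $\mathbb{R}$, $\overline{G}(y):=1-G(y)$. If $G$ has finite mean, its integrated tail distribution $G^{\mathrm{I}}$ is defined by $\overline{G^{\mathrm{I}}}(y):=\min\bigl(1,\int_y^\infty\overline{G}(z)\,dz\bigr)$. A distribution $G$ on $\mathbb{R}_+$ is subexponential ($G\in\mathcal{S}$) if $\overline{G^{*2}}(y)/\overline{G}(y)\to2$ as $y\to\infty$, where $G^{*2}$ is the convolution of $G$ with itself; a distribution $G$ on $\mathbb{R}$ is in $\mathcal{S}$ iff $G_+(y):=G(y)\mathbf{1}(y\ge0)$ is in $\mathcal{S}$. For functions $f,g$, $f(y)\sim g(y)$ means $f(y)/g(y)\to1$ as $y\to\infty$. Setting: $X=(X_n,\,n\ge1)$ is regenerative with regeneration epochs $0\le T_0<T_1<\cdots$: the cycles $((X_n,\,T_{k-1}<n\le T_k),\,k\ge1)$ are i.i.d. and independent of the initial cycle $(X_n,\,0<n\le T_0)$. Put $\tau_0=T_0$, $\tau_k=T_k-T_{k-1}$ ($k\ge1$), and assume $E\tau_1<\infty$. The stationary measure is $\pi(B):=E\sum_{n=T_0+1}^{T_1}\mathbf{1}(X_n\in B)/E\tau_1$, $B\in\mathscr{X}$. The walk is $S_0=0$, $S_n=\xi_1+\cdots+\xi_n$, where, conditionally on $X$, the $\xi_n$ are independent and $P(\xi_n\le y\mid X)=P(\xi_n\le y\mid X_n)=F_{X_n}(y)$ a.s., for a family of distribution functions $(F_x,\,x\in\mathcal{X})$ with $x\mapsto F_x(y)$ measurable for each $y$.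 Each $F_x$ has finite mean $a_x:=\int_{\mathbb{R}}y\,F_x(dy)$. For $\beta>0$, $a_x^\beta:=\int_{\mathbb{R}}(y\vee-\beta)\,F_x(dy)$, and $\kappa:=\lim_{\beta\to\infty}\sup_{x\in\mathcal{X}}a_x^\beta$. Also $C:=\int_{\mathcal{X}}c(x)\,\pi(dx)$. *)

theory Defs
  imports "HOL-Probability.Probability"
begin

text \<open>Tail of a distribution (given as a measure on the reals): overline G (y) = 1 - G(y) = G((y,oo)).\<close>
definition tail :: "real measure \<Rightarrow> real \<Rightarrow> real" where
  "tail G y = measure G {y<..}"

text \<open>Tail of the integrated tail distribution: min(1, int_y^oo overline G(z) dz).\<close>
definition int_tail :: "real measure \<Rightarrow> real \<Rightarrow> real" where
  "int_tail G y = min 1 (LBINT z:{y..}. tail G z)"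

text \<open>The integrated tail distribution G^I as a measure, via its distribution function 1 - int_tail.\<close>
definition int_tail_dist :: "real measure \<Rightarrow> real measure" where
  "int_tail_dist G = interval_measure (\<lambda>y. 1 - int_tail G y)"

text \<open>Subexponentiality of a distribution on R: G is in S iff G_+ (the law of max(xi,0), xi ~ G) is
  subexponential, i.e. overline{G_+^{*2}}(y) / overline{G_+}(y) tends to 2.\<close>
definition subexponential :: "real measure \<Rightarrow> bool" where
  "subexponential G \<longleftrightarrow>
     (let Gp = distr G borel (\<lambda>t. max t 0)
      in ((\<lambda>y. tail (Gp \<star> Gp) y / tail Gp y) \<longlongrightarrow> 2) at_top)"

text \<open>The cycles of a process with regeneration epochs T.  Cycle 0 is the initial cycle
  (X_n, 0 < n <= T 0); cycle k >= 1 is (X_n, T (k-1) < n <= T k).  A cycle is encoded as its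
  length together with the sequence of its values, padded with a fixed point of the state space.\<close>
definition cycle :: "'x measure \<Rightarrow> (nat \<Rightarrow> 'w \<Rightarrow> 'x) \<Rightarrow> (nat \<Rightarrow> 'w \<Rightarrow> nat) \<Rightarrow> nat \<Rightarrow> 'w \<Rightarrow> nat \<times> (nat \<Rightarrow> 'x)" where
  "cycle SX X T k \<omega> =
     (let s = (if k = 0 then 0 else T (k - 1) \<omega>)
      in (T k \<omega> - s, \<lambda>j. if j < T k \<omega> - s then X (s + 1 + j) \<omega> else (SOME x. x \<in> space SX)))"

definition cycle_space :: "'x measure \<Rightarrow> (nat \<times> (nat \<Rightarrow> 'x)) measure" where
  "cycle_space SX = count_space UNIV \<Otimes>\<^sub>M (\<Pi>\<^sub>M j\<in>UNIV. SX)"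

text \<open>X = (X_n, n >= 1) is regenerative with regeneration epochs 0 <= T 0 < T 1 < ... (E tau_1 finite
  is assumed separately).\<close>
definition regenerative :: "'w measure \<Rightarrow> 'x measure \<Rightarrow> (nat \<Rightarrow> 'w \<Rightarrow> 'x) \<Rightarrow> (nat \<Rightarrow> 'w \<Rightarrow> nat) \<Rightarrow> bool" where
  "regenerative M SX X T \<longleftrightarrow>
     (\<forall>n\<ge>1. X n \<in> measurable M SX) \<and>
     (\<forall>k. T k \<in> measurable M (count_space UNIV)) \<and>
     (\<forall>\<omega>\<in>space M. strict_mono (\<lambda>k. T k \<omega>)) \<and>
     prob_space.indep_vars M (\<lambda>_. cycle_space SX) (cycle SX X T) UNIV \<and>
     (\<forall>k\<ge>1. distr M (cycle_space SX) (cycle SX X T k) = distr M (cycle_space SX) (cycle SX X T 1))"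

text \<open>Stationary measure pi(B) = E sum_{n=T_0+1}^{T_1} 1(X_n in B) / E tau_1.\<close>
definition stationary_measure :: "'w measure \<Rightarrow> 'x measure \<Rightarrow> (nat \<Rightarrow> 'w \<Rightarrow> 'x) \<Rightarrow> (nat \<Rightarrow> 'w \<Rightarrow> nat) \<Rightarrow> 'x measure" where
  "stationary_measure M SX X T =
     measure_of (space SX) (sets SX)
       (\<lambda>B. (\<integral>\<^sup>+\<omega>. ennreal (\<Sum>n\<in>{T 0 \<omega><..T 1 \<omega>}. indicator B (X n \<omega>)) \<partial>M)
             / (\<integral>\<^sup>+\<omega>. ennreal (real (T 1 \<omega> - T 0 \<omega>)) \<partial>M))"

text \<open>sigma-algebra generated by the process (X_n, n >= 1).\<close>
definition proc_sigma :: "'w measure \<Rightarrow> 'x measure \<Rightarrow> (nat \<Rightarrow> 'w \<Rightarrow> 'x) \<Rightarrow> 'w measure" where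
  "proc_sigma M SX X = sigma (space M) (\<Union>n\<in>{1..}. {X n -` A \<inter> space M | A. A \<in> sets SX})"

text \<open>Conditionally on X, the xi_n (n >= 1) are independent with P(xi_n in B | X) = F_{X_n}(B).\<close>
definition modulated_increments ::
  "'w measure \<Rightarrow> 'x measure \<Rightarrow> (nat \<Rightarrow> 'w \<Rightarrow> 'x) \<Rightarrow> ('x \<Rightarrow> real measure) \<Rightarrow> (nat \<Rightarrow> 'w \<Rightarrow> real) \<Rightarrow> bool" where
  "modulated_increments M SX X Fx \<xi> \<longleftrightarrow>
     (\<forall>n\<ge>1. \<xi> n \<in> borel_measurable M) \<and>
     (\<forall>I B. finite I \<and> I \<subseteq> {1..} \<and> (\<forall>n\<in>I. B n \<in> sets borel) \<longrightarrow>
        (AE \<omega> in M. real_cond_exp M (proc_sigma M SX X) (\<lambda>\<omega>'. \<Prod>n\<in>I. indicator (B n) (\<xi> n \<omega>')) \<omega>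
                    = (\<Prod>n\<in>I. measure (Fx (X n \<omega>)) (B n))))"

text \<open>a_x^beta and kappa = lim_{beta -> oo} sup_x a_x^beta (in the extended reals).\<close>
definition trunc_mean :: "real measure \<Rightarrow> real \<Rightarrow> real" where
  "trunc_mean G \<beta> = (\<integral>y. max y (- \<beta>) \<partial>G)"

definition kappa :: "'x measure \<Rightarrow> ('x \<Rightarrow> real measure) \<Rightarrow> ereal" where
  "kappa SX Fx = Lim at_top (\<lambda>\<beta>::real. SUP x\<in>space SX. ereal (trunc_mean (Fx x) \<beta>))"

end

theory Submission
  imports Defs
begin

text \<open>
  Given the environment \<open>X\<close>, the increments are independent with tails dominated by that of \<open>F\<close>, and
  \<open>\<kappa> < 0\<close> makes the drift of the increments truncated from below uniformly negative.  Stop the walk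
  when it first exceeds a line \<open>K - n a\<close>.  If the maximum exceeds \<open>y\<close>, then at that time the walk
  is above \<open>y - L\<close> (a single big jump), or at most at \<open>L\<close>, or in between; the last possibility is
  negligible by subexponentiality.  With a slope \<open>a\<close> so small that the crossing probability is
  uniformly small, an induction gives the bound \<open>D * int_tail F y\<close> on the conditional probability,
  with \<open>D\<close> independent of \<open>X\<close>.  For any \<open>a\<close> below the stationary drift and \<open>K\<close> large this bound
  makes every contribution small except that of the big jumps, whose expected number
  \<open>E \<Sum>n. tail (Fx (X n)) (y + n a)\<close> is asymptotically \<open>(C / a) * int_tail F y\<close>, as one sees by splitting
  the sum into cycles.  For the lower bound, the events that the walk stays above a slightly steeper line
  and below \<open>y\<close> until it makes its first big jump are disjoint.
\<close>

section \<open>Stop-loss transforms and integrated tails\<close>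

text \<open>Only first moments are at hand: the steps need not have a variance, and their lower
  tails need not be uniformly integrable over the environment. Crossing probabilities therefore rest
  on a maximal inequality with truncated squares, whose constants depend on the dominating law alone
  and so serve all environments at once. The two drift conditions do different work. What happens
  after the crossing must be bounded in every fixed environment, and this is what
  \<open>kappa\<close> buys. The stationary drift is seen only on average over the environment; it
  makes the crossing itself rare for slopes close to it. Quantile transforms supply at once
  independence given the environment, a majorant with law \<open>F\<close> common to all
  environments, and increments unaffected by any joint behaviour with the epochs. The integrated
  tail is handled without its cap, as a stop-loss transform: its differences are bracketed by tails,
  so sums of tails along a line telescope.\<close>

lemma (in real_distribution) tail_bounds: "0 \<le> tail M y" "tail M y \<le> 1"
  by (simp_all add: tail_def)

lemma (in real_distribution) tail_antimono: "x \<le> y \<Longrightarrow> tail M y \<le> tail M x"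
  unfolding tail_def by (intro finite_measure_mono) auto

lemma (in real_distribution) borel_measurable_tail [measurable]: "tail M \<in> borel_measurable borel"
proof -
  have "mono (\<lambda>y. - tail M y)" by (rule monoI) (simp add: tail_antimono)
  then have "(\<lambda>y. - (- tail M y)) \<in> borel_measurable borel"
    by (intro borel_measurable_uminus borel_measurable_mono)
  then show ?thesis by simp
qed

lemma (in real_distribution) emeasure_greaterThan: "emeasure M {y<..} = ennreal (tail M y)"
  by (simp add: tail_def emeasure_eq_measure)

lemma (in real_distribution) tendsto_tail: "(tail M \<longlongrightarrow> 0) at_top"
proof -
  have "((\<lambda>y. 1 - cdf M y) \<longlongrightarrow> 1 - 1) at_top"
    by (intro tendsto_intros cdf_lim_at_top_prob)
  moreover have "1 - cdf M y = tail M y" for y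
    unfolding tail_def cdf_def by (subst prob_compl[symmetric]) (auto intro!: arg_cong[where f=prob])
  ultimately show ?thesis by simp
qed

locale integrable_dist = real_distribution G for G :: "real measure" +
  assumes integrable_id: "integrable G (\<lambda>y. y)"

lemma integrable_distI:
  assumes "prob_space G" "sets G = sets borel" "integrable G (\<lambda>y. y)"
  shows "integrable_dist G"
  using assms by (simp add: integrable_dist_def integrable_dist_axioms_def real_distribution_def real_distribution_axioms_def)

text \<open>The stop-loss transform of actuarial mathematics. By Fubini it is the integral of the
  tail beyond \<open>y\<close> (\<open>nn_integral_tail\<close>), so \<open>int_tail\<close> is its
  minimum with 1.\<close>

definition stop_loss :: "real measure \<Rightarrow> real \<Rightarrow> real" where
  "stop_loss G y = (\<integral>z. max 0 (z - y) \<partial>G)"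

context integrable_dist
begin

lemma integrable_excess: "integrable G (\<lambda>z. max 0 (z - y))"
  using integrable_id by (intro integrable_max) auto

lemma integrable_max_const: "integrable G (\<lambda>z. max z y)"
  using integrable_id by (intro integrable_max) auto

lemma stop_loss_nonneg: "0 \<le> stop_loss G y"
  unfolding stop_loss_def by (rule Bochner_Integration.integral_nonneg) auto

lemma stop_loss_antimono: "x \<le> y \<Longrightarrow> stop_loss G y \<le> stop_loss G x"
  unfolding stop_loss_def by (intro integral_mono integrable_excess) auto

text \<open>Pointwise, the excess over \<open>y\<close> minus the excess over \<open>y + d\<close>
  lies between \<open>d\<close> times the indicator of \<open>{y + d<..}\<close> and
  \<open>d\<close> times that of \<open>{y<..}\<close>.\<close>

lemma stop_loss_diff:
  assumes "0 < d"
  shows "d * tail G (y + d) \<le> stop_loss G y - stop_loss G (y + d)"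
    and "stop_loss G y - stop_loss G (y + d) \<le> d * tail G y"
proof -
  have eq: "stop_loss G y - stop_loss G (y + d) = (\<integral>z. max 0 (z - y) - max 0 (z - (y + d)) \<partial>G)"
    unfolding stop_loss_def by (intro Bochner_Integration.integral_diff[symmetric] integrable_excess)
  have tl: "d * tail G t = (\<integral>z. d * indicator {t<..} z \<partial>G)" for t
    by (simp add: tail_def)
  have i: "integrable G (\<lambda>z. d * indicator {t<..} z)" for t
    by (intro integrable_mult_right integrable_real_indicator) (auto simp: emeasure_eq_measure)
  show "d * tail G (y + d) \<le> stop_loss G y - stop_loss G (y + d)"
    unfolding eq tl using assms
    by (intro integral_mono i Bochner_Integration.integrable_diff integrable_excess)
       (auto split: split_indicator)
  show "stop_loss G y - stop_loss G (y + d) \<le> d * tail G y"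
    unfolding eq tl using assms
    by (intro integral_mono i Bochner_Integration.integrable_diff integrable_excess)
       (auto split: split_indicator)
qed

lemma tendsto_stop_loss: "(stop_loss G \<longlongrightarrow> 0) at_top"
proof -
  have "((\<lambda>y. \<integral>z. max 0 (z - y) \<partial>G) \<longlongrightarrow> (\<integral>z. 0 \<partial>G)) at_top"
  proof (rule integral_dominated_convergence_at_top[where w="\<lambda>z. max 0 (z - 0)"])
    show "\<forall>\<^sub>F i in at_top. AE x in G. norm (max 0 (x - i)) \<le> max 0 (x - 0)"
      using eventually_ge_at_top[of "0::real"] by eventually_elim auto
    show "AE x in G. ((\<lambda>y. max 0 (x - y)) \<longlongrightarrow> 0) at_top"
    proof (rule AE_I2)
      fix x :: real
      show "((\<lambda>y. max 0 (x - y)) \<longlongrightarrow> 0) at_top"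
        by (rule tendsto_eventually, rule eventually_mono[OF eventually_ge_at_top[of x]]) auto
    qed
  qed (auto simp: integrable_excess[of 0, simplified])
  then show ?thesis by (simp add: stop_loss_def[abs_def])
qed

text \<open>The first bound of \<open>stop_loss_diff\<close> telescopes over a grid of mesh
  \<open>d\<close>. The grid starts one mesh to the right of the stop-loss argument, which explains
  the shifts by \<open>d\<close> in later uses.\<close>

lemma sum_tail_le:
  assumes "0 < d"
  shows "(\<Sum>n<N. tail G (y + d + real n * d)) \<le> stop_loss G y / d"
proof -
  have "d * (\<Sum>n<N. tail G (y + d + real n * d)) \<le> stop_loss G y - stop_loss G (y + real N * d)"
  proof (induction N)
    case (Suc N)
    with stop_loss_diff(1)[OF assms, of "y + real N * d"] show ?case
      by (simp add: algebra_simps)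
  qed simp
  with stop_loss_nonneg[of "y + real N * d"] assms show ?thesis
    by (simp add: field_simps)
qed

lemma suminf_tail_le:
  assumes "0 < d"
  shows "(\<Sum>n. ennreal (tail G (y + d + real n * d))) \<le> ennreal (stop_loss G y / d)"
proof (rule suminf_le_const[OF summableI])
  fix N
  show "(\<Sum>n<N. ennreal (tail G (y + d + real n * d))) \<le> ennreal (stop_loss G y / d)"
    using sum_tail_le[OF assms, where N = N and y = y] by (simp add: sum_ennreal tail_bounds ennreal_leI)
qed

text \<open>The second bound of \<open>stop_loss_diff\<close> telescopes too; the boundary term at
  \<open>y + real N * d\<close> disappears because the stop-loss tends to 0.\<close>

lemma suminf_tail_ge:
  assumes "0 < d"
  shows "ennreal (stop_loss G y / d) \<le> (\<Sum>n. ennreal (tail G (y + real n * d)))"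
proof -
  have s: "stop_loss G y - stop_loss G (y + real N * d) \<le> d * (\<Sum>n<N. tail G (y + real n * d))" for N
  proof (induction N)
    case (Suc N)
    with stop_loss_diff(2)[OF assms, of "y + real N * d"] show ?case
      by (simp add: algebra_simps)
  qed simp
  have *: "ennreal ((stop_loss G y - stop_loss G (y + real N * d)) / d)
      \<le> (\<Sum>n. ennreal (tail G (y + real n * d)))" for N
  proof -
    have "ennreal ((stop_loss G y - stop_loss G (y + real N * d)) / d)
       \<le> ennreal (\<Sum>n<N. tail G (y + real n * d))"
      using s[of N] assms by (intro ennreal_leI) (simp add: field_simps)
    also have "\<dots> = (\<Sum>n<N. ennreal (tail G (y + real n * d)))"
      by (simp add: sum_ennreal tail_bounds)
    also have "\<dots> \<le> (\<Sum>n. ennreal (tail G (y + real n * d)))"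
      by (intro sum_le_suminf summableI) auto
    finally show ?thesis .
  qed
  have "filterlim (\<lambda>N. y + real N * d) at_top sequentially"
    using assms
    by (intro filterlim_tendsto_add_at_top[OF tendsto_const]
          filterlim_at_top_mult_tendsto_pos[OF tendsto_const assms] filterlim_real_sequentially)
  then have "(\<lambda>N. stop_loss G (y + real N * d)) \<longlonglongrightarrow> 0"
    by (rule filterlim_compose[OF tendsto_stop_loss])
  then have "(\<lambda>N. ennreal ((stop_loss G y - stop_loss G (y + real N * d)) / d))
     \<longlonglongrightarrow> ennreal ((stop_loss G y - 0) / d)"
    using assms by (intro tendsto_ennrealI tendsto_intros) auto
  then show ?thesis
    using * by (auto intro: LIMSEQ_le_const2)
qed

text \<open>Write the tail as a probability and exchange the integrals: for fixed \<open>w\<close>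
  the points \<open>z\<close> with \<open>y \<le> z < w\<close> have length
  \<open>max 0 (w - y)\<close>.\<close>

lemma nn_integral_tail: "(\<integral>\<^sup>+z. ennreal (tail G z) * indicator {y..} z \<partial>lborel) = ennreal (stop_loss G y)"
proof -
  interpret pair_sigma_finite G lborel ..
  have "(\<integral>\<^sup>+z. ennreal (tail G z) * indicator {y..} z \<partial>lborel)
     = (\<integral>\<^sup>+z. \<integral>\<^sup>+w. indicator {y..} z * indicator {z<..} w \<partial>G \<partial>lborel)"
    by (intro nn_integral_cong) (auto simp: tail_def emeasure_eq_measure nn_integral_cmult mult.commute)
  also have "\<dots> = (\<integral>\<^sup>+w. \<integral>\<^sup>+z. indicator {y..} z * indicator {z<..} w \<partial>lborel \<partial>G)"
  proof (rule Fubini')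
    have eq: "(\<lambda>(w, z). indicator {y..} z * indicator {z<..} w :: ennreal)
        = indicator {p \<in> space (G \<Otimes>\<^sub>M lborel). y \<le> snd p \<and> snd p < fst p}"
      by (auto simp: fun_eq_iff space_pair_measure split: split_indicator)
    have "{p \<in> space (G \<Otimes>\<^sub>M lborel). y \<le> snd p \<and> snd p < fst p} \<in> sets (G \<Otimes>\<^sub>M lborel)"
      by measurable
    then show "(\<lambda>(w, z). indicator {y..} z * indicator {z<..} w :: ennreal) \<in> borel_measurable (G \<Otimes>\<^sub>M lborel)"
      unfolding eq by (rule borel_measurable_indicator)
  qed
  also have "\<dots> = (\<integral>\<^sup>+w. ennreal (max 0 (w - y)) \<partial>G)"
  proof (rule nn_integral_cong)
    fix w
    have "(\<integral>\<^sup>+z. indicator {y..} z * indicator {z<..} w \<partial>lborel) = (\<integral>\<^sup>+z. indicator {y..<w} z \<partial>lborel)"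
      by (intro nn_integral_cong) (auto split: split_indicator)
    also have "\<dots> = ennreal (max 0 (w - y))"
      by (cases "y \<le> w") (auto simp: max_def)
    finally show "(\<integral>\<^sup>+z. indicator {y..} z * indicator {z<..} w \<partial>lborel) = ennreal (max 0 (w - y))" .
  qed
  also have "\<dots> = ennreal (stop_loss G y)"
    unfolding stop_loss_def by (intro nn_integral_eq_integral integrable_excess) auto
  finally show ?thesis .
qed

lemma int_tail_eq: "int_tail G y = min 1 (stop_loss G y)"
proof -
  have "(LBINT z:{y..}. tail G z) = enn2real (\<integral>\<^sup>+z. ennreal (indicator {y..} z * tail G z) \<partial>lborel)"
    unfolding set_lebesgue_integral_def
    by (subst integral_eq_nn_integral) (auto simp: tail_bounds)
  also have "(\<integral>\<^sup>+z. ennreal (indicator {y..} z * tail G z) \<partial>lborel) = ennreal (stop_loss G y)"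
    unfolding nn_integral_tail[symmetric]
    by (intro nn_integral_cong) (auto split: split_indicator)
  finally show ?thesis
    unfolding int_tail_def by (simp add: stop_loss_nonneg)
qed

lemma int_tail_antimono: "x \<le> y \<Longrightarrow> int_tail G y \<le> int_tail G x"
  using stop_loss_antimono[of x y] by (auto simp: int_tail_eq)

lemma stop_loss_lipschitz: "\<bar>stop_loss G x - stop_loss G y\<bar> \<le> \<bar>x - y\<bar>"
proof (induction x y rule: linorder_wlog)
  case (le x y)
  show ?case
  proof (cases "x = y")
    case False
    with le have "stop_loss G x - stop_loss G y \<le> (y - x) * tail G x"
      using stop_loss_diff(2)[of "y - x" x] by simp
    also have "\<dots> \<le> (y - x) * 1"
      using le by (intro mult_left_mono tail_bounds) auto
    finally show ?thesis
      using stop_loss_antimono[OF le] by simp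
  qed simp
qed (simp add: abs_minus_commute)

lemma continuous_stop_loss: "isCont (stop_loss G) y"
  unfolding isCont_def
proof (rule metric_LIM_I)
  fix e :: real assume "0 < e"
  then show "\<exists>s>0. \<forall>x. x \<noteq> y \<and> dist x y < s \<longrightarrow> dist (stop_loss G x) (stop_loss G y) < e"
    using stop_loss_lipschitz[of _ y] by (intro exI[of _ e]) (auto simp: dist_real_def intro: le_less_trans)
qed

text \<open>The positive part dominates \<open>z - y\<close>. Consequently \<open>int_tail\<close>
  is 1 to the left of the mean minus 1, which gives the limit of \<open>1 - int_tail\<close> at
  minus infinity.\<close>

lemma stop_loss_ge_linear: "expectation (\<lambda>z. z) - y \<le> stop_loss G y"
proof -
  have "expectation (\<lambda>z. z) - y = (\<integral>z. z - y \<partial>G)"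
    using integrable_id prob_space by simp
  also have "\<dots> \<le> stop_loss G y"
    unfolding stop_loss_def using integrable_id by (intro integral_mono integrable_excess) auto
  finally show ?thesis .
qed

text \<open>\<open>interval_measure\<close> has the intended distribution function only once
  monotonicity, right continuity and the limits are verified. Continuity comes from the Lipschitz
  bound, the limits from the decay of the stop-loss and its linear lower bound.\<close>

lemma tail_int_tail_dist: "tail (int_tail_dist G) y = int_tail G y"
  and real_distribution_int_tail_dist: "real_distribution (int_tail_dist G)"
proof -
  let ?H = "\<lambda>y. 1 - int_tail G y"
  have nd: "\<And>x y. x \<le> y \<Longrightarrow> ?H x \<le> ?H y" by (simp add: int_tail_antimono)
  have rc: "continuous (at_right a) ?H" for a
  proof -
    have "isCont (\<lambda>y. 1 - min 1 (stop_loss G y)) a"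
      by (intro isCont_diff continuous_min continuous_const continuous_stop_loss)
    then show ?thesis
      unfolding int_tail_eq by (rule continuous_at_imp_continuous_at_within)
  qed
  have "(?H \<longlongrightarrow> 1 - min 1 0) at_top"
    unfolding int_tail_eq by (intro tendsto_intros tendsto_stop_loss)
  then have top: "(?H \<longlongrightarrow> 1) at_top" by simp
  have "eventually (\<lambda>y. ?H y = 0) at_bot"
    unfolding eventually_at_bot_linorder
  proof (intro exI[of _ "expectation (\<lambda>z. z) - 1"] allI impI)
    fix y assume "y \<le> expectation (\<lambda>z. z) - 1"
    with stop_loss_ge_linear[of y] show "?H y = 0"
      by (simp add: int_tail_eq)
  qed
  then have bot: "(?H \<longlongrightarrow> 0) at_bot" by (rule tendsto_eventually)
  have rd: "real_distribution (int_tail_dist G)"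
    unfolding int_tail_dist_def
    by (rule real_distribution_interval_measure[OF nd rc bot top]) 
  then interpret I: real_distribution "int_tail_dist G" .
  show "real_distribution (int_tail_dist G)" by fact
  have "cdf (int_tail_dist G) y = ?H y"
    unfolding int_tail_dist_def by (subst cdf_interval_measure[OF nd rc bot]) auto
  moreover have "tail (int_tail_dist G) y = 1 - cdf (int_tail_dist G) y"
    unfolding tail_def cdf_def by (subst I.prob_compl[symmetric]) (auto intro!: arg_cong[where f="I.prob"])
  ultimately show "tail (int_tail_dist G) y = int_tail G y" by simp
qed

end

lemma (in integrable_dist) integrable_dist_shift: "integrable_dist (distr G borel (\<lambda>z. z + b))"
  unfolding integrable_dist_def integrable_dist_axioms_def
proof
  have m: "(\<lambda>z. z + b) \<in> borel_measurable G" by measurable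
  then show "real_distribution (distr G borel (\<lambda>z. z + b))" by (rule real_distribution_distr)
  have "integrable G (\<lambda>z. z + b)"
    by (rule Bochner_Integration.integrable_add[OF integrable_id integrable_const])
  then show "integrable (distr G borel (\<lambda>z. z + b)) (\<lambda>y. y)"
    by (subst integrable_distr_eq[OF m]) simp_all
qed

text \<open>Both values are integrals of tails over the same half line, so an inequality of tails
  passes to them.\<close>

lemma stop_loss_mono_tail:
  assumes "integrable_dist F" "integrable_dist G" and le: "\<And>y. tail G y \<le> tail F y"
  shows "stop_loss G y \<le> stop_loss F y"
proof -
  interpret F: integrable_dist F by fact
  interpret G: integrable_dist G by fact
  have "ennreal (stop_loss G y) \<le> ennreal (stop_loss F y)"
    unfolding F.nn_integral_tail[symmetric] G.nn_integral_tail[symmetric]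
    by (intro nn_integral_mono mult_right_mono ennreal_leI le) auto
  then show ?thesis by (simp add: F.stop_loss_nonneg)
qed

section \<open>Subexponential distributions\<close>

text \<open>Concentration on the nonnegative reals is expressed through the tail;
  \<open>AE_nonneg\<close> recovers the almost sure form. The law to keep in mind is the positive
  part of the integrated tail distribution.\<close>

locale subexp_dist = real_distribution H for H :: "real measure" +
  assumes tail_neg: "y < 0 \<Longrightarrow> tail H y = 1"
    and subexp: "((\<lambda>y. tail (H \<star> H) y / tail H y) \<longlongrightarrow> 2) at_top"

text \<open>For independent \<open>X\<^sub>1, X\<^sub>2\<close> with law \<open>H\<close> this is the probability of
  \<open>X\<^sub>1 + X\<^sub>2 > y\<close>, \<open>X\<^sub>1 > L\<close> and \<open>X\<^sub>2 > L\<close>.\<close>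
definition two_jumps :: "real measure \<Rightarrow> real \<Rightarrow> real \<Rightarrow> ennreal" where
  "two_jumps H L y = (\<integral>\<^sup>+x\<in>{L<..}. ennreal (tail H (max L (y - x))) \<partial>H)"

context subexp_dist
begin

lemma AE_nonneg: "AE x in H. 0 \<le> x"
proof -
  have "prob {..<0} = 0"
  proof -
    have "prob {..<0::real} \<le> e" if "0 < e" for e
    proof -
      have "(\<lambda>n. prob {..- (1 / real (Suc n))}) \<longlonglongrightarrow> prob (\<Union>n. {..- (1 / real (Suc n))})"
        by (intro finite_Lim_measure_incseq) (auto simp: incseq_def frac_le)
      moreover have "prob {..- (1 / real (Suc n))} = 0" for n
      proof -
        have "prob {..- (1 / real (Suc n))} = 1 - tail H (- (1 / real (Suc n)))"
          unfolding tail_def by (subst prob_compl[symmetric]) (auto intro!: arg_cong[where f=prob])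
        then show ?thesis by (simp add: tail_neg)
      qed
      ultimately have "prob (\<Union>n. {..- (1 / real (Suc n))}) = 0"
        by (simp add: LIMSEQ_const_iff)
      moreover have "(\<Union>n. {..- (1 / real (Suc n))}) = {..<0::real}"
      proof (intro set_eqI iffI)
        fix x :: real assume "x \<in> {..<0}"
        then obtain n where "inverse (real (Suc n)) < - x"
          using reals_Archimedean[of "- x"] by auto
        then show "x \<in> (\<Union>n. {..- (1 / real (Suc n))})"
          by (auto simp: inverse_eq_divide intro!: exI[of _ n])
      qed (auto intro: le_less_trans)
      ultimately show ?thesis using that by simp
    qed
    then have "prob {..<0::real} \<le> 0" by (rule field_le_epsilon[of _ 0, simplified])
    then show ?thesis by (simp add: measure_le_0_iff)
  qed
  then show ?thesis
    by (subst AE_iff_measurable[of "{..<0}"]) (auto simp: emeasure_eq_measure not_le)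
qed

lemma tail_convolution: "ennreal (tail (H \<star> H) y) = (\<integral>\<^sup>+x. ennreal (tail H (y - x)) \<partial>H)"
proof -
  interpret C: prob_space "H \<star> H"
  proof
    show "emeasure (H \<star> H) (space (H \<star> H)) = 1"
      by (subst convolution_emeasure)
         (auto simp: space_convolution finite_measure_axioms emeasure_space_1[simplified])
  qed
  have "ennreal (tail (H \<star> H) y) = emeasure (H \<star> H) {y<..}"
    by (simp add: tail_def C.emeasure_eq_measure)
  also have "\<dots> = (\<integral>\<^sup>+x. emeasure H {a. a + x \<in> {y<..}} \<partial>H)"
    by (subst convolution_emeasure) (auto simp: finite_measure_axioms)
  also have "\<dots> = (\<integral>\<^sup>+x. ennreal (tail H (y - x)) \<partial>H)"
    unfolding emeasure_greaterThan[symmetric]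
    by (intro nn_integral_cong arg_cong[where f="emeasure H"]) auto
  finally show ?thesis .
qed

text \<open>Division by zero gives 0 here: a tail vanishing at one point vanishes ever after, and
  the quotient would eventually be 0 instead of tending to 2.\<close>

lemma tail_pos: "0 < tail H y"
proof (rule ccontr)
  assume "\<not> 0 < tail H y"
  then have z: "tail H z = 0" if "y \<le> z" for z
    using tail_antimono[OF that] tail_bounds(1)[of z] tail_bounds(1)[of y] by linarith
  from eventually_ge_at_top[of y] have "eventually (\<lambda>z. tail (H \<star> H) z / tail H z = 0) at_top"
    by (rule eventually_mono) (simp add: z)
  then have "((\<lambda>y. tail (H \<star> H) y / tail H y) \<longlongrightarrow> 0) at_top"
    by (rule tendsto_eventually)
  with tendsto_unique[OF _ this subexp] show False by simp
qed

lemma prob_atMost: "prob {..y} = 1 - tail H y"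
  unfolding tail_def by (subst prob_compl[symmetric]) (auto intro!: arg_cong[where f=prob])

text \<open>The integral over the first summand is cut at \<open>t\<close> and at \<open>y\<close>,
  and on each piece \<open>tail H (y - x)\<close> is replaced by a lower bound valid there; beyond
  \<open>y\<close> it equals 1.\<close>

lemma tail_convolution_ge:
  assumes "0 \<le> t" "t \<le> y"
  shows "(1 - tail H t) * tail H y + (tail H t - tail H y) * tail H (y - t) + tail H y \<le> tail (H \<star> H) y"
proof -
  have "ennreal ((1 - tail H t) * tail H y + (tail H t - tail H y) * tail H (y - t) + tail H y)
     = (\<integral>\<^sup>+x. ennreal (tail H y) * indicator {..t} x + ennreal (tail H (y - t)) * indicator {t<..y} x
          + indicator {y<..} x \<partial>H)"
  proof -
    have "prob {t<..y} = tail H t - tail H y"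
      unfolding tail_def using assms by (subst finite_measure_Diff[symmetric]) (auto intro!: arg_cong[where f=prob])
    then have "(\<integral>\<^sup>+x. ennreal (tail H y) * indicator {..t} x + ennreal (tail H (y - t)) * indicator {t<..y} x
          + indicator {y<..} x \<partial>H) = ennreal (tail H y) * ennreal (1 - tail H t)
          + ennreal (tail H (y - t)) * ennreal (tail H t - tail H y) + ennreal (tail H y)"
      by (simp add: nn_integral_add nn_integral_cmult_indicator emeasure_eq_measure prob_atMost tail_def[symmetric])
    also have "\<dots> = ennreal ((1 - tail H t) * tail H y + (tail H t - tail H y) * tail H (y - t) + tail H y)"
      using tail_antimono[OF \<open>t \<le> y\<close>]
      by (simp add: ennreal_mult'[symmetric] ennreal_plus[symmetric] tail_bounds mult.commute del: ennreal_plus)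
    finally show ?thesis by simp
  qed
  also have "\<dots> \<le> (\<integral>\<^sup>+x. ennreal (tail H (y - x)) \<partial>H)"
  proof (rule nn_integral_mono_AE, use AE_nonneg in eventually_elim)
    fix x :: real assume "0 \<le> x"
    then show "ennreal (tail H y) * indicator {..t} x + ennreal (tail H (y - t)) * indicator {t<..y} x
          + indicator {y<..} x \<le> ennreal (tail H (y - x))"
      using assms tail_neg[of "y - x"]
      by (auto split: split_indicator intro!: ennreal_leI tail_antimono)
  qed
  finally show ?thesis
    unfolding tail_convolution[symmetric] by (simp add: tail_def)
qed

text \<open>The classical argument that subexponential laws are long-tailed. The lower bound for the
  convolution is solved for \<open>tail H (y - t)\<close>, and the resulting majorant has limit
  \<open>(2 - 1 - (1 - tail H t)) / tail H t = 1\<close>.\<close>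

lemma long_tailed_aux:
  assumes "0 \<le> t"
  shows "((\<lambda>y. tail H (y - t) / tail H y) \<longlongrightarrow> 1) at_top"
proof (rule tendsto_sandwich)
  let ?r = "\<lambda>y. tail (H \<star> H) y / tail H y"
  show "eventually (\<lambda>y. 1 \<le> tail H (y - t) / tail H y) at_top"
    using assms tail_pos by (intro always_eventually) (auto simp: tail_antimono)
  have lt: "tail H t - tail H y > 0" if "tail H y < tail H t" for y using that by simp
  have "eventually (\<lambda>y. tail H y < tail H t) at_top"
    using order_tendstoD(2)[OF tendsto_tail tail_pos[of t]] .
  then show "eventually (\<lambda>y. tail H (y - t) / tail H y \<le> (?r y - 1 - (1 - tail H t)) / (tail H t - tail H y)) at_top"
    using eventually_ge_at_top[of t]
  proof eventually_elim
    case (elim y)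
    have "(tail H t - tail H y) * tail H (y - t) \<le> tail (H \<star> H) y - tail H y - (1 - tail H t) * tail H y"
      using tail_convolution_ge[OF assms elim(2)] by simp
    also have "\<dots> = (?r y - 1 - (1 - tail H t)) * tail H y"
      using tail_pos[of y] by (simp add: field_simps)
    finally show ?case
      using elim tail_pos[of y] by (simp add: field_simps)
  qed
  have "((\<lambda>y. (?r y - 1 - (1 - tail H t)) / (tail H t - tail H y)) \<longlongrightarrow> (2 - 1 - (1 - tail H t)) / (tail H t - 0)) at_top"
    using tail_pos[of t] by (intro tendsto_intros subexp tendsto_tail) auto
  then show "((\<lambda>y. (?r y - 1 - (1 - tail H t)) / (tail H t - tail H y)) \<longlongrightarrow> 1) at_top"
    using tail_pos[of t] by simp
qed simp

text \<open>For negative \<open>t\<close> the quotient is the inverse of the one for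
  \<open>- t\<close>, taken at a shifted argument.\<close>

lemma long_tailed: "((\<lambda>y. tail H (y - t) / tail H y) \<longlongrightarrow> 1) at_top"
proof (cases "0 \<le> t")
  case False
  then have "((\<lambda>y. tail H (y - (- t)) / tail H y) \<longlongrightarrow> 1) at_top"
    by (intro long_tailed_aux) auto
  moreover have "filterlim (\<lambda>y. y - t) at_top at_top"
    unfolding diff_conv_add_uminus
    using filterlim_tendsto_add_at_top[OF tendsto_const[of "- t"] filterlim_ident]
    by (simp add: add.commute)
  ultimately have "((\<lambda>y. tail H (y - t + t) / tail H (y - t)) \<longlongrightarrow> 1) at_top"
    using filterlim_compose[of "\<lambda>y. tail H (y + t) / tail H y"] by fastforce
  from tendsto_inverse[OF this] show ?thesis by simp
qed (rule long_tailed_aux)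

text \<open>When \<open>2 * L \<le> y\<close>, a sum exceeding \<open>y\<close> has its first
  summand at most \<open>L\<close>, or its second at most \<open>L\<close>, or both above
  \<open>L\<close>, and these cases are disjoint. The first two have the same probability
  \<open>A\<close>, which is at least \<open>(1 - tail H L) * tail H y\<close> because the small
  summand is nonnegative.\<close>

lemma two_jumps_le:
  assumes "2 * L \<le> y"
  shows "two_jumps H L y \<le> ennreal (tail (H \<star> H) y - 2 * (1 - tail H L) * tail H y)"
proof -
  interpret HH: pair_prob_space H H ..
  define A where "A = (\<integral>\<^sup>+x\<in>{..L}. ennreal (tail H (y - x)) \<partial>H)"
  have "ennreal ((1 - tail H L) * tail H y) = (\<integral>\<^sup>+x\<in>{..L}. ennreal (tail H y) \<partial>H)"
    by (simp add: nn_integral_cmult_indicator emeasure_eq_measure prob_atMost ennreal_mult'[symmetric] tail_bounds mult.commute)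
  also have "\<dots> \<le> A"
    unfolding A_def
    by (rule nn_integral_mono_AE, use AE_nonneg in eventually_elim)
       (auto split: split_indicator intro!: ennreal_leI tail_antimono)
  finally have A: "ennreal ((1 - tail H L) * tail H y) \<le> A" .
  \<comment> \<open>The case of a small second summand. For \<open>z \<le> L\<close> the bound
    \<open>y - z\<close> is at least \<open>L\<close>, so the requirement that the first summand
    exceed \<open>L\<close> holds by itself and symmetry yields \<open>A\<close>.\<close>
  have swap: "(\<integral>\<^sup>+x. \<integral>\<^sup>+z. indicator {L<..} x * indicator {z. z \<le> L \<and> y < x + z} z \<partial>H \<partial>H) = A"
  proof -
    have "(\<integral>\<^sup>+x. \<integral>\<^sup>+z. indicator {L<..} x * indicator {z. z \<le> L \<and> y < x + z} z \<partial>H \<partial>H)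
       = (\<integral>\<^sup>+z. \<integral>\<^sup>+x. indicator {L<..} x * indicator {z. z \<le> L \<and> y < x + z} z \<partial>H \<partial>H)"
    proof (rule HH.Fubini')
      have eq: "(\<lambda>(z, x). indicator {L<..} x * indicator {z. z \<le> L \<and> y < x + z} z :: ennreal)
          = indicator {p \<in> space (H \<Otimes>\<^sub>M H). L < snd p \<and> fst p \<le> L \<and> y < snd p + fst p}"
        by (auto simp: fun_eq_iff space_pair_measure split: split_indicator)
      have "{p \<in> space (H \<Otimes>\<^sub>M H). L < snd p \<and> fst p \<le> L \<and> y < snd p + fst p} \<in> sets (H \<Otimes>\<^sub>M H)"
        by measurable
      then show "(\<lambda>(z, x). indicator {L<..} x * indicator {z. z \<le> L \<and> y < x + z} z :: ennreal)
          \<in> borel_measurable (H \<Otimes>\<^sub>M H)"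
        unfolding eq by (rule borel_measurable_indicator)
    qed
    also have "\<dots> = A"
      unfolding A_def
    proof (rule nn_integral_cong)
      fix z
      have "(\<integral>\<^sup>+x. indicator {L<..} x * indicator {z. z \<le> L \<and> y < x + z} z \<partial>H)
         = (\<integral>\<^sup>+x. indicator {..L} z * indicator {y - z<..} x \<partial>H)"
        using assms by (intro nn_integral_cong) (auto split: split_indicator)
      also have "\<dots> = ennreal (tail H (y - z)) * indicator {..L} z"
        by (simp add: nn_integral_cmult_indicator emeasure_greaterThan mult.commute)
      finally show "(\<integral>\<^sup>+x. indicator {L<..} x * indicator {z. z \<le> L \<and> y < x + z} z \<partial>H)
         = ennreal (tail H (y - z)) * indicator {..L} z" .
    qed
    finally show ?thesis .
  qed
  have "ennreal (tail (H \<star> H) y) = (\<integral>\<^sup>+x. ennreal (tail H (y - x)) * indicator {..L} x +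
      (\<integral>\<^sup>+z. indicator {L<..} x * indicator {z. z \<le> L \<and> y < x + z} z \<partial>H) +
      ennreal (tail H (max L (y - x))) * indicator {L<..} x \<partial>H)"
    unfolding tail_convolution
  proof (rule nn_integral_cong)
    fix x
    show "ennreal (tail H (y - x)) = ennreal (tail H (y - x)) * indicator {..L} x +
      (\<integral>\<^sup>+z. indicator {L<..} x * indicator {z. z \<le> L \<and> y < x + z} z \<partial>H) +
      ennreal (tail H (max L (y - x))) * indicator {L<..} x"
    proof (cases "x \<le> L")
      case False
      have "ennreal (tail H (y - x)) = emeasure H ({z. z \<le> L \<and> y < x + z} \<union> {max L (y - x)<..})"
        unfolding emeasure_greaterThan[symmetric] by (intro arg_cong[where f="emeasure H"]) auto
      also have "\<dots> = emeasure H {z. z \<le> L \<and> y < x + z} + emeasure H {max L (y - x)<..}"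
      proof (rule plus_emeasure[symmetric])
        have "{z. z \<le> L \<and> y < x + z} = {y - x<..L}" by auto
        then show "{z. z \<le> L \<and> y < x + z} \<in> events" by simp
      qed auto
      finally show ?thesis
        using False by (simp add: emeasure_greaterThan)
    qed simp
  qed
  also have "\<dots> = A + A + two_jumps H L y"
  proof -
    have [measurable]: "(\<lambda>x. \<integral>\<^sup>+z. indicator {L<..} x * indicator {z. z \<le> L \<and> y < x + z} z \<partial>H) \<in> borel_measurable H"
    proof -
      have "(\<lambda>x. \<integral>\<^sup>+z. indicator {L<..} x * indicator {z. z \<le> L \<and> y < x + z} z \<partial>H)
         = (\<lambda>x. \<integral>\<^sup>+z. (if L < x \<and> z \<le> L \<and> y < x + z then 1 else 0) \<partial>H)"
        by (intro ext nn_integral_cong) (auto split: split_indicator)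
      then show ?thesis by simp
    qed
    show ?thesis
      unfolding two_jumps_def
      by (simp add: nn_integral_add swap[unfolded A_def] A_def)
  qed
  finally have *: "ennreal (tail (H \<star> H) y) = A + A + two_jumps H L y" .
  have "ennreal (2 * (1 - tail H L) * tail H y) + two_jumps H L y \<le> A + A + two_jumps H L y"
  proof (rule add_right_mono)
    have "ennreal (2 * (1 - tail H L) * tail H y)
        = ennreal ((1 - tail H L) * tail H y) + ennreal ((1 - tail H L) * tail H y)"
      by (subst ennreal_plus[symmetric]) (auto simp: tail_bounds)
    also have "\<dots> \<le> A + A" by (intro add_mono A)
    finally show "ennreal (2 * (1 - tail H L) * tail H y) \<le> A + A" .
  qed
  then have "ennreal (2 * (1 - tail H L) * tail H y) + two_jumps H L y \<le> ennreal (tail (H \<star> H) y)"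
    using * by simp
  then show ?thesis
    by (cases "two_jumps H L y")
       (auto simp: ennreal_plus[symmetric] tail_bounds tail_def top_unique simp del: ennreal_plus)
qed

lemma two_jumps_antimono: "L \<le> L' \<Longrightarrow> two_jumps H L' y \<le> two_jumps H L y"
  unfolding two_jumps_def
  by (intro nn_integral_mono) (auto split: split_indicator intro!: ennreal_leI tail_antimono)

text \<open>The limit 2 is used up by the two ways of having a single big summand. What is left is
  at most \<open>e / 2\<close> from the convergence plus \<open>2 * tail H L < e / 2\<close> from
  the choice of \<open>L\<close>.\<close>

lemma two_jumps_small:
  assumes "0 < e"
  obtains L where "\<And>L'. L \<le> L' \<Longrightarrow> eventually (\<lambda>y. two_jumps H L' y \<le> ennreal (e * tail H y)) at_top"
proof -
  have "eventually (\<lambda>L. tail H L < e / 4) at_top"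
    using order_tendstoD(2)[OF tendsto_tail, of "e / 4"] assms by simp
  then obtain L where L: "tail H L < e / 4"
    by (auto simp: eventually_at_top_linorder)
  have "eventually (\<lambda>y. tail (H \<star> H) y / tail H y < 2 + e / 2) at_top"
    using assms by (intro order_tendstoD(2)[OF subexp]) auto
  then have ev: "eventually (\<lambda>y. two_jumps H L y \<le> ennreal (e * tail H y)) at_top"
    using eventually_ge_at_top[of "2 * L"]
  proof eventually_elim
    case (elim y)
    have "tail (H \<star> H) y - 2 * (1 - tail H L) * tail H y \<le> (2 + e / 2) * tail H y - 2 * (1 - tail H L) * tail H y"
      using elim(1) tail_pos[of y] by (simp add: field_simps)
    also have "\<dots> = (e / 2 + 2 * tail H L) * tail H y" by (simp add: algebra_simps)
    also have "\<dots> \<le> e * tail H y"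
      using L tail_pos[of y] by (intro mult_right_mono) auto
    finally show ?case
      using two_jumps_le[OF elim(2)] by (blast intro: order_trans ennreal_leI)
  qed
  show thesis
  proof (rule that)
    fix L' assume "L \<le> L'"
    with ev show "eventually (\<lambda>y. two_jumps H L' y \<le> ennreal (e * tail H y)) at_top"
      by (auto elim!: eventually_mono intro: order_trans two_jumps_antimono)
  qed
qed

text \<open>The integrand is symmetric in the two summands. Exchanging the integrals exposes the
  tail of \<open>\<mu>\<close> at \<open>max L (y - z)\<close>, a point not below \<open>L\<close>,
  where the hypothesis applies; \<open>\<mu>\<close> will be the law of the position at the first
  crossing.\<close>

lemma two_jumps_dominates:
  fixes \<mu> :: "real measure"
  assumes "finite_measure \<mu>" and [measurable_cong]: "sets \<mu> = sets borel"
    and tail: "\<And>t. L \<le> t \<Longrightarrow> emeasure \<mu> {t<..} \<le> ennreal c * ennreal (tail H t)"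
  shows "(\<integral>\<^sup>+x\<in>{L<..}. ennreal (tail H (max L (y - x))) \<partial>\<mu>) \<le> ennreal c * two_jumps H L y"
proof -
  interpret mu: finite_measure \<mu> by fact
  interpret HM: pair_sigma_finite H \<mu> ..
  have "(\<integral>\<^sup>+x\<in>{L<..}. ennreal (tail H (max L (y - x))) \<partial>\<mu>)
      = (\<integral>\<^sup>+x. \<integral>\<^sup>+z. (if L < x \<and> L < z \<and> y < x + z then 1 else 0) \<partial>H \<partial>\<mu>)"
  proof (rule nn_integral_cong)
    fix x
    have "(\<integral>\<^sup>+z. (if L < x \<and> L < z \<and> y < x + z then 1 else 0) \<partial>H)
       = (\<integral>\<^sup>+z. indicator {L<..} x * indicator {max L (y - x)<..} z \<partial>H)"
      by (intro nn_integral_cong) (auto split: split_indicator)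
    also have "\<dots> = ennreal (tail H (max L (y - x))) * indicator {L<..} x"
      by (simp add: nn_integral_cmult_indicator emeasure_greaterThan mult.commute)
    finally show "ennreal (tail H (max L (y - x))) * indicator {L<..} x
       = (\<integral>\<^sup>+z. (if L < x \<and> L < z \<and> y < x + z then 1 else 0) \<partial>H)" by simp
  qed
  also have "\<dots> = (\<integral>\<^sup>+z. \<integral>\<^sup>+x. (if L < x \<and> L < z \<and> y < x + z then 1 else 0) \<partial>\<mu> \<partial>H)"
    by (rule HM.Fubini') measurable
  also have "\<dots> \<le> (\<integral>\<^sup>+z. ennreal c * (ennreal (tail H (max L (y - z))) * indicator {L<..} z) \<partial>H)"
  proof (rule nn_integral_mono)
    fix z
    have "(\<integral>\<^sup>+x. (if L < x \<and> L < z \<and> y < x + z then 1 else 0) \<partial>\<mu>)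
       = (\<integral>\<^sup>+x. indicator {L<..} z * indicator {max L (y - z)<..} x \<partial>\<mu>)"
      by (intro nn_integral_cong) (auto split: split_indicator)
    also have "\<dots> = indicator {L<..} z * emeasure \<mu> {max L (y - z)<..}"
      using assms(2) by (simp add: nn_integral_cmult_indicator)
    also have "\<dots> \<le> indicator {L<..} z * (ennreal c * ennreal (tail H (max L (y - z))))"
      by (intro mult_left_mono tail) auto
    finally show "(\<integral>\<^sup>+x. (if L < x \<and> L < z \<and> y < x + z then 1 else 0) \<partial>\<mu>)
      \<le> ennreal c * (ennreal (tail H (max L (y - z))) * indicator {L<..} z)"
      by (simp add: mult_ac)
  qed
  also have "\<dots> = ennreal c * two_jumps H L y"
    unfolding two_jumps_def by (rule nn_integral_cmult) measurable
  finally show ?thesis .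
qed

end

section \<open>Line crossing by sums of independent variables\<close>

text \<open>Outside \<open>I\<close> the coordinate is the constant \<open>undefined\<close>.
  Without a side condition \<open>i \<in> I\<close>, measurability of partial sums of coordinates
  can be derived automatically.\<close>

lemma measurable_component_borel:
  "(\<lambda>x. x i) \<in> borel_measurable (PiM I (\<lambda>_. borel :: real measure))"
proof (cases "i \<in> I")
  case False
  then have "(\<lambda>x. x i) \<in> borel_measurable (PiM I (\<lambda>_. borel :: real measure))
    \<longleftrightarrow> (\<lambda>x. undefined :: real) \<in> borel_measurable (PiM I (\<lambda>_. borel :: real measure))"
    by (intro measurable_cong) (auto simp: space_PiM PiE_def extensional_def)
  then show ?thesis by simp
qed simp

section \<open>Freezing the past of an independent sequence\<close>

context prob_space
begin

text \<open>Conditioning on \<open>A\<close>, written as Fubini for the product of the two laws: the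
  estimate has to be made only for each frozen value \<open>a\<close>.\<close>

lemma indep_var_emeasure_le:
  assumes ind: "indep_var N1 A N2 W"
    and E: "E \<in> sets (N1 \<Otimes>\<^sub>M N2)"
    and h [measurable]: "h \<in> borel_measurable N1"
    and le: "\<And>a. a \<in> space N1 \<Longrightarrow> emeasure M {\<omega> \<in> space M. (a, W \<omega>) \<in> E} \<le> h a"
  shows "emeasure M {\<omega> \<in> space M. (A \<omega>, W \<omega>) \<in> E} \<le> (\<integral>\<^sup>+\<omega>. h (A \<omega>) \<partial>M)"
proof -
  have [measurable]: "A \<in> measurable M N1" "W \<in> measurable M N2"
    using ind by (auto dest: indep_var_rv1 indep_var_rv2)
  interpret W: prob_space "distr M N2 W" by (rule prob_space_distr) simp
  have "emeasure M {\<omega> \<in> space M. (A \<omega>, W \<omega>) \<in> E}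
      = emeasure (distr M (N1 \<Otimes>\<^sub>M N2) (\<lambda>\<omega>. (A \<omega>, W \<omega>))) E"
    using E by (subst emeasure_distr) (auto intro!: arg_cong[where f="emeasure M"])
  also have "\<dots> = emeasure (distr M N1 A \<Otimes>\<^sub>M distr M N2 W) E"
    using ind by (simp add: indep_var_distribution_eq)
  also have "\<dots> = (\<integral>\<^sup>+a. emeasure (distr M N2 W) (Pair a -` E) \<partial>distr M N1 A)"
    using E by (intro W.emeasure_pair_measure_alt) simp
  also have "\<dots> \<le> (\<integral>\<^sup>+a. h a \<partial>distr M N1 A)"
  proof (rule nn_integral_mono)
    fix a assume "a \<in> space (distr M N1 A)"
    then have a: "a \<in> space N1" by simp
    have "emeasure (distr M N2 W) (Pair a -` E) = emeasure M {\<omega> \<in> space M. (a, W \<omega>) \<in> E}"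
      using sets_Pair1[OF E] by (subst emeasure_distr) (auto intro!: arg_cong[where f="emeasure M"])
    also have "\<dots> \<le> h a" by (rule le[OF a])
    finally show "emeasure (distr M N2 W) (Pair a -` E) \<le> h a" .
  qed
  also have "\<dots> = (\<integral>\<^sup>+\<omega>. h (A \<omega>) \<partial>M)"
    by (rule nn_integral_distr) measurable
  finally show ?thesis .
qed

lemma indep_vars_shift:
  assumes "indep_vars N X (UNIV :: nat set)"
  shows "indep_vars (\<lambda>i. N (k + i)) (\<lambda>i. X (k + i)) UNIV"
  unfolding indep_vars_def2
proof (intro conjI ballI indep_setsI)
  fix i
  show "random_variable (N (k + i)) (X (k + i))" using assms by (auto simp: indep_vars_def2)
  then show "{X (k + i) -` A \<inter> space M |A. A \<in> sets (N (k + i))} \<subseteq> events"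
    by (auto intro: measurable_sets)
next
  fix A :: "nat \<Rightarrow> 'a set" and J :: "nat set"
  assume J: "J \<noteq> {}" "J \<subseteq> UNIV" "finite J"
    and A: "\<forall>j\<in>J. A j \<in> {X (k + j) -` A \<inter> space M |A. A \<in> sets (N (k + j))}"
  have "prob (\<Inter>i\<in>(+) k ` J. A (i - k)) = (\<Prod>i\<in>(+) k ` J. prob (A (i - k)))"
    using assms J A unfolding indep_vars_def2 by (intro indep_setsD) auto
  then show "prob (\<Inter>i\<in>J. A i) = (\<Prod>i\<in>J. prob (A i))"
    by (simp add: prod.reindex)
qed

lemma indep_vars_past_future:
  assumes "indep_vars (\<lambda>_. borel :: real measure) X (UNIV :: nat set)"
  shows "indep_var (PiM {..<n} (\<lambda>_. borel)) (\<lambda>\<omega>. \<lambda>i\<in>{..<n}. X i \<omega>)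
     (PiM {n..} (\<lambda>_. borel)) (\<lambda>\<omega>. \<lambda>i\<in>{n..}. X i \<omega>)"
  using assms by (rule indep_var_restrict) auto

end

text \<open>As second moments may be infinite, the square is formed with \<open>min z r'\<close>; a
  larger step is paid for by the last term, since the left side never exceeds 1. That term comes
  from \<open>min 1 (v / r') \<le> 2 * v / (v + r')\<close>, and its rational form can be summed
  over the times (\<open>sum_inverse_square_le\<close>).\<close>

lemma truncated_square_step_bound:
  fixes s z r r' v :: real
  assumes "0 < r'" "\<bar>z\<bar> \<le> v" "- r' \<le> z"
  shows "min 1 ((max 0 (s + z))\<^sup>2 / r'\<^sup>2) \<le> ((max 0 s)\<^sup>2 + 2 * max 0 s * min z r') / r'\<^sup>2 + 8 * v\<^sup>2 / (v + r')\<^sup>2"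
proof -
  have v: "0 \<le> v" using assms by simp
  define m where "m = min 1 (v / r')"
  have m0: "0 \<le> m" using v assms by (simp add: m_def)
  have "m \<le> 2 * v / (v + r')"
  proof (cases "v \<le> r'")
    case True
    then have "v * (v + r') \<le> v * (2 * r')" using v by (intro mult_left_mono) auto
    then show ?thesis using True v assms by (simp add: m_def min_def field_simps)
  next
    case False
    then show ?thesis using v assms by (auto simp: m_def min_def field_simps)
  qed
  then have "m\<^sup>2 \<le> (2 * v / (v + r'))\<^sup>2" using m0 by (rule power_mono)
  then have m8: "2 * m\<^sup>2 \<le> 8 * v\<^sup>2 / (v + r')\<^sup>2"
    by (simp add: power_divide power_mult_distrib)
  define u where "u = min z r'"
  have u: "\<bar>u\<bar> \<le> m * r'"
    using assms v by (auto simp: u_def m_def min_def field_simps)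
  have u2: "u\<^sup>2 / r'\<^sup>2 \<le> m\<^sup>2"
  proof -
    have "u\<^sup>2 \<le> (m * r')\<^sup>2" using u by (rule abs_le_square_iff[THEN iffD1, OF order_trans[OF _ abs_ge_self]])
    then show ?thesis using assms by (simp add: power_mult_distrib divide_le_eq)
  qed
  have "(max 0 (s + u))\<^sup>2 \<le> (max 0 s)\<^sup>2 + 2 * max 0 s * u + u\<^sup>2"
  proof (cases "0 \<le> s")
    case True
    have "(max 0 (s + u))\<^sup>2 \<le> (s + u)\<^sup>2" by (auto simp: max_def)
    with True show ?thesis by (simp add: power2_sum algebra_simps)
  next
    case False
    then have "(max 0 (s + u))\<^sup>2 \<le> u\<^sup>2"
      by (auto simp: max_def intro!: power_mono)
    with False show ?thesis by simp
  qed
  then have b: "(max 0 (s + u))\<^sup>2 / r'\<^sup>2 \<le> ((max 0 s)\<^sup>2 + 2 * max 0 s * u) / r'\<^sup>2 + m\<^sup>2"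
    using u2 divide_right_mono[of "(max 0 (s + u))\<^sup>2" _ "r'\<^sup>2"] by (fastforce simp: add_divide_distrib)
  show ?thesis
  proof (cases "z \<le> r'")
    case True
    then have "u = z" by (simp add: u_def)
    have "min 1 ((max 0 (s + z))\<^sup>2 / r'\<^sup>2) \<le> (max 0 (s + z))\<^sup>2 / r'\<^sup>2" by simp
    also have "\<dots> \<le> ((max 0 s)\<^sup>2 + 2 * max 0 s * u) / r'\<^sup>2 + m\<^sup>2"
      using b \<open>u = z\<close> by simp
    also have "\<dots> \<le> ((max 0 s)\<^sup>2 + 2 * max 0 s * u) / r'\<^sup>2 + 8 * v\<^sup>2 / (v + r')\<^sup>2"
      using m8 zero_le_power2[of m] by linarith
    finally show ?thesis unfolding u_def .
  next
    case False
    then have "u = r'" "m = 1" using assms by (auto simp: u_def m_def min_def field_simps)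
    moreover have "0 \<le> ((max 0 s)\<^sup>2 + 2 * max 0 s * r') / r'\<^sup>2"
      using assms by (auto intro!: divide_nonneg_nonneg add_nonneg_nonneg mult_nonneg_nonneg)
    ultimately show ?thesis
      using m8 u_def by (auto simp: min_le_iff_disj)
  qed
qed

text \<open>A Hajek-Renyi bound: with the line \<open>r k = K + k d\<close>, the function \<open>V k s = (s\<^sup>+)\<^sup>2 / (r k)\<^sup>2\<close> plus
  the later weights dominates the crossing probability from level \<open>s\<close> at time \<open>k\<close>, since a step increases
  it in the mean by at most its weight.\<close>

lemma (in prob_space) weighted_square_crossing_bound:
  fixes Z Y :: "nat \<Rightarrow> 'a \<Rightarrow> real" and D :: "real measure"
  assumes "indep_vars (\<lambda>_. borel) Z UNIV"
    and "\<And>i. integrable M (Z i)" "\<And>i. expectation (Z i) \<le> 0"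
    and "\<And>i \<omega>. \<omega> \<in> space M \<Longrightarrow> \<bar>Z i \<omega>\<bar> \<le> Y i \<omega>" "\<And>i \<omega>. \<omega> \<in> space M \<Longrightarrow> - K \<le> Z i \<omega>"
    and "\<And>i. Y i \<in> borel_measurable M" "\<And>i. distr M borel (Y i) = D"
    and K: "0 < K" and d: "0 \<le> d"
  shows "prob {\<omega> \<in> space M. \<exists>m\<le>N. K + real (k + m) * d < s + (\<Sum>i<m. Z i \<omega>)}
    \<le> (max 0 s)\<^sup>2 / (K + real k * d)\<^sup>2 + (\<Sum>i<N. \<integral>v. 8 * v\<^sup>2 / (v + (K + real (k + i + 1) * d))\<^sup>2 \<partial>D)"
  using assms(1-7)
proof (induction N arbitrary: Z Y k s)
  case 0
  have "0 < K + real k * d" using K d by (simp add: add_pos_nonneg)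
  then show ?case
    by (cases "s \<le> K + real k * d") (auto simp: prob_space le_divide_eq intro!: power_mono)
next
  case (Suc N)
  note [measurable] = Suc.prems(6) measurable_component_borel
  have Zm [measurable]: "Z i \<in> borel_measurable M" for i using Suc.prems(1) by (auto simp: indep_vars_def)
  define r where "r = (\<lambda>k. K + real k * d)"
  have r_pos: "0 < r k" for k using K d by (simp add: r_def add_pos_nonneg)
  have rK: "K \<le> r k" for k using d by (simp add: r_def)
  have r_Suc: "r k \<le> r (Suc k)" using d by (simp add: r_def algebra_simps)
  define q where "q = (\<lambda>j v. 8 * v\<^sup>2 / (v + r j)\<^sup>2 :: real)"
  have [measurable]: "q j \<in> borel_measurable borel" for j by (simp add: q_def)
  have q_bound: "0 \<le> q j v" "q j v \<le> 8" if "0 \<le> v" for j v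
  proof -
    have "v\<^sup>2 \<le> (v + r j)\<^sup>2" using that r_pos[of j] by (intro power_mono) auto
    then show "q j v \<le> 8" using that r_pos[of j] by (simp add: q_def divide_le_eq)
  qed (simp add: q_def)
  have Y0: "0 \<le> Y i \<omega>" if "\<omega> \<in> space M" for i \<omega> using Suc.prems(4)[OF that, of i] by simp
  have q_int: "integrable M (\<lambda>\<omega>. q j (Y i \<omega>))" for i j
    by (rule integrable_const_bound[of _ 8]) (auto simp: q_bound Y0)
  have q_D: "(\<integral>v. q j v \<partial>D) = expectation (\<lambda>\<omega>. q j (Y i \<omega>))" for i j
    using Suc.prems(7)[of i] by (subst integral_distr[symmetric, of _ _ borel]) auto
  have qD_nonneg: "0 \<le> (\<integral>v. q j v \<partial>D)" for j
    unfolding q_D[of j 0] by (auto intro!: Bochner_Integration.integral_nonneg q_bound Y0)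
  define W where "W = (\<Sum>i<N. \<integral>v. q (Suc k + i + 1) v \<partial>D)"
  have W0: "0 \<le> W" unfolding W_def by (intro sum_nonneg qD_nonneg)
  show ?case
  proof (cases "s \<le> r k")
    \<comment> \<open>The line is exceeded before any step is made, and the first term of the bound
      is already at least 1.\<close>
    case False
    then have "1 \<le> (max 0 s)\<^sup>2 / (r k)\<^sup>2"
      using r_pos[of k] by (auto simp: le_divide_eq intro!: power_mono)
    moreover have "0 \<le> (\<Sum>i<Suc N. \<integral>v. q (k + i + 1) v \<partial>D)"
      by (intro sum_nonneg qD_nonneg)
    ultimately show ?thesis
      using prob_le_1 unfolding q_def r_def by (meson add_increasing2 order_trans)
  next
    case True
    \<comment> \<open>The bound inherited from time \<open>Suc k\<close> when the first step is
      \<open>z\<close>. It is capped because the square of the step may fail to be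
      integrable.\<close>
    define h where "h = (\<lambda>z. min 1 ((max 0 (s + z))\<^sup>2 / (r (Suc k))\<^sup>2) + W)"
    define A where "A = (\<lambda>\<omega>. \<lambda>i\<in>{..<Suc 0}. Z i \<omega>)"
    define F where "F = (\<lambda>\<omega>. \<lambda>i\<in>{Suc 0..}. Z i \<omega>)"
    define E where "E = {p \<in> space (PiM {..<Suc 0} (\<lambda>_. borel) \<Otimes>\<^sub>M PiM {Suc 0..} (\<lambda>_. borel)).
        \<exists>m\<le>N. r (Suc k + m) < s + fst p 0 + (\<Sum>i<m. snd p (Suc i) :: real)}"
    have ind: "indep_var (PiM {..<Suc 0} (\<lambda>_. borel)) A (PiM {Suc 0..} (\<lambda>_. borel)) F"
      unfolding A_def F_def by (rule indep_vars_past_future[OF Suc.prems(1)])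
    have ev: "{\<omega> \<in> space M. \<exists>m\<le>Suc N. r (k + m) < s + (\<Sum>i<m. Z i \<omega>)} = {\<omega> \<in> space M. (A \<omega>, F \<omega>) \<in> E}"
    proof -
      have "(\<exists>m\<le>Suc N. r (k + m) < s + (\<Sum>i<m. Z i \<omega>)) \<longleftrightarrow>
         (\<exists>m\<le>N. r (Suc k + m) < s + Z 0 \<omega> + (\<Sum>i<m. Z (Suc i) \<omega>))" for \<omega>
      proof -
        have "(\<exists>m\<le>Suc N. r (k + m) < s + (\<Sum>i<m. Z i \<omega>)) \<longleftrightarrow>
         r k < s \<or> (\<exists>m\<le>N. r (k + Suc m) < s + (\<Sum>i<Suc m. Z i \<omega>))"
          by (auto simp: less_Suc_eq_le[symmetric] Ex_less_Suc2 simp del: sum.lessThan_Suc)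
        then show ?thesis using True by (simp add: sum.lessThan_Suc_shift add.assoc del: sum.lessThan_Suc)
      qed
      moreover have "A \<omega> \<in> space (PiM {..<Suc 0} (\<lambda>_. borel))" "F \<omega> \<in> space (PiM {Suc 0..} (\<lambda>_. borel))" for \<omega>
        by (auto simp: A_def F_def space_PiM)
      ultimately show ?thesis
        by (auto simp: E_def space_pair_measure A_def F_def)
    qed
    have "emeasure M {\<omega> \<in> space M. (A \<omega>, F \<omega>) \<in> E} \<le> (\<integral>\<^sup>+\<omega>. ennreal (h (A \<omega> 0)) \<partial>M)"
    proof (rule indep_var_emeasure_le[OF ind])
      show "E \<in> sets (PiM {..<Suc 0} (\<lambda>_. borel) \<Otimes>\<^sub>M PiM {Suc 0..} (\<lambda>_. borel))"
        unfolding E_def by measurable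
      show "(\<lambda>a. ennreal (h (a 0))) \<in> borel_measurable (PiM {..<Suc 0} (\<lambda>_. borel))"
        unfolding h_def by measurable
      fix a :: "nat \<Rightarrow> real" assume a: "a \<in> space (PiM {..<Suc 0} (\<lambda>_. borel))"
      have "{\<omega> \<in> space M. (a, F \<omega>) \<in> E} = {\<omega> \<in> space M. \<exists>m\<le>N. r (Suc k + m) < (s + a 0) + (\<Sum>i<m. Z (Suc i) \<omega>)}"
        using a by (auto simp: E_def F_def space_pair_measure space_PiM)
      moreover have "prob {\<omega> \<in> space M. \<exists>m\<le>N. r (Suc k + m) < (s + a 0) + (\<Sum>i<m. Z (Suc i) \<omega>)}
        \<le> (max 0 (s + a 0))\<^sup>2 / (r (Suc k))\<^sup>2 + W"
        unfolding W_def q_def r_def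
        by (rule Suc.IH[of "\<lambda>i. Z (Suc i)" "\<lambda>i. Y (Suc i)"])
           (use Suc.prems indep_vars_shift[OF Suc.prems(1), of 1] in auto)
      moreover have "prob {\<omega> \<in> space M. \<exists>m\<le>N. r (Suc k + m) < (s + a 0) + (\<Sum>i<m. Z (Suc i) \<omega>)} \<le> 1 + W"
        using prob_le_1 W0 by (meson add_increasing2)
      ultimately show "emeasure M {\<omega> \<in> space M. (a, F \<omega>) \<in> E} \<le> ennreal (h (a 0))"
        by (simp add: emeasure_eq_measure h_def ennreal_leI min_def)
    qed
    also have "\<dots> \<le> (\<integral>\<^sup>+\<omega>. ennreal (((max 0 s)\<^sup>2 + 2 * max 0 s * min (Z 0 \<omega>) (r (Suc k))) / (r (Suc k))\<^sup>2
         + q (Suc k) (Y 0 \<omega>) + W) \<partial>M)"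
    proof (intro nn_integral_mono ennreal_leI)
      fix \<omega> assume w: "\<omega> \<in> space M"
      have "- r (Suc k) \<le> Z 0 \<omega>" using Suc.prems(5)[OF w, of 0] rK[of "Suc k"] by simp
      from truncated_square_step_bound[OF r_pos[of "Suc k"] Suc.prems(4)[OF w, of 0] this, of s]
      show "h (A \<omega> 0) \<le> ((max 0 s)\<^sup>2 + 2 * max 0 s * min (Z 0 \<omega>) (r (Suc k))) / (r (Suc k))\<^sup>2
         + q (Suc k) (Y 0 \<omega>) + W"
        by (simp add: h_def A_def q_def)
    qed
    also have "\<dots> = ennreal (\<integral>\<omega>. ((max 0 s)\<^sup>2 + 2 * max 0 s * min (Z 0 \<omega>) (r (Suc k))) / (r (Suc k))\<^sup>2
         + q (Suc k) (Y 0 \<omega>) + W \<partial>M)"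
    proof (rule nn_integral_eq_integral)
      show "integrable M (\<lambda>\<omega>. ((max 0 s)\<^sup>2 + 2 * max 0 s * min (Z 0 \<omega>) (r (Suc k))) / (r (Suc k))\<^sup>2
         + q (Suc k) (Y 0 \<omega>) + W)"
        using Suc.prems(2)[of 0] q_int
        by (intro Bochner_Integration.integrable_add integrable_divide integrable_mult_right integrable_min) auto
      show "AE \<omega> in M. 0 \<le> ((max 0 s)\<^sup>2 + 2 * max 0 s * min (Z 0 \<omega>) (r (Suc k))) / (r (Suc k))\<^sup>2
         + q (Suc k) (Y 0 \<omega>) + W"
      proof (rule AE_I2)
        fix \<omega> assume w: "\<omega> \<in> space M"
        have "- r (Suc k) \<le> Z 0 \<omega>" using Suc.prems(5)[OF w, of 0] rK[of "Suc k"] by simp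
        from truncated_square_step_bound[OF r_pos[of "Suc k"] Suc.prems(4)[OF w, of 0] this, of s]
        have "min 1 ((max 0 (s + Z 0 \<omega>))\<^sup>2 / (r (Suc k))\<^sup>2) + W
          \<le> ((max 0 s)\<^sup>2 + 2 * max 0 s * min (Z 0 \<omega>) (r (Suc k))) / (r (Suc k))\<^sup>2
         + q (Suc k) (Y 0 \<omega>) + W" by (simp add: q_def)
        moreover have "0 \<le> min 1 ((max 0 (s + Z 0 \<omega>))\<^sup>2 / (r (Suc k))\<^sup>2) + W"
          using W0 by (auto intro!: add_nonneg_nonneg)
        ultimately show "0 \<le> ((max 0 s)\<^sup>2 + 2 * max 0 s * min (Z 0 \<omega>) (r (Suc k))) / (r (Suc k))\<^sup>2
         + q (Suc k) (Y 0 \<omega>) + W" by simp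
      qed
    qed
    finally have "prob {\<omega> \<in> space M. \<exists>m\<le>Suc N. r (k + m) < s + (\<Sum>i<m. Z i \<omega>)}
      \<le> max 0 (\<integral>\<omega>. ((max 0 s)\<^sup>2 + 2 * max 0 s * min (Z 0 \<omega>) (r (Suc k))) / (r (Suc k))\<^sup>2
         + q (Suc k) (Y 0 \<omega>) + W \<partial>M)"
      unfolding ev emeasure_eq_measure by (auto simp: ennreal_le_iff2 le_max_iff_disj)
    also have "\<dots> \<le> (max 0 s)\<^sup>2 / (r k)\<^sup>2 + (\<integral>v. q (Suc k) v \<partial>D) + W"
    proof -
      have i1: "integrable M (\<lambda>\<omega>. min (Z 0 \<omega>) (r (Suc k)))"
        using Suc.prems(2)[of 0] by (intro integrable_min) auto
      have "(\<integral>\<omega>. ((max 0 s)\<^sup>2 + 2 * max 0 s * min (Z 0 \<omega>) (r (Suc k))) / (r (Suc k))\<^sup>2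
         + q (Suc k) (Y 0 \<omega>) + W \<partial>M)
        = ((max 0 s)\<^sup>2 + 2 * max 0 s * expectation (\<lambda>\<omega>. min (Z 0 \<omega>) (r (Suc k)))) / (r (Suc k))\<^sup>2
          + (\<integral>v. q (Suc k) v \<partial>D) + W"
        using q_int i1 q_D[of "Suc k" 0] by (simp add: prob_space)
      also have "\<dots> \<le> ((max 0 s)\<^sup>2 + 2 * max 0 s * 0) / (r (Suc k))\<^sup>2 + (\<integral>v. q (Suc k) v \<partial>D) + W"
      proof -
        \<comment> \<open>Cutting a step from above only lowers its mean, so the linear term is
          nonpositive in expectation.\<close>
        have "expectation (\<lambda>\<omega>. min (Z 0 \<omega>) (r (Suc k))) \<le> expectation (Z 0)"
          using i1 Suc.prems(2)[of 0] by (intro integral_mono) auto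
        with Suc.prems(3)[of 0] show ?thesis
          by (intro add_right_mono divide_right_mono add_left_mono mult_left_mono) auto
      qed
      also have "\<dots> \<le> (max 0 s)\<^sup>2 / (r k)\<^sup>2 + (\<integral>v. q (Suc k) v \<partial>D) + W"
        using r_pos[of k] r_Suc by (auto intro!: divide_left_mono power_mono mult_pos_pos)
      finally show ?thesis
        using W0 qD_nonneg[of "Suc k"] by simp
    qed
    also have "\<dots> = (max 0 s)\<^sup>2 / (r k)\<^sup>2 + (\<Sum>i<Suc N. \<integral>v. q (k + i + 1) v \<partial>D)"
      by (simp add: W_def sum.lessThan_Suc_shift del: sum.lessThan_Suc)
    finally show ?thesis unfolding r_def q_def .
  qed
qed

text \<open>One square in the denominator is weakened to \<open>x * (x + d)\<close>, whose inverse
  is a telescoping difference.\<close>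

lemma sum_inverse_square_le:
  fixes c d :: real
  assumes "0 < c" "0 < d"
  shows "(\<Sum>i<N. 1 / (c + real (i + 1) * d)\<^sup>2) \<le> 1 / (d * c)"
proof -
  have "(\<Sum>i<N. 1 / (c + real (i + 1) * d)\<^sup>2) \<le> (1 / d) * (1 / c - 1 / (c + real N * d))"
  proof (induction N)
    case (Suc N)
    define x where "x = c + real N * d"
    have x: "0 < x" using assms by (simp add: x_def add_pos_nonneg)
    have "1 / (x + d)\<^sup>2 \<le> 1 / (x * (x + d))"
      using x assms by (intro divide_left_mono) (auto simp: power2_eq_square intro!: mult_right_mono)
    also have "\<dots> = (1 / d) * (1 / x - 1 / (x + d))"
      using x assms by (simp add: field_simps)
    finally have "1 / (x + d)\<^sup>2 \<le> (1 / d) * (1 / x - 1 / (x + d))" .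
    moreover have "c + real (Suc N) * d = x + d" "c + real (N + 1) * d = x + d"
      by (simp_all add: x_def algebra_simps)
    ultimately show ?case using Suc by (simp add: x_def[symmetric] right_diff_distrib)
  qed simp
  also have "\<dots> \<le> (1 / d) * (1 / c - 0)"
    using assms by (intro mult_left_mono diff_left_mono) (auto simp: add_pos_nonneg)
  finally show ?thesis by simp
qed

text \<open>Domination is a pointwise coupling. The majorants are merely identically distributed,
  which is all that gives the weights in the maximal inequality a common law. Truncation at
  \<open>- \<beta>\<close> produces the lower bound on the steps required there.\<close>

definition dominated_steps ::
  "real measure \<Rightarrow> real \<Rightarrow> real \<Rightarrow> 'u measure \<Rightarrow> (nat \<Rightarrow> 'u \<Rightarrow> real) \<Rightarrow> bool" where
  "dominated_steps F \<beta> \<mu> P \<xi> \<longleftrightarrow> prob_space P \<and> prob_space.indep_vars P (\<lambda>_. borel) \<xi> UNIV \<and>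
     (\<exists>\<eta>. \<forall>i. \<eta> i \<in> borel_measurable P \<and> distr P borel (\<eta> i) = F \<and> (\<forall>\<omega>\<in>space P. \<xi> i \<omega> \<le> \<eta> i \<omega>)) \<and>
     (\<forall>i. (\<integral>\<omega>. max (\<xi> i \<omega>) (- \<beta>) \<partial>P) \<le> \<mu>)"

lemma dominated_steps_shift:
  assumes "dominated_steps F \<beta> \<mu> P \<xi>"
  shows "dominated_steps F \<beta> \<mu> P (\<lambda>i. \<xi> (k + i))"
proof -
  obtain \<eta> where "\<forall>i. \<eta> i \<in> borel_measurable P \<and> distr P borel (\<eta> i) = F \<and> (\<forall>\<omega>\<in>space P. \<xi> i \<omega> \<le> \<eta> i \<omega>)"
    using assms by (auto simp: dominated_steps_def)
  then show ?thesis
    using assms unfolding dominated_steps_def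
    by (auto intro: prob_space.indep_vars_shift exI[of _ "\<lambda>i. \<eta> (k + i)"])
qed

text \<open>\<open>K0\<close> depends on \<open>F\<close>, \<open>\<beta>\<close>,
  \<open>\<mu>\<close>, \<open>d\<close>, \<open>e\<close> but neither on the steps nor on the
  horizon. Summing the weights over time leaves \<open>8 / d\<close> times the mean of
  \<open>Y^2 / (Y + K)\<close>, which tends to 0 by dominated convergence with \<open>Y\<close>
  integrable only.\<close>

lemma crossing_bound:
  fixes \<beta> \<mu> d e :: real
  assumes "integrable_dist F" "0 < d" "0 < e"
  obtains K0 where "0 < K0"
    and "\<And>(P :: 'u measure) \<xi> K N. dominated_steps F \<beta> \<mu> P \<xi> \<Longrightarrow> K0 \<le> K \<Longrightarrow>
      measure P {\<omega> \<in> space P. \<exists>n\<le>N. K + real n * (\<mu> + d) < (\<Sum>i<n. \<xi> i \<omega>)} \<le> e"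
proof -
  interpret F: integrable_dist F by fact
  \<comment> \<open>Chosen so that the centred truncated step is at most
    \<open>max \<eta> 0 + B\<close> in absolute value and at least \<open>- B\<close>, hence at
    least \<open>- K\<close> once \<open>B \<le> K\<close>.\<close>
  define B where "B = \<bar>\<beta>\<bar> + \<bar>\<mu>\<bar>"
  define Yf where "Yf = (\<lambda>z. max z 0 + B)"
  have [measurable]: "Yf \<in> borel_measurable borel" by (simp add: Yf_def)
  have Yf0: "0 \<le> Yf z" for z by (simp add: Yf_def B_def)
  have Yf_int: "integrable F Yf"
    unfolding Yf_def using F.integrable_max_const[of 0] by simp
  define g where "g = (\<lambda>K. \<integral>z. 8 / d * ((Yf z)\<^sup>2 / (Yf z + K)) \<partial>F)"
  have "((\<lambda>K. \<integral>z. 8 / d * ((Yf z)\<^sup>2 / (Yf z + K)) \<partial>F) \<longlongrightarrow> (\<integral>z. 0 \<partial>F)) at_top"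
  proof (rule integral_dominated_convergence_at_top[where w="\<lambda>z. 8 / d * Yf z"])
    show "\<forall>\<^sub>F K in at_top. AE z in F. norm (8 / d * ((Yf z)\<^sup>2 / (Yf z + K))) \<le> 8 / d * Yf z"
      using eventually_gt_at_top[of "0::real"]
    proof eventually_elim
      case (elim K)
      have "(Yf z)\<^sup>2 / (Yf z + K) \<le> Yf z" for z
        using elim Yf0[of z] by (simp add: divide_le_eq power2_eq_square add_nonneg_pos algebra_simps)
      then have "8 / d * ((Yf z)\<^sup>2 / (Yf z + K)) \<le> 8 / d * Yf z" for z
        using \<open>0 < d\<close> by (intro mult_left_mono) auto
      then show ?case
        using elim Yf0 \<open>0 < d\<close> by (auto simp: abs_mult)
    qed
    show "AE z in F. ((\<lambda>K. 8 / d * ((Yf z)\<^sup>2 / (Yf z + K))) \<longlongrightarrow> 0) at_top"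
    proof (rule AE_I2)
      fix z
      have "((\<lambda>K. (Yf z)\<^sup>2 / (Yf z + K)) \<longlongrightarrow> 0) at_top"
        by (intro tendsto_divide_0[OF tendsto_const] filterlim_at_top_imp_at_infinity
             filterlim_tendsto_add_at_top[OF tendsto_const] filterlim_ident)
      from tendsto_mult[OF tendsto_const this, of "8 / d"]
      show "((\<lambda>K. 8 / d * ((Yf z)\<^sup>2 / (Yf z + K))) \<longlongrightarrow> 0) at_top" by simp
    qed
    show "integrable F (\<lambda>z. 8 / d * Yf z)" using Yf_int by simp
  qed auto
  then have "eventually (\<lambda>K. g K < e) at_top"
    using \<open>0 < e\<close> by (intro order_tendstoD(2)) (auto simp: g_def)
  then obtain K1 where K1: "\<And>K. K1 \<le> K \<Longrightarrow> g K < e"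
    by (auto simp: eventually_at_top_linorder)
  define K0 where "K0 = max (max 1 B) K1"
  have K0: "0 < K0" "B \<le> K0" "K1 \<le> K0" by (auto simp: K0_def)
  show thesis
  proof (rule that[OF K0(1)])
    fix P :: "'u measure" and \<xi> K N
    assume ds: "dominated_steps F \<beta> \<mu> P \<xi>" and "K0 \<le> K"
    then have K: "0 < K" "B \<le> K" "K1 \<le> K" using K0 by auto
    from ds obtain \<eta> where P: "prob_space P" and ind: "prob_space.indep_vars P (\<lambda>_. borel) \<xi> UNIV"
      and eta [measurable]: "\<And>i. \<eta> i \<in> borel_measurable P" and dst: "\<And>i. distr P borel (\<eta> i) = F"
      and le: "\<And>i \<omega>. \<omega> \<in> space P \<Longrightarrow> \<xi> i \<omega> \<le> \<eta> i \<omega>"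
      and mean: "\<And>i. (\<integral>\<omega>. max (\<xi> i \<omega>) (- \<beta>) \<partial>P) \<le> \<mu>"
      unfolding dominated_steps_def by metis
    interpret P: prob_space P by fact
    have [measurable]: "\<xi> i \<in> borel_measurable P" for i using ind by (auto simp: P.indep_vars_def)
    define Z where "Z = (\<lambda>i \<omega>. max (\<xi> i \<omega>) (- \<beta>) - \<mu>)"
    define Y where "Y = (\<lambda>i \<omega>. Yf (\<eta> i \<omega>))"
    have Y_int: "integrable P (Y i)" for i
    proof -
      have "integrable (distr P borel (\<eta> i)) Yf" using Yf_int by (simp add: dst)
      then show ?thesis unfolding Y_def by (subst (asm) integrable_distr_eq) auto
    qed
    have ZY: "\<bar>Z i \<omega>\<bar> \<le> Y i \<omega>" if "\<omega> \<in> space P" for i \<omega>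
      using le[OF that, of i] unfolding Z_def Y_def Yf_def B_def by linarith
    have Z_int: "integrable P (Z i)" for i
      by (rule Bochner_Integration.integrable_bound[OF Y_int[of i]])
         (auto simp: Z_def intro!: AE_I2 order_trans[OF ZY[unfolded Z_def] abs_ge_self])
    have max_int: "integrable P (\<lambda>\<omega>. max (\<xi> i \<omega>) (- \<beta>))" for i
      using Bochner_Integration.integrable_add[OF Z_int[of i] P.integrable_const[of \<mu>]]
      by (simp add: Z_def)
    \<comment> \<open>Started at level 0 and time 0, so the squared initial term vanishes and only
      the weights remain.\<close>
    have "P.prob {\<omega> \<in> space P. \<exists>m\<le>N. K + real (0 + m) * d < 0 + (\<Sum>i<m. Z i \<omega>)}
      \<le> (max 0 0)\<^sup>2 / (K + real 0 * d)\<^sup>2 +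
        (\<Sum>i<N. \<integral>v. 8 * v\<^sup>2 / (v + (K + real (0 + i + 1) * d))\<^sup>2 \<partial>distr F borel Yf)"
    proof (rule P.weighted_square_crossing_bound[where Y=Y])
      show "P.indep_vars (\<lambda>_. borel) Z UNIV"
        unfolding Z_def by (rule P.indep_vars_compose2[OF ind]) auto
      show "P.expectation (Z i) \<le> 0" for i
        using mean[of i] max_int[of i] by (simp add: Z_def P.prob_space)
      show "- K \<le> Z i \<omega>" for i \<omega>
        using K by (auto simp: Z_def B_def)
      show "distr P borel (Y i) = distr F borel Yf" for i
        unfolding dst[of i, symmetric] Y_def by (subst distr_distr) (auto simp: comp_def)
    qed (use ZY Z_int K \<open>0 < d\<close> in \<open>auto simp: Y_def\<close>)
    also have "\<dots> = (\<Sum>i<N. \<integral>z. 8 * (Yf z)\<^sup>2 / (Yf z + (K + real (i + 1) * d))\<^sup>2 \<partial>F)"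
      by (simp add: integral_distr)
    also have "\<dots> = (\<integral>z. (\<Sum>i<N. 8 * (Yf z)\<^sup>2 / (Yf z + (K + real (i + 1) * d))\<^sup>2) \<partial>F)"
    proof (rule Bochner_Integration.integral_sum[symmetric])
      fix i
      show "integrable F (\<lambda>z. 8 * (Yf z)\<^sup>2 / (Yf z + (K + real (i + 1) * d))\<^sup>2)"
      proof (rule F.integrable_const_bound[of _ 8])
        have "8 * (Yf z)\<^sup>2 / (Yf z + (K + real (i + 1) * d))\<^sup>2 \<le> 8" for z
        proof -
          have "(Yf z)\<^sup>2 \<le> (Yf z + (K + real (i + 1) * d))\<^sup>2"
            using Yf0[of z] K \<open>0 < d\<close> by (intro power_mono) auto
          moreover have "0 < Yf z + (K + real (i + 1) * d)"
            using Yf0[of z] K \<open>0 < d\<close> by (intro add_nonneg_pos add_pos_nonneg) auto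
          ultimately show ?thesis by (simp add: divide_le_eq)
        qed
        then show "AE z in F. norm (8 * (Yf z)\<^sup>2 / (Yf z + (K + real (i + 1) * d))\<^sup>2) \<le> 8" by simp
      qed simp
    qed
    also have "\<dots> \<le> g K"
      unfolding g_def
    proof (rule integral_mono_AE')
      show "integrable F (\<lambda>z. 8 / d * ((Yf z)\<^sup>2 / (Yf z + K)))"
      proof (rule Bochner_Integration.integrable_bound[of _ "\<lambda>z. 8 / d * Yf z"])
        have "(Yf z)\<^sup>2 / (Yf z + K) \<le> Yf z" for z
          using K Yf0[of z] by (simp add: divide_le_eq power2_eq_square add_nonneg_pos algebra_simps)
        then have "8 / d * ((Yf z)\<^sup>2 / (Yf z + K)) \<le> 8 / d * Yf z" for z
          using \<open>0 < d\<close> by (intro mult_left_mono) auto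
        then show "AE z in F. norm (8 / d * ((Yf z)\<^sup>2 / (Yf z + K))) \<le> norm (8 / d * Yf z)"
          using K Yf0 \<open>0 < d\<close> by (auto simp: abs_mult)
      qed (use Yf_int in auto)
      show "AE z in F. (\<Sum>i<N. 8 * (Yf z)\<^sup>2 / (Yf z + (K + real (i + 1) * d))\<^sup>2) \<le> 8 / d * ((Yf z)\<^sup>2 / (Yf z + K))"
      proof (rule AE_I2)
        fix z
        have "(\<Sum>i<N. 8 * (Yf z)\<^sup>2 / (Yf z + (K + real (i + 1) * d))\<^sup>2)
          = 8 * (Yf z)\<^sup>2 * (\<Sum>i<N. 1 / (Yf z + K + real (i + 1) * d)\<^sup>2)"
          by (simp add: sum_distrib_left add.assoc)
        also have "\<dots> \<le> 8 * (Yf z)\<^sup>2 * (1 / (d * (Yf z + K)))"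
          using K Yf0[of z] \<open>0 < d\<close> by (intro mult_left_mono sum_inverse_square_le) auto
        finally show "(\<Sum>i<N. 8 * (Yf z)\<^sup>2 / (Yf z + (K + real (i + 1) * d))\<^sup>2) \<le> 8 / d * ((Yf z)\<^sup>2 / (Yf z + K))"
          by simp
      qed
      show "AE z in F. 0 \<le> 8 / d * ((Yf z)\<^sup>2 / (Yf z + K))"
        using K Yf0 \<open>0 < d\<close> by auto
    qed
    also have "\<dots> \<le> e" using K1[OF K(3)] by simp
    finally have b: "P.prob {\<omega> \<in> space P. \<exists>m\<le>N. K + real m * d < (\<Sum>i<m. Z i \<omega>)} \<le> e" by simp
    have "P.prob {\<omega> \<in> space P. \<exists>n\<le>N. K + real n * (\<mu> + d) < (\<Sum>i<n. \<xi> i \<omega>)}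
      \<le> P.prob {\<omega> \<in> space P. \<exists>m\<le>N. K + real m * d < (\<Sum>i<m. Z i \<omega>)}"
    proof (intro P.finite_measure_mono subsetI CollectI conjI)
      fix \<omega> assume "\<omega> \<in> {\<omega> \<in> space P. \<exists>n\<le>N. K + real n * (\<mu> + d) < (\<Sum>i<n. \<xi> i \<omega>)}"
      then obtain n where n: "n \<le> N" "\<omega> \<in> space P" "K + real n * (\<mu> + d) < (\<Sum>i<n. \<xi> i \<omega>)" by auto
      have "(\<Sum>i<n. \<xi> i \<omega>) \<le> (\<Sum>i<n. Z i \<omega> + \<mu>)" by (intro sum_mono) (simp add: Z_def)
      also have "\<dots> = (\<Sum>i<n. Z i \<omega>) + real n * \<mu>" by (simp add: sum.distrib)
      finally show "\<omega> \<in> space P" "\<exists>m\<le>N. K + real m * d < (\<Sum>i<m. Z i \<omega>)"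
        using n by (auto intro!: exI[of _ n] simp: algebra_simps)
    qed (simp add: Z_def)
    with b show "P.prob {\<omega> \<in> space P. \<exists>n\<le>N. K + real n * (\<mu> + d) < (\<Sum>i<n. \<xi> i \<omega>)} \<le> e"
      by simp
  qed
qed

section \<open>Decomposition at the first crossing of a line\<close>

context subexp_dist
begin

text \<open>\<open>later\<close> bounds the walk restarted at the crossing time, and
  \<open>jump\<close> makes the law of the position at that time, beyond \<open>L\<close>,
  comparable to \<open>c * tail H\<close>; with both, the intermediate range is governed by
  \<open>two_jumps\<close>. The bounds are for one fixed law \<open>P\<close> and carry over to
  averages over environments.\<close>

lemma big_jump_decomposition:
  fixes P :: "'u measure" and \<xi> :: "nat \<Rightarrow> 'u \<Rightarrow> real" and a K L y c D :: real
  defines "S \<equiv> (\<lambda>n \<omega>. \<Sum>i<n. \<xi> i \<omega>)"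
  assumes P: "prob_space P" and ind: "prob_space.indep_vars P (\<lambda>_. borel) \<xi> UNIV"
    and later: "\<And>n t. 1 \<le> n \<Longrightarrow> n \<le> N \<Longrightarrow>
      measure P {\<omega> \<in> space P. \<exists>m\<le>N - n. t < (\<Sum>i<m. \<xi> (n + i) \<omega>)} \<le> min 1 (D * tail H t)"
    and jump: "\<And>t. L \<le> t \<Longrightarrow> (\<Sum>n<N. measure P {\<omega> \<in> space P. t - K + real n * a < \<xi> n \<omega>}) \<le> c * tail H t"
    and nonneg: "0 \<le> K" "0 \<le> a" "0 \<le> L" "0 \<le> D" "0 \<le> c" and y: "K \<le> y"
  shows "ennreal (measure P {\<omega> \<in> space P. \<exists>n\<le>N. y < S n \<omega>})
    \<le> ennreal (measure P {\<omega> \<in> space P. \<exists>n\<le>N. K - real n * a < S n \<omega>} * (D * tail H (y - L)))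
      + ennreal D * (ennreal c * two_jumps H L y)
      + ennreal (\<Sum>n<N. measure P {\<omega> \<in> space P. y - L - K + real n * a < \<xi> n \<omega>})"
proof -
  interpret P: prob_space P by fact
  note measurable_component_borel [measurable]
  have [measurable]: "\<xi> i \<in> borel_measurable P" for i using ind by (auto simp: P.indep_vars_def)
  have [measurable]: "S n \<in> borel_measurable P" for n by (simp add: S_def)
  \<comment> \<open>\<open>A n\<close>: the line is exceeded for the first time at time \<open>n\<close>; \<open>R\<close>: the position at that time\<close>
  define A where "A = (\<lambda>n. {\<omega> \<in> space P. (\<forall>j<n. S j \<omega> \<le> K - real j * a) \<and> K - real n * a < S n \<omega>})"
  have [measurable]: "A n \<in> sets P" for n unfolding A_def by measurable
  have A_disj: "m = n" if "\<omega> \<in> A m" "\<omega> \<in> A n" for m n \<omega>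
    using that by (auto simp: A_def) (metis linorder_neqE_nat not_less)
  \<comment> \<open>One time unit earlier the walk was not above the line, so to be above
    \<open>t\<close> now it needs a step larger than \<open>t\<close> minus the height of the line
    there.\<close>
  have A_jump: "t - K + real (n - 1) * a < \<xi> (n - 1) \<omega>"
    if "\<omega> \<in> A n" "t < S n \<omega>" "1 \<le> n" for n t \<omega>
  proof -
    from that have "\<forall>j<n. S j \<omega> \<le> K - real j * a" by (simp add: A_def)
    moreover have "n - 1 < n" using that(3) by simp
    ultimately have "S (n - 1) \<omega> \<le> K - real (n - 1) * a" by blast
    moreover have "S n \<omega> = S (n - 1) \<omega> + \<xi> (n - 1) \<omega>"
      using that(3) unfolding S_def by (cases n) auto
    ultimately show ?thesis using that(2) by linarith
  qed
  have jumps: "(\<Sum>n\<in>{1..N}. P.prob {\<omega> \<in> A n. t < S n \<omega>})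
     \<le> (\<Sum>n<N. P.prob {\<omega> \<in> space P. t - K + real n * a < \<xi> n \<omega>})" for t
  proof -
    have "(\<Sum>n\<in>{1..N}. P.prob {\<omega> \<in> A n. t < S n \<omega>})
      \<le> (\<Sum>n\<in>{1..N}. P.prob {\<omega> \<in> space P. t - K + real (n - 1) * a < \<xi> (n - 1) \<omega>})"
      using A_jump by (intro sum_mono P.finite_measure_mono) (auto simp: A_def)
    also have "\<dots> = (\<Sum>n<N. P.prob {\<omega> \<in> space P. t - K + real n * a < \<xi> n \<omega>})"
      by (rule sum.reindex_bij_witness[of _ Suc "\<lambda>n. n - 1"]) auto
    finally show ?thesis .
  qed
  define B where "B = (\<lambda>n. {\<omega> \<in> A n. \<exists>m\<le>N - n. y - S n \<omega> < (\<Sum>i<m. \<xi> (n + i) \<omega>)})"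
  have [measurable]: "B n \<in> sets P" for n unfolding B_def by measurable
  have cover: "{\<omega> \<in> space P. \<exists>n\<le>N. y < S n \<omega>} \<subseteq> (\<Union>n\<in>{1..N}. B n)"
  proof
    fix \<omega> assume "\<omega> \<in> {\<omega> \<in> space P. \<exists>n\<le>N. y < S n \<omega>}"
    then obtain m where m: "\<omega> \<in> space P" "m \<le> N" "y < S m \<omega>" by auto
    \<comment> \<open>Since \<open>K \<le> y\<close> and the line descends, exceeding
      \<open>y\<close> entails exceeding the line. The least such time is positive because the walk
      starts at 0 and \<open>0 \<le> K\<close>.\<close>
    define n where "n = (LEAST n. K - real n * a < S n \<omega>)"
    have "0 \<le> real m * a" using nonneg by simp
    then have "K - real m * a < S m \<omega>" using m y by linarith
    then have n: "K - real n * a < S n \<omega>" "n \<le> m" "\<And>j. j < n \<Longrightarrow> \<not> K - real j * a < S j \<omega>"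
      unfolding n_def by (auto intro: LeastI Least_le dest: not_less_Least)
    have n1: "1 \<le> n" using n(1) nonneg by (cases n) (auto simp: S_def)
    have "S m \<omega> = S n \<omega> + (\<Sum>i<m - n. \<xi> (n + i) \<omega>)"
      unfolding S_def using sum.atLeastLessThan_concat[of 0 n m "\<lambda>i. \<xi> i \<omega>"] n(2)
        sum.shift_bounds_nat_ivl[of "\<lambda>i. \<xi> i \<omega>" 0 n "m - n"]
      by (simp add: lessThan_atLeast0 add.commute)
    with m n n1 have "\<omega> \<in> B n"
      by (auto simp: B_def A_def not_less intro!: exI[of _ "m - n"])
    with n n1 m show "\<omega> \<in> (\<Union>n\<in>{1..N}. B n)" by auto
  qed
  \<comment> \<open>The first \<open>n\<close> steps are frozen: they determine \<open>A n\<close>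
    and \<open>S n\<close>, and the remaining steps are independent of them and subject to
    \<open>later\<close>.\<close>
  have Bn: "emeasure P (B n) \<le> (\<integral>\<^sup>+\<omega>. indicator (A n) \<omega> * ennreal (min 1 (D * tail H (y - S n \<omega>))) \<partial>P)"
    if n: "1 \<le> n" "n \<le> N" for n
  proof -
    define good where "good = (\<lambda>a'. (\<forall>j<n. (\<Sum>i<j. a' i) \<le> K - real j * a) \<and> K - real n * a < (\<Sum>i<n. a' i :: real))"
    have [measurable]: "Measurable.pred (PiM {..<n} (\<lambda>_. borel)) good" unfolding good_def by measurable
    define E where "E = {p \<in> space (PiM {..<n} (\<lambda>_. borel) \<Otimes>\<^sub>M PiM {n..} (\<lambda>_. borel)). good (fst p) \<and>
        (\<exists>m\<le>N - n. y - (\<Sum>i<n. fst p i) < (\<Sum>i<m. snd p (n + i)))}"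
    define h where "h = (\<lambda>a'. if good a' then ennreal (min 1 (D * tail H (y - (\<Sum>i<n. a' i)))) else 0)"
    let ?X = "\<lambda>\<omega>. \<lambda>i\<in>{..<n}. \<xi> i \<omega>" and ?Y = "\<lambda>\<omega>. \<lambda>i\<in>{n..}. \<xi> i \<omega>"
    have sX': "(\<Sum>i<j. ?X \<omega> i) = S j \<omega>" if "j \<le> n" for j \<omega>
      unfolding S_def using that by (intro sum.cong) auto
    then have sX: "(\<Sum>i<n. ?X \<omega> i) = S n \<omega>" for \<omega> by blast
    have gX: "good (?X \<omega>) \<longleftrightarrow> \<omega> \<in> A n" if "\<omega> \<in> space P" for \<omega>
    proof -
      have "(\<forall>j<n. (\<Sum>i<j. ?X \<omega> i) \<le> K - real j * a) \<longleftrightarrow> (\<forall>j<n. S j \<omega> \<le> K - real j * a)"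
        using sX'[of _ \<omega>] by (metis less_imp_le)
      then show ?thesis
        using that unfolding good_def A_def sX by simp
    qed
    have "B n = {\<omega> \<in> space P. (?X \<omega>, ?Y \<omega>) \<in> E}"
    proof -
      have "(\<Sum>i<m. ?Y \<omega> (n + i)) = (\<Sum>i<m. \<xi> (n + i) \<omega>)" for m \<omega> by simp
      moreover have "?X \<omega> \<in> space (PiM {..<n} (\<lambda>_. borel))" "?Y \<omega> \<in> space (PiM {n..} (\<lambda>_. borel))" for \<omega>
        by (auto simp: space_PiM)
      moreover have "\<omega> \<in> space P" if "\<omega> \<in> A n" for \<omega> using that by (simp add: A_def)
      ultimately show ?thesis
        unfolding B_def E_def using gX sX by (auto simp: space_pair_measure)
    qed
    then have "emeasure P (B n) = emeasure P {\<omega> \<in> space P. (?X \<omega>, ?Y \<omega>) \<in> E}" by simp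
    also have "\<dots> \<le> (\<integral>\<^sup>+\<omega>. h (?X \<omega>) \<partial>P)"
    proof (rule P.indep_var_emeasure_le[OF P.indep_vars_past_future[OF ind]])
      show "E \<in> sets (PiM {..<n} (\<lambda>_. borel) \<Otimes>\<^sub>M PiM {n..} (\<lambda>_. borel))"
        unfolding E_def by measurable
      show "h \<in> borel_measurable (PiM {..<n} (\<lambda>_. borel))" unfolding h_def by measurable
      fix a' :: "nat \<Rightarrow> real" assume a': "a' \<in> space (PiM {..<n} (\<lambda>_. borel))"
      show "emeasure P {\<omega> \<in> space P. (a', ?Y \<omega>) \<in> E} \<le> h a'"
      proof (cases "good a'")
        case True
        then have "{\<omega> \<in> space P. (a', ?Y \<omega>) \<in> E}
          = {\<omega> \<in> space P. \<exists>m\<le>N - n. y - (\<Sum>i<n. a' i) < (\<Sum>i<m. \<xi> (n + i) \<omega>)}"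
          using a' by (auto simp: E_def space_pair_measure space_PiM)
        with True later[OF n, of "y - (\<Sum>i<n. a' i)"] show ?thesis
          by (simp add: P.emeasure_eq_measure h_def ennreal_leI)
      next
        case False
        then have "{\<omega> \<in> space P. (a', ?Y \<omega>) \<in> E} = {}" by (auto simp: E_def)
        then show ?thesis by (metis emeasure_empty zero_le)
      qed
    qed
    also have "\<dots> = (\<integral>\<^sup>+\<omega>. indicator (A n) \<omega> * ennreal (min 1 (D * tail H (y - S n \<omega>))) \<partial>P)"
    proof (rule nn_integral_cong)
      fix \<omega> assume w: "\<omega> \<in> space P"
      show "h (?X \<omega>) = indicator (A n) \<omega> * ennreal (min 1 (D * tail H (y - S n \<omega>)))"
        unfolding h_def sX gX[OF w] by simp
    qed
    finally show ?thesis .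
  qed
  \<comment> \<open>The position at the crossing time, with default value 0 if there is no crossing
    up to \<open>N\<close>. The default is harmless, as only values of \<open>R\<close> above
    \<open>L \<ge> 0\<close> are considered.\<close>
  define R where "R = (\<lambda>\<omega>. \<Sum>n\<in>{1..N}. indicator (A n) \<omega> * S n \<omega>)"
  have [measurable]: "R \<in> borel_measurable P" unfolding R_def by measurable
  have R_eq: "R \<omega> = S n \<omega>" if "\<omega> \<in> A n" "1 \<le> n" "n \<le> N" for \<omega> n
  proof -
    have "R \<omega> = (\<Sum>k\<in>{1..N}. if k = n then S n \<omega> else 0)"
      unfolding R_def using that A_disj by (intro sum.cong) (auto split: split_indicator)
    with that show ?thesis by simp
  qed
  have R_ex: "\<exists>n\<in>{1..N}. \<omega> \<in> A n \<and> R \<omega> = S n \<omega>" if "0 < R \<omega>" for \<omega>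
  proof -
    have "\<exists>n\<in>{1..N}. \<omega> \<in> A n"
    proof (rule ccontr)
      assume "\<not> (\<exists>n\<in>{1..N}. \<omega> \<in> A n)"
      then have "R \<omega> = 0" unfolding R_def by (intro sum.neutral ballI) simp
      with that show False by simp
    qed
    then obtain n where n: "n \<in> {1..N}" "\<omega> \<in> A n" by blast
    then show ?thesis using R_eq[OF n(2)] by (intro bexI[OF _ n(1)]) simp
  qed
  have R_tail: "emeasure (distr P borel R) {t<..} \<le> ennreal c * ennreal (tail H t)" if "L \<le> t" for t
  proof -
    have "emeasure (distr P borel R) {t<..} = emeasure P {\<omega> \<in> space P. t < R \<omega>}"
      by (subst emeasure_distr) (auto intro!: arg_cong[where f="emeasure P"])
    also have "\<dots> \<le> emeasure P (\<Union>n\<in>{1..N}. {\<omega> \<in> A n. t < S n \<omega>})"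
    proof (rule emeasure_mono)
      show "{\<omega> \<in> space P. t < R \<omega>} \<subseteq> (\<Union>n\<in>{1..N}. {\<omega> \<in> A n. t < S n \<omega>})"
      proof
        fix \<omega> assume "\<omega> \<in> {\<omega> \<in> space P. t < R \<omega>}"
        then have "t < R \<omega>" by simp
        then obtain n where "n \<in> {1..N}" "\<omega> \<in> A n" "R \<omega> = S n \<omega>"
          using R_ex[of \<omega>] nonneg \<open>L \<le> t\<close> by auto
        with \<open>t < R \<omega>\<close> show "\<omega> \<in> (\<Union>n\<in>{1..N}. {\<omega> \<in> A n. t < S n \<omega>})" by auto
      qed
    qed measurable
    also have "\<dots> \<le> (\<Sum>n\<in>{1..N}. emeasure P {\<omega> \<in> A n. t < S n \<omega>})"
      by (rule emeasure_subadditive_finite) auto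
    also have "\<dots> = ennreal (\<Sum>n\<in>{1..N}. P.prob {\<omega> \<in> A n. t < S n \<omega>})"
      by (simp add: P.emeasure_eq_measure sum_ennreal)
    also have "\<dots> \<le> ennreal (c * tail H t)"
      using jumps[of t] jump[OF that] by (intro ennreal_leI) simp
    finally show ?thesis using nonneg by (simp add: ennreal_mult')
  qed
  \<comment> \<open>For a position up to \<open>y - L\<close> the bound with \<open>D\<close> is
    used, and above \<open>y - L\<close> the trivial bound 1. In the middle range
    \<open>y - R \<omega>\<close> is at least \<open>L\<close>, which gives the form with
    \<open>max L\<close>.\<close>
  have split3: "indicator (A n) \<omega> * ennreal (min 1 (D * tail H (y - S n \<omega>)))
     \<le> ennreal (D * tail H (y - L)) * indicator (A n) \<omega>
       + indicator (A n) \<omega> * (ennreal D * (ennreal (tail H (max L (y - R \<omega>))) * indicator {L<..} (R \<omega>)))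
       + indicator {\<omega> \<in> A n. y - L < S n \<omega>} \<omega>"
    if n: "1 \<le> n" "n \<le> N" for n \<omega>
  proof (cases "\<omega> \<in> A n")
    case True
    consider "S n \<omega> \<le> L" | "L < S n \<omega>" "S n \<omega> \<le> y - L" | "y - L < S n \<omega>" by linarith
    then show ?thesis
    proof cases
      case 1
      then have "min 1 (D * tail H (y - S n \<omega>)) \<le> D * tail H (y - L)"
        using nonneg by (auto intro!: min.coboundedI2 mult_left_mono tail_antimono)
      then show ?thesis using True by (auto simp: ennreal_leI intro!: add_increasing2)
    next
      case 2
      then have "min 1 (D * tail H (y - S n \<omega>)) \<le> D * tail H (max L (y - R \<omega>))"
        using R_eq[OF True n] by (auto simp: max_def)
      then show ?thesis using True 2 R_eq[OF True n] nonneg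
        by (auto simp: ennreal_leI ennreal_mult'[symmetric] intro!: add_increasing2 add_increasing)
    next
      case 3
      then show ?thesis using True by (auto intro!: add_increasing simp: ennreal_le_1)
    qed
  qed simp
  have sumA: "(\<Sum>n\<in>{1..N}. emeasure P (A n)) \<le> ennreal (P.prob {\<omega> \<in> space P. \<exists>n\<le>N. K - real n * a < S n \<omega>})"
  proof -
    have "(\<Sum>n\<in>{1..N}. emeasure P (A n)) = emeasure P (\<Union>n\<in>{1..N}. A n)"
      using A_disj by (intro sum_emeasure) (auto simp: disjoint_family_on_def)
    also have "\<dots> \<le> emeasure P {\<omega> \<in> space P. \<exists>n\<le>N. K - real n * a < S n \<omega>}"
      by (rule emeasure_mono) (auto simp: A_def)
    finally show ?thesis by (simp add: P.emeasure_eq_measure)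
  qed
  have sumA1: "(\<Sum>n\<in>{1..N}. indicator (A n) \<omega> :: ennreal) \<le> 1" for \<omega>
  proof (cases "\<exists>n\<in>{1..N}. \<omega> \<in> A n")
    case True
    then obtain n where n: "n \<in> {1..N}" "\<omega> \<in> A n" by auto
    have "(\<Sum>k\<in>{1..N}. indicator (A k) \<omega> :: ennreal) = (\<Sum>k\<in>{1..N}. if k = n then 1 else 0)"
      using n A_disj by (intro sum.cong) (auto split: split_indicator)
    then show ?thesis using n by simp
  qed simp
  have "ennreal (P.prob {\<omega> \<in> space P. \<exists>n\<le>N. y < S n \<omega>}) \<le> emeasure P (\<Union>n\<in>{1..N}. B n)"
    unfolding P.emeasure_eq_measure[symmetric] by (intro emeasure_mono cover) measurable
  also have "\<dots> \<le> (\<Sum>n\<in>{1..N}. emeasure P (B n))"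
    by (rule emeasure_subadditive_finite) auto
  also have "\<dots> \<le> (\<Sum>n\<in>{1..N}. \<integral>\<^sup>+\<omega>. indicator (A n) \<omega> * ennreal (min 1 (D * tail H (y - S n \<omega>))) \<partial>P)"
    by (intro sum_mono Bn) auto
  also have "\<dots> \<le> (\<Sum>n\<in>{1..N}. \<integral>\<^sup>+\<omega>. ennreal (D * tail H (y - L)) * indicator (A n) \<omega>
       + indicator (A n) \<omega> * (ennreal D * (ennreal (tail H (max L (y - R \<omega>))) * indicator {L<..} (R \<omega>)))
       + indicator {\<omega> \<in> A n. y - L < S n \<omega>} \<omega> \<partial>P)"
    by (intro sum_mono nn_integral_mono split3) auto
  also have "\<dots> = ennreal (D * tail H (y - L)) * (\<Sum>n\<in>{1..N}. emeasure P (A n))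
     + (\<integral>\<^sup>+\<omega>. (\<Sum>n\<in>{1..N}. indicator (A n) \<omega>) *
          (ennreal D * (ennreal (tail H (max L (y - R \<omega>))) * indicator {L<..} (R \<omega>))) \<partial>P)
     + (\<Sum>n\<in>{1..N}. emeasure P {\<omega> \<in> A n. y - L < S n \<omega>})"
    by (simp add: nn_integral_add nn_integral_cmult_indicator sum.distrib sum_distrib_left
        nn_integral_sum[symmetric] sum_distrib_right)
  also have "\<dots> \<le> ennreal (D * tail H (y - L)) * ennreal (P.prob {\<omega> \<in> space P. \<exists>n\<le>N. K - real n * a < S n \<omega>})
     + ennreal D * (ennreal c * two_jumps H L y)
     + ennreal (\<Sum>n<N. P.prob {\<omega> \<in> space P. y - L - K + real n * a < \<xi> n \<omega>})"
  proof (intro add_mono mult_left_mono sumA)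
    have "(\<integral>\<^sup>+\<omega>. (\<Sum>n\<in>{1..N}. indicator (A n) \<omega>) *
          (ennreal D * (ennreal (tail H (max L (y - R \<omega>))) * indicator {L<..} (R \<omega>))) \<partial>P)
       \<le> (\<integral>\<^sup>+\<omega>. ennreal D * (ennreal (tail H (max L (y - R \<omega>))) * indicator {L<..} (R \<omega>)) \<partial>P)"
    proof (rule nn_integral_mono)
      fix \<omega>
      show "(\<Sum>n\<in>{1..N}. indicator (A n) \<omega>) *
          (ennreal D * (ennreal (tail H (max L (y - R \<omega>))) * indicator {L<..} (R \<omega>)))
         \<le> ennreal D * (ennreal (tail H (max L (y - R \<omega>))) * indicator {L<..} (R \<omega>))"
        using mult_right_mono[OF sumA1[of \<omega>]] by simp
    qed
    also have "\<dots> = ennreal D * (\<integral>\<^sup>+x\<in>{L<..}. ennreal (tail H (max L (y - x))) \<partial>distr P borel R)"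
      by (subst nn_integral_cmult) (auto simp: nn_integral_distr)
    also have "\<dots> \<le> ennreal D * (ennreal c * two_jumps H L y)"
      using R_tail by (intro mult_left_mono two_jumps_dominates) (auto intro!: P.finite_measure_distr)
    finally show "(\<integral>\<^sup>+\<omega>. (\<Sum>n\<in>{1..N}. indicator (A n) \<omega>) *
          (ennreal D * (ennreal (tail H (max L (y - R \<omega>))) * indicator {L<..} (R \<omega>))) \<partial>P)
       \<le> ennreal D * (ennreal c * two_jumps H L y)" .
    show "(\<Sum>n\<in>{1..N}. emeasure P {\<omega> \<in> A n. y - L < S n \<omega>})
      \<le> ennreal (\<Sum>n<N. P.prob {\<omega> \<in> space P. y - L - K + real n * a < \<xi> n \<omega>})"
      using jumps[of "y - L"] by (simp add: P.emeasure_eq_measure sum_ennreal ennreal_leI)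
  qed auto
  finally show ?thesis
    using nonneg by (simp add: ennreal_mult'[symmetric] tail_bounds mult.commute)
qed

end

section \<open>Asymptotics relative to the positive part of the integrated tail law\<close>

locale heavy_int_tail = subexp_dist H + F: integrable_dist F for H F +
  assumes tail_H: "0 \<le> y \<Longrightarrow> tail H y = int_tail F y"
begin

text \<open>Far out the cap at 1 is inactive, so stop-loss, integrated tail and the tail of
  \<open>H\<close> can be interchanged in all limits.\<close>

lemma stop_loss_eq_tail: "eventually (\<lambda>y. stop_loss F y = tail H y) at_top"
proof -
  have "eventually (\<lambda>y. stop_loss F y < 1) at_top"
    by (rule order_tendstoD(2)[OF F.tendsto_stop_loss]) simp
  then show ?thesis
    using eventually_ge_at_top[of 0]
    by eventually_elim (simp add: tail_H F.int_tail_eq)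
qed

lemma filterlim_shift: "filterlim (\<lambda>y::real. y + b) at_top at_top"
  using filterlim_tendsto_add_at_top[OF tendsto_const[of b] filterlim_ident] by (simp add: add.commute)

lemma stop_loss_shift: "((\<lambda>y. stop_loss F (y + b) / tail H y) \<longlongrightarrow> 1) at_top"
proof -
  have "eventually (\<lambda>y. stop_loss F (y + b) / tail H y = tail H (y - (- b)) / tail H y) at_top"
    using eventually_compose_filterlim[OF stop_loss_eq_tail filterlim_shift[of b]]
    by eventually_elim simp
  then show ?thesis
    using long_tailed[of "- b"] by (subst tendsto_cong)
qed

lemma eventually_stop_loss_le:
  assumes "1 < r"
  shows "eventually (\<lambda>y. stop_loss F (y + b) \<le> r * tail H y) at_top"
  using order_tendstoD(2)[OF stop_loss_shift[of b] assms]
  by eventually_elim (use tail_pos in \<open>auto simp: divide_less_eq not_less less_imp_le\<close>)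

text \<open>A tail value is at most a unit difference of the stop-loss, and both stop-loss values
  are asymptotic to \<open>tail H y\<close> because \<open>H\<close> is long-tailed.\<close>

lemma tail_F_negligible: "((\<lambda>y. tail F (y + b) / tail H y) \<longlongrightarrow> 0) at_top"
proof (rule tendsto_sandwich)
  show "eventually (\<lambda>y. 0 \<le> tail F (y + b) / tail H y) at_top"
    by (simp add: F.tail_bounds tail_bounds)
  have "tail F (y + b) / tail H y \<le> stop_loss F (y + (b - 1)) / tail H y - stop_loss F (y + b) / tail H y" for y
  proof -
    have "tail F (y + b) \<le> stop_loss F (y + (b - 1)) - stop_loss F (y + b)"
      using F.stop_loss_diff(1)[of 1 "y + (b - 1)"] by simp
    then have "tail F (y + b) / tail H y \<le> (stop_loss F (y + (b - 1)) - stop_loss F (y + b)) / tail H y"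
      using tail_pos[of y] by (intro divide_right_mono) auto
    then show ?thesis by (simp add: diff_divide_distrib)
  qed
  then show "eventually (\<lambda>y. tail F (y + b) / tail H y
      \<le> stop_loss F (y + (b - 1)) / tail H y - stop_loss F (y + b) / tail H y) at_top"
    by (intro always_eventually allI)
  show "((\<lambda>y. stop_loss F (y + (b - 1)) / tail H y - stop_loss F (y + b) / tail H y) \<longlongrightarrow> 0) at_top"
    using tendsto_diff[OF stop_loss_shift stop_loss_shift] by simp
qed simp

lemma dominated_steps_tail:
  assumes ds: "dominated_steps F \<beta> \<mu> P \<xi>"
  shows "measure P {\<omega> \<in> space P. t < \<xi> n \<omega>} \<le> tail F t"
proof -
  interpret P: prob_space P using ds by (simp add: dominated_steps_def)
  obtain \<eta> where [measurable]: "\<eta> n \<in> borel_measurable P" and dst: "distr P borel (\<eta> n) = F"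
    and le: "\<forall>\<omega>\<in>space P. \<xi> n \<omega> \<le> \<eta> n \<omega>"
    using ds by (auto simp: dominated_steps_def)
  have "P.prob {\<omega> \<in> space P. t < \<xi> n \<omega>} \<le> P.prob {\<omega> \<in> space P. t < \<eta> n \<omega>}"
    using le by (intro P.finite_measure_mono) (auto intro: less_le_trans)
  also have "\<dots> = measure (distr P borel (\<eta> n)) {t<..}"
    by (subst measure_distr) (auto intro!: arg_cong[where f=P.prob])
  finally show ?thesis by (simp add: dst tail_def)
qed

lemma dominated_steps_jumps:
  assumes ds: "dominated_steps F \<beta> \<mu> P \<xi>" and "0 < a"
  shows "(\<Sum>n<N. measure P {\<omega> \<in> space P. t + real n * a < \<xi> n \<omega>}) \<le> stop_loss F (t - a) / a"
proof -
  have "(\<Sum>n<N. measure P {\<omega> \<in> space P. t + real n * a < \<xi> n \<omega>}) \<le> (\<Sum>n<N. tail F (t + real n * a))"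
    by (intro sum_mono dominated_steps_tail[OF ds])
  also have "\<dots> \<le> stop_loss F (t - a) / a"
    using F.sum_tail_le[OF \<open>0 < a\<close>, where y="t - a" and N=N] by simp
  finally show ?thesis .
qed

text \<open>The threshold is the same for all dominated sequences; long-tailedness absorbs the shift
  by \<open>K\<close> and by one mesh into the factor 2.\<close>

lemma eventually_jumps_le:
  assumes "0 < a"
  obtains L0 where "\<And>(P :: 'u measure) \<xi> \<beta> \<mu> t N. dominated_steps F \<beta> \<mu> P \<xi> \<Longrightarrow> L0 \<le> t \<Longrightarrow>
     (\<Sum>n<N. measure P {\<omega> \<in> space P. t - K + real n * a < \<xi> n \<omega>}) \<le> 2 / a * tail H t"
proof -
  obtain L0 where L0: "\<And>t. L0 \<le> t \<Longrightarrow> stop_loss F (t + (- K - a)) \<le> 2 * tail H t"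
    using eventually_stop_loss_le[of 2 "- K - a"] by (auto simp: eventually_at_top_linorder)
  show thesis
  proof (rule that)
    fix P :: "'u measure" and \<xi> \<beta> \<mu> t N
    assume ds: "dominated_steps F \<beta> \<mu> P \<xi>" and t: "L0 \<le> t"
    have "(\<Sum>n<N. measure P {\<omega> \<in> space P. t - K + real n * a < \<xi> n \<omega>}) \<le> stop_loss F (t - K - a) / a"
      by (rule dominated_steps_jumps[OF ds assms])
    also have "\<dots> \<le> 2 * tail H t / a"
      using L0[OF t] assms by (intro divide_right_mono) (auto simp: algebra_simps)
    finally show "(\<Sum>n<N. measure P {\<omega> \<in> space P. t - K + real n * a < \<xi> n \<omega>}) \<le> 2 / a * tail H t"
      by simp
  qed
qed

text \<open>Induction on \<open>N\<close>: after the first crossing of the line the bound holds by hypothesis, and with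
  crossing probability at most \<open>1/4\<close> the three terms of the decomposition add up to at most
  \<open>(D/2 + D/4 + 2 c) tail H y\<close>.\<close>

lemma uniform_tail_bound:
  assumes "\<mu> < 0"
  obtains D where "1 \<le> D"
    and "\<And>(P :: 'u measure) \<xi> N y. dominated_steps F \<beta> \<mu> P \<xi> \<Longrightarrow>
      measure P {\<omega> \<in> space P. \<exists>n\<le>N. y < (\<Sum>i<n. \<xi> i \<omega>)} \<le> min 1 (D * tail H y)"
proof -
  \<comment> \<open>Half of the drift is spent on the crossing bound, so that
    \<open>\<mu> + a = - a\<close> is the slope of the line.\<close>
  define a where "a = - \<mu> / 2"
  have a: "0 < a" "\<mu> + a = - a" using assms by (auto simp: a_def)
  obtain K where K: "0 < K"
    and cross: "\<And>(P :: 'u measure) \<xi> K' N. dominated_steps F \<beta> \<mu> P \<xi> \<Longrightarrow> K \<le> K' \<Longrightarrow>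
      measure P {\<omega> \<in> space P. \<exists>n\<le>N. K' + real n * (\<mu> + a) < (\<Sum>i<n. \<xi> i \<omega>)} \<le> 1 / 4"
    by (rule crossing_bound[OF F.integrable_dist_axioms a(1), where e="1/4" and \<mu>=\<mu> and \<beta>=\<beta>]) auto
  obtain L1 where L1: "\<And>(P :: 'u measure) \<xi> \<beta> \<mu> t N. dominated_steps F \<beta> \<mu> P \<xi> \<Longrightarrow> L1 \<le> t \<Longrightarrow>
     (\<Sum>n<N. measure P {\<omega> \<in> space P. t - K + real n * a < \<xi> n \<omega>}) \<le> 2 / a * tail H t"
    using eventually_jumps_le[OF a(1), of K] by blast
  define c where "c = 2 / a"
  have c: "0 < c" using a by (simp add: c_def)
  obtain L2 where L2: "\<And>L. L2 \<le> L \<Longrightarrow> eventually (\<lambda>y. two_jumps H L y \<le> ennreal (1 / (4 * c) * tail H y)) at_top"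
    using two_jumps_small[of "1 / (4 * c)"] c by auto
  define L where "L = max 0 (max L1 L2)"
  have L: "0 \<le> L" "L1 \<le> L" "L2 \<le> L" by (auto simp: L_def)
  have "eventually (\<lambda>y. tail H (y - L) / tail H y < 2) at_top"
    by (rule order_tendstoD(2)[OF long_tailed]) simp
  then have "eventually (\<lambda>y. two_jumps H L y \<le> ennreal (1 / (4 * c) * tail H y) \<and>
      tail H (y - L) \<le> 2 * tail H y \<and> K \<le> y \<and> 2 * L \<le> y) at_top"
    using L2[OF L(3)] eventually_ge_at_top[of K] eventually_ge_at_top[of "2 * L"]
    by eventually_elim (use tail_pos in \<open>auto simp: divide_less_eq not_less less_imp_le\<close>)
  then obtain y1 where y1: "\<And>y. y1 \<le> y \<Longrightarrow> two_jumps H L y \<le> ennreal (1 / (4 * c) * tail H y)"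
      "\<And>y. y1 \<le> y \<Longrightarrow> tail H (y - L) \<le> 2 * tail H y" "\<And>y. y1 \<le> y \<Longrightarrow> K \<le> y"
      "\<And>y. y1 \<le> y \<Longrightarrow> 2 * L \<le> y"
    by (auto simp: eventually_at_top_linorder)
  \<comment> \<open>The first entry makes the bound trivial below \<open>y1\<close>;
    \<open>8 * c \<le> D\<close> turns the big-jump term \<open>2 * c\<close> into at most
    \<open>D / 4\<close>. The level \<open>1 / (4 * c)\<close> for \<open>two_jumps\<close> was set
    to leave another \<open>D / 4\<close>.\<close>
  define D where "D = max (1 / tail H y1) (max 1 (8 * c))"
  have D: "1 / tail H y1 \<le> D" "1 \<le> D" "8 * c \<le> D" by (auto simp: D_def)
  show thesis
  proof (rule that[OF D(2)])
    fix P :: "'u measure" and \<xi> N y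
    assume "dominated_steps F \<beta> \<mu> P \<xi>"
    then show "measure P {\<omega> \<in> space P. \<exists>n\<le>N. y < (\<Sum>i<n. \<xi> i \<omega>)} \<le> min 1 (D * tail H y)"
    proof (induction N arbitrary: \<xi> y rule: less_induct)
      case (less N)
      interpret P: prob_space P using less.prems by (simp add: dominated_steps_def)
      show ?case
      proof (cases "1 \<le> D * tail H y")
        case False
        have y: "y1 \<le> y"
        proof (rule ccontr)
          assume "\<not> y1 \<le> y"
          then have "tail H y1 \<le> tail H y" by (intro tail_antimono) auto
          then have "1 / tail H y1 * tail H y1 \<le> D * tail H y"
            using D tail_pos[of y1] by (intro mult_mono) auto
          with False tail_pos[of y1] show False by simp
        qed
        have p: "P.prob {\<omega> \<in> space P. \<exists>n\<le>N. K - real n * a < (\<Sum>i<n. \<xi> i \<omega>)} \<le> 1 / 4"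
          using cross[OF less.prems, of K N] by (simp add: a)
        have j: "(\<Sum>n<N. P.prob {\<omega> \<in> space P. y - L - K + real n * a < \<xi> n \<omega>}) \<le> c * tail H (y - L)"
          unfolding c_def using L y1(4)[OF y] by (intro L1[OF less.prems]) auto
        have "ennreal (P.prob {\<omega> \<in> space P. \<exists>n\<le>N. y < (\<Sum>i<n. \<xi> i \<omega>)})
          \<le> ennreal (P.prob {\<omega> \<in> space P. \<exists>n\<le>N. K - real n * a < (\<Sum>i<n. \<xi> i \<omega>)} * (D * tail H (y - L)))
            + ennreal D * (ennreal c * two_jumps H L y)
            + ennreal (\<Sum>n<N. P.prob {\<omega> \<in> space P. y - L - K + real n * a < \<xi> n \<omega>})"
        proof (rule big_jump_decomposition)
          show "P.indep_vars (\<lambda>_. borel) \<xi> UNIV" using less.prems by (simp add: dominated_steps_def)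
          show "P.prob {\<omega> \<in> space P. \<exists>m\<le>N - n. t < (\<Sum>i<m. \<xi> (n + i) \<omega>)} \<le> min 1 (D * tail H t)"
            if "1 \<le> n" "n \<le> N" for n t
            using that by (intro less.IH dominated_steps_shift less.prems) auto
          show "(\<Sum>n<N. P.prob {\<omega> \<in> space P. t - K + real n * a < \<xi> n \<omega>}) \<le> c * tail H t" if "L \<le> t" for t
            unfolding c_def using that L by (intro L1[OF less.prems]) auto
        qed (use K a L D c y1(3)[OF y] P.prob_space_axioms in auto)
        also have "\<dots> \<le> ennreal (1 / 4 * (D * (2 * tail H y))) + ennreal D * (ennreal c * ennreal (1 / (4 * c) * tail H y))
          + ennreal (c * (2 * tail H y))"
        proof (intro add_mono mult_left_mono y1(1)[OF y] ennreal_leI)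
          show "P.prob {\<omega> \<in> space P. \<exists>n\<le>N. K - real n * a < (\<Sum>i<n. \<xi> i \<omega>)} * (D * tail H (y - L))
            \<le> 1 / 4 * (D * (2 * tail H y))"
            using p y1(2)[OF y] D tail_bounds by (intro mult_mono mult_left_mono) auto
          show "(\<Sum>n<N. P.prob {\<omega> \<in> space P. y - L - K + real n * a < \<xi> n \<omega>}) \<le> c * (2 * tail H y)"
            using j y1(2)[OF y] c by (meson order_trans mult_left_mono less_imp_le)
        qed auto
        also have "\<dots> = ennreal (D * tail H y * (3 / 4) + 2 * c * tail H y)"
        proof -
          have "D * (c * (1 / (4 * c) * tail H y)) = D * tail H y / 4" using c by simp
          then show ?thesis
            using c D tail_bounds(1)[of y]
            by (simp add: ennreal_mult'[symmetric] ennreal_plus[symmetric] del: ennreal_plus)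
        qed
        also have "\<dots> \<le> ennreal (D * tail H y)"
        proof (rule ennreal_leI)
          have "2 * c * tail H y \<le> D / 4 * tail H y"
            using D tail_bounds(1)[of y] by (intro mult_right_mono) auto
          then show "D * tail H y * (3 / 4) + 2 * c * tail H y \<le> D * tail H y" by simp
        qed
        finally have "P.prob {\<omega> \<in> space P. \<exists>n\<le>N. y < (\<Sum>i<n. \<xi> i \<omega>)} \<le> D * tail H y"
          using D tail_bounds(1)[of y] by simp
        with P.prob_le_1 show ?thesis by simp
      qed (use P.prob_le_1 in auto)
    qed
  qed
qed

end

section \<open>Regenerative processes\<close>

lemma (in prob_space) eventually_prob_greater_le:
  fixes V :: "'a \<Rightarrow> real"
  assumes [measurable]: "V \<in> borel_measurable M" and "0 < e"
  shows "eventually (\<lambda>K. prob {\<omega> \<in> space M. K < V \<omega>} \<le> e) at_top"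
proof -
  interpret V: real_distribution "distr M borel V" by simp
  have "eventually (\<lambda>K. tail (distr M borel V) K < e) at_top"
    using V.tendsto_tail \<open>0 < e\<close> by (rule order_tendstoD)
  moreover have "tail (distr M borel V) K = prob {\<omega> \<in> space M. K < V \<omega>}" for K
    unfolding tail_def by (subst measure_distr) (auto intro!: arg_cong[where f=prob])
  ultimately show ?thesis by (auto elim!: eventually_mono)
qed

locale regenerative_process = prob_space M for M :: "'w measure" +
  fixes SX :: "'x measure" and X :: "nat \<Rightarrow> 'w \<Rightarrow> 'x" and T :: "nat \<Rightarrow> 'w \<Rightarrow> nat"
  assumes regen: "regenerative M SX X T"
    and integrable_tau: "integrable M (\<lambda>\<omega>. real (T 1 \<omega> - T 0 \<omega>))"
begin

abbreviation "cyc \<equiv> cycle SX X T"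

abbreviation "len k \<omega> \<equiv> fst (cyc k \<omega>)"

definition mean_len :: real where
  "mean_len = expectation (\<lambda>\<omega>. real (len 1 \<omega>))"

lemma measurable_X [measurable]: "X (Suc n) \<in> measurable M SX"
  using regen by (auto simp: regenerative_def)

lemma measurable_T [measurable]: "T k \<in> measurable M (count_space UNIV)"
  using regen by (auto simp: regenerative_def)

lemma T_strict_mono: "\<omega> \<in> space M \<Longrightarrow> strict_mono (\<lambda>k. T k \<omega>)"
  using regen by (auto simp: regenerative_def)

lemma cyc_indep: "indep_vars (\<lambda>_. cycle_space SX) cyc UNIV"
  using regen by (auto simp: regenerative_def)

lemma measurable_cyc [measurable]: "cyc k \<in> measurable M (cycle_space SX)"
  using cyc_indep by (auto simp: indep_vars_def)

lemma distr_cyc: "distr M (cycle_space SX) (cyc (Suc k)) = distr M (cycle_space SX) (cyc 1)"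
proof -
  have "\<forall>k\<ge>1. distr M (cycle_space SX) (cyc k) = distr M (cycle_space SX) (cyc 1)"
    using regen unfolding regenerative_def by blast
  from this[rule_format, of "Suc k"] show ?thesis by (simp only: le_add1 plus_1_eq_Suc One_nat_def)
qed

lemma measurable_fst_cycle [measurable]: "fst \<in> measurable (cycle_space SX) (count_space UNIV)"
  and measurable_snd_cycle [measurable]: "(\<lambda>p. snd p j) \<in> measurable (cycle_space SX) SX"
  unfolding cycle_space_def by measurable

lemma len_0: "len 0 \<omega> = T 0 \<omega>"
  and len_Suc: "len (Suc k) \<omega> = T (Suc k) \<omega> - T k \<omega>"
  by (simp_all add: cycle_def Let_def)

lemma T_Suc: "\<omega> \<in> space M \<Longrightarrow> T (Suc k) \<omega> = T k \<omega> + len (Suc k) \<omega>"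
  using strict_monoD[OF T_strict_mono, of \<omega> k "Suc k"] by (simp add: len_Suc)

lemma len_pos: "\<omega> \<in> space M \<Longrightarrow> 1 \<le> len (Suc k) \<omega>"
  using strict_monoD[OF T_strict_mono, of \<omega> k "Suc k"] by (simp add: len_Suc)

text \<open>The process is indexed from 1, hence the \<open>Suc\<close>: position \<open>j\<close>
  of cycle \<open>Suc k\<close> is time \<open>T k \<omega> + 1 + j\<close>.\<close>

lemma cyc_value: "j < len (Suc k) \<omega> \<Longrightarrow> snd (cyc (Suc k) \<omega>) j = X (Suc (T k \<omega> + j)) \<omega>"
  by (simp add: cycle_def Let_def)

lemma T_ge: "\<omega> \<in> space M \<Longrightarrow> k \<le> T k \<omega>"
  by (rule strict_mono_imp_increasing[OF T_strict_mono])

lemma T_eq_sum_len: "\<omega> \<in> space M \<Longrightarrow> T k \<omega> = T 0 \<omega> + (\<Sum>l<k. len (Suc l) \<omega>)"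
  by (induction k) (simp_all add: T_Suc)

text \<open>In applications \<open>h n\<close> is a function of \<open>X (Suc n)\<close>, so the
  range \<open>n < T k \<omega>\<close> covers the times 1 to \<open>T k \<omega>\<close>.\<close>

lemma sum_cycles:
  fixes h :: "nat \<Rightarrow> 'b::comm_monoid_add"
  assumes "\<omega> \<in> space M"
  shows "(\<Sum>n<T k \<omega>. h n) = (\<Sum>n<T 0 \<omega>. h n) + (\<Sum>l<k. \<Sum>j<len (Suc l) \<omega>. h (T l \<omega> + j))"
proof (induction k)
  case (Suc k)
  have "(\<Sum>n<T (Suc k) \<omega>. h n) = (\<Sum>n<T k \<omega>. h n) + (\<Sum>n\<in>{T k \<omega>..<T (Suc k) \<omega>}. h n)"
    using T_Suc[OF assms, of k]
    by (simp add: lessThan_atLeast0 sum.atLeastLessThan_concat)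
  also have "(\<Sum>n\<in>{T k \<omega>..<T (Suc k) \<omega>}. h n) = (\<Sum>j<len (Suc k) \<omega>. h (T k \<omega> + j))"
    using T_Suc[OF assms, of k] sum.shift_bounds_nat_ivl[of h 0 "T k \<omega>" "len (Suc k) \<omega>"]
    by (simp add: lessThan_atLeast0 add.commute)
  finally show ?case using Suc by (simp add: add.assoc)
qed simp

lemma nn_integral_cyc:
  assumes [measurable]: "\<phi> \<in> borel_measurable (cycle_space SX)"
  shows "(\<integral>\<^sup>+\<omega>. \<phi> (cyc (Suc k) \<omega>) \<partial>M) = (\<integral>\<^sup>+\<omega>. \<phi> (cyc 1 \<omega>) \<partial>M)"
proof -
  have "(\<integral>\<^sup>+\<omega>. \<phi> (cyc (Suc k) \<omega>) \<partial>M) = (\<integral>\<^sup>+c. \<phi> c \<partial>distr M (cycle_space SX) (cyc (Suc k)))"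
    by (simp add: nn_integral_distr)
  also have "\<dots> = (\<integral>\<^sup>+\<omega>. \<phi> (cyc 1 \<omega>) \<partial>M)"
    unfolding distr_cyc by (simp add: nn_integral_distr)
  finally show ?thesis .
qed

lemma integrable_len: "integrable M (\<lambda>\<omega>. real (len 1 \<omega>))"
  using integrable_tau len_Suc[of 0] by simp

lemma mean_len_ge_1: "1 \<le> mean_len"
proof -
  have "expectation (\<lambda>_. 1) \<le> mean_len"
    unfolding mean_len_def using len_pos[of _ 0]
    by (intro integral_mono integrable_len) auto
  then show ?thesis by (simp add: prob_space)
qed

lemma nn_integral_len: "(\<integral>\<^sup>+\<omega>. ennreal (real (len 1 \<omega>)) \<partial>M) = ennreal mean_len"
  unfolding mean_len_def by (rule nn_integral_eq_integral[OF integrable_len]) simp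

definition cycle_sum :: "('x \<Rightarrow> 'b::comm_monoid_add) \<Rightarrow> nat \<times> (nat \<Rightarrow> 'x) \<Rightarrow> 'b" where
  "cycle_sum g p = (\<Sum>j<fst p. g (snd p j))"

lemma measurable_cycle_sum_real [measurable]:
  fixes g :: "'x \<Rightarrow> real"
  assumes [measurable]: "g \<in> borel_measurable SX"
  shows "cycle_sum g \<in> borel_measurable (cycle_space SX)"
  unfolding cycle_sum_def
  by (rule measurable_compose_countable[where f="\<lambda>n p. \<Sum>j<n. g (snd p j)" and g=fst]) measurable

lemma measurable_cycle_sum_ennreal [measurable]:
  fixes g :: "'x \<Rightarrow> ennreal"
  assumes [measurable]: "g \<in> borel_measurable SX"
  shows "cycle_sum g \<in> borel_measurable (cycle_space SX)"
  unfolding cycle_sum_def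
  by (rule measurable_compose_countable[where f="\<lambda>n p. \<Sum>j<n. g (snd p j)" and g=fst]) measurable

abbreviation "\<pi> \<equiv> stationary_measure M SX X T"

text \<open>A measure given through \<open>measure_of\<close> has the prescribed values only if they
  are countably additive. This is obtained by exhibiting a genuine measure with these values; the
  integral formula is then computed for that measure.\<close>

lemma
  shows nn_integral_stationary_measure: "g \<in> borel_measurable SX \<Longrightarrow>
      ennreal mean_len * (\<integral>\<^sup>+x. g x \<partial>\<pi>) = (\<integral>\<^sup>+\<omega>. cycle_sum g (cyc 1 \<omega>) \<partial>M)"
    and sets_stationary_measure: "sets \<pi> = sets SX"
proof -
  define W where "W = (\<lambda>p :: (nat \<times> (nat \<Rightarrow> 'x)) \<times> nat. if snd p < fst (fst p) then ennreal (1 / mean_len) else 0)"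
  define Q where "Q = distr M (cycle_space SX) (cyc 1)"
  \<comment> \<open>A cycle is drawn from its law \<open>Q\<close>, each position within its length
    receives weight \<open>1 / mean_len\<close>, and the value at that position is recorded.\<close>
  define \<rho> where "\<rho> = distr (density (Q \<Otimes>\<^sub>M count_space UNIV) W) SX (\<lambda>p. snd (fst p) (snd p))"
  have [measurable_cong]: "sets Q = sets (cycle_space SX)" by (simp add: Q_def)
  have val [measurable]: "(\<lambda>p. snd (fst p) (snd p)) \<in> measurable (cycle_space SX \<Otimes>\<^sub>M count_space UNIV) SX"
    by (rule measurable_compose_countable[where f="\<lambda>j p. snd (fst p) j" and g=snd]) measurable
  have Wm [measurable]: "W \<in> borel_measurable (cycle_space SX \<Otimes>\<^sub>M count_space UNIV)"
    unfolding W_def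
  proof (rule measurable_compose_countable[where g="\<lambda>p. fst (fst p)" and
      f="\<lambda>n p. if snd p < n then ennreal (1 / mean_len) else 0"])
    show "(\<lambda>p. fst (fst p)) \<in> measurable (cycle_space SX \<Otimes>\<^sub>M count_space UNIV) (count_space UNIV)"
      by (rule measurable_compose[OF measurable_fst measurable_fst_cycle])
    show "(\<lambda>p. if snd p < n then ennreal (1 / mean_len) else 0)
        \<in> borel_measurable (cycle_space SX \<Otimes>\<^sub>M count_space UNIV)" for n :: nat
      by (rule measurable_compose[OF measurable_snd, where g="\<lambda>j. if j < n then ennreal (1 / mean_len) else 0"]) simp
  qed
  interpret Q: prob_space Q unfolding Q_def by (rule prob_space_distr) simp
  have C: "sigma_finite_measure (count_space (UNIV :: nat set))"
    by (rule sigma_finite_measure_count_space)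
  interpret C: sigma_finite_measure "count_space (UNIV :: nat set)" by (rule C)
  interpret QC: pair_sigma_finite Q "count_space (UNIV :: nat set)" ..
  have m: "0 < mean_len" using mean_len_ge_1 by simp
  have nn: "(\<integral>\<^sup>+x. g x \<partial>\<rho>) = ennreal (1 / mean_len) * (\<integral>\<^sup>+\<omega>. cycle_sum g (cyc 1 \<omega>) \<partial>M)"
    if [measurable]: "g \<in> borel_measurable SX" for g :: "'x \<Rightarrow> ennreal"
  proof -
    have "(\<integral>\<^sup>+x. g x \<partial>\<rho>) = (\<integral>\<^sup>+p. W p * g (snd (fst p) (snd p)) \<partial>(Q \<Otimes>\<^sub>M count_space UNIV))"
      unfolding \<rho>_def by (simp add: nn_integral_distr nn_integral_density)
    also have "\<dots> = (\<integral>\<^sup>+c. \<integral>\<^sup>+j. W (c, j) * g (snd c j) \<partial>count_space UNIV \<partial>Q)"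
      by (subst C.nn_integral_fst[symmetric]) simp_all
    also have "\<dots> = (\<integral>\<^sup>+c. ennreal (1 / mean_len) * cycle_sum g c \<partial>Q)"
    proof (rule nn_integral_cong)
      fix c
      have "(\<integral>\<^sup>+j. W (c, j) * g (snd c j) \<partial>count_space UNIV)
         = (\<integral>\<^sup>+j. ennreal (1 / mean_len) * g (snd c j) * indicator {..<fst c} j \<partial>count_space UNIV)"
        by (intro nn_integral_cong) (auto simp: W_def split: split_indicator)
      also have "\<dots> = (\<Sum>j<fst c. ennreal (1 / mean_len) * g (snd c j))"
        by (subst nn_integral_count_space_indicator[symmetric]) (auto simp: nn_integral_count_space_finite)
      finally show "(\<integral>\<^sup>+j. W (c, j) * g (snd c j) \<partial>count_space UNIV) = ennreal (1 / mean_len) * cycle_sum g c"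
        by (simp add: cycle_sum_def sum_distrib_left)
    qed
    also have "\<dots> = ennreal (1 / mean_len) * (\<integral>\<^sup>+\<omega>. cycle_sum g (cyc 1 \<omega>) \<partial>M)"
      unfolding Q_def by (simp add: nn_integral_distr nn_integral_cmult)
    finally show ?thesis .
  qed
  have "\<pi> = measure_of (space \<rho>) (sets \<rho>) (emeasure \<rho>)"
    unfolding stationary_measure_def
  proof -
    have sp: "space \<rho> = space SX" "sets \<rho> = sets SX" by (simp_all add: \<rho>_def)
    show "measure_of (space SX) (sets SX)
       (\<lambda>B. (\<integral>\<^sup>+\<omega>. ennreal (\<Sum>n\<in>{T 0 \<omega><..T 1 \<omega>}. indicator B (X n \<omega>)) \<partial>M)
             / (\<integral>\<^sup>+\<omega>. ennreal (real (T 1 \<omega> - T 0 \<omega>)) \<partial>M)) = measure_of (space \<rho>) (sets \<rho>) (emeasure \<rho>)"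
      unfolding sp
    proof (rule measure_of_eq[OF sets.space_closed])
      fix B assume "B \<in> sigma_sets (space SX) (sets SX)"
      then have [measurable]: "B \<in> sets SX" by (simp add: sets.sigma_sets_eq)
      have "(\<integral>\<^sup>+\<omega>. ennreal (\<Sum>n\<in>{T 0 \<omega><..T 1 \<omega>}. indicator B (X n \<omega>)) \<partial>M)
        = (\<integral>\<^sup>+\<omega>. cycle_sum (indicator B) (cyc 1 \<omega>) \<partial>M)"
      proof (rule nn_integral_cong)
        fix \<omega> assume w: "\<omega> \<in> space M"
        have "(\<Sum>n\<in>{T 0 \<omega><..T 1 \<omega>}. indicator B (X n \<omega>) :: real) = (\<Sum>j<len 1 \<omega>. indicator B (X (Suc (T 0 \<omega> + j)) \<omega>))"
          using T_Suc[OF w, of 0]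
          by (intro sum.reindex_bij_witness[of _ "\<lambda>j. Suc (T 0 \<omega> + j)" "\<lambda>n. n - Suc (T 0 \<omega>)"]) auto
        also have "\<dots> = (\<Sum>j<len 1 \<omega>. indicator B (snd (cyc 1 \<omega>) j))"
          using cyc_value[of _ 0 \<omega>] by (intro sum.cong) auto
        finally show "ennreal (\<Sum>n\<in>{T 0 \<omega><..T 1 \<omega>}. indicator B (X n \<omega>)) = cycle_sum (indicator B) (cyc 1 \<omega>)"
          by (simp add: cycle_sum_def sum_ennreal[symmetric] ennreal_indicator)
      qed
      moreover have "(\<integral>\<^sup>+\<omega>. ennreal (real (T 1 \<omega> - T 0 \<omega>)) \<partial>M) = ennreal mean_len"
        using nn_integral_len len_Suc[of 0] by simp
      moreover have "emeasure \<rho> B = ennreal (1 / mean_len) * (\<integral>\<^sup>+\<omega>. cycle_sum (indicator B) (cyc 1 \<omega>) \<partial>M)"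
        using nn[of "indicator B"] by (simp add: sp)
      ultimately show "(\<integral>\<^sup>+\<omega>. ennreal (\<Sum>n\<in>{T 0 \<omega><..T 1 \<omega>}. indicator B (X n \<omega>)) \<partial>M)
             / (\<integral>\<^sup>+\<omega>. ennreal (real (T 1 \<omega> - T 0 \<omega>)) \<partial>M) = emeasure \<rho> B"
        using m by (simp add: divide_ennreal_def inverse_ennreal mult.commute inverse_eq_divide)
    qed
  qed
  then have pi: "\<pi> = \<rho>" by (simp add: measure_of_of_measure)
  show "sets \<pi> = sets SX" by (simp add: pi \<rho>_def)
  show "ennreal mean_len * (\<integral>\<^sup>+x. g x \<partial>\<pi>) = (\<integral>\<^sup>+\<omega>. cycle_sum g (cyc 1 \<omega>) \<partial>M)"
    if "g \<in> borel_measurable SX"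
    using m by (simp add: pi nn[OF that] mult.assoc[symmetric] ennreal_mult'[symmetric])
qed

lemma space_stationary_measure: "space \<pi> = space SX"
  by (rule sets_eq_imp_space_eq[OF sets_stationary_measure])

lemma prob_space_stationary_measure: "prob_space \<pi>"
proof
  have "ennreal mean_len * (\<integral>\<^sup>+x. 1 \<partial>\<pi>) = ennreal mean_len"
    using nn_integral_stationary_measure[of "\<lambda>_. 1"] nn_integral_len
    by (simp add: cycle_sum_def ennreal_of_nat_eq_real_of_nat)
  then have "ennreal mean_len * emeasure \<pi> (space \<pi>) = ennreal mean_len * 1" by simp
  then show "emeasure \<pi> (space \<pi>) = 1"
    using mean_len_ge_1 by (subst (asm) ennreal_mult_cancel_left) auto
qed

end

lemma (in prob_space) tendsto_expectation_max:
  fixes f :: "'a \<Rightarrow> real"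
  assumes f: "integrable M f"
  shows "((\<lambda>\<beta>. expectation (\<lambda>\<omega>. max (f \<omega>) (- \<beta>))) \<longlongrightarrow> expectation f) at_top"
proof (rule integral_dominated_convergence_at_top[where w="\<lambda>\<omega>. \<bar>f \<omega>\<bar>"])
  show "\<forall>\<^sub>F \<beta> in at_top. AE \<omega> in M. norm (max (f \<omega>) (- \<beta>)) \<le> \<bar>f \<omega>\<bar>"
    using eventually_ge_at_top[of 0] by eventually_elim auto
  show "AE \<omega> in M. ((\<lambda>\<beta>. max (f \<omega>) (- \<beta>)) \<longlongrightarrow> f \<omega>) at_top"
  proof (rule AE_I2)
    fix \<omega>
    show "((\<lambda>\<beta>. max (f \<omega>) (- \<beta>)) \<longlongrightarrow> f \<omega>) at_top"
      by (rule tendsto_eventually, rule eventually_mono[OF eventually_ge_at_top[of "- f \<omega>"]]) auto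
  qed
qed (use f in auto)

section \<open>Uniform laws of large numbers for the epochs and the environment\<close>

context regenerative_process
begin

lemma cyc_space: "\<omega> \<in> space M \<Longrightarrow> snd (cyc k \<omega>) j \<in> space SX"
  by (rule measurable_space[OF measurable_compose[OF measurable_cyc measurable_snd_cycle]])

lemma measurable_real_len [measurable]: "(\<lambda>p. real (fst p)) \<in> borel_measurable (cycle_space SX)"
  by (rule measurable_compose[OF measurable_fst_cycle]) simp

lemma measurable_real_T [measurable]: "(\<lambda>\<omega>. real (T k \<omega>)) \<in> borel_measurable M"
  by (rule measurable_compose[OF measurable_T]) simp

lemma indep_cyc_functional:
  assumes [measurable]: "\<phi> \<in> borel_measurable (cycle_space SX)"
  shows "indep_vars (\<lambda>_. borel) (\<lambda>i \<omega>. \<phi> (cyc (Suc i) \<omega>)) UNIV"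
  using indep_vars_compose2[OF indep_vars_shift[OF cyc_indep, of 1], of "\<lambda>_. \<phi>" "\<lambda>_. borel"] by simp

text \<open>A one-sided law of large numbers uniform in the horizon. The summands are i.i.d. and
  serve as their own majorants, so \<open>crossing_bound\<close> applies.\<close>

lemma cycle_functional_crossing:
  fixes \<phi> :: "nat \<times> (nat \<Rightarrow> 'x) \<Rightarrow> real"
  assumes [measurable]: "\<phi> \<in> borel_measurable (cycle_space SX)"
    and int: "integrable M (\<lambda>\<omega>. \<phi> (cyc 1 \<omega>))" and "0 < d" "0 < e"
    and mean: "expectation (\<lambda>\<omega>. \<phi> (cyc 1 \<omega>)) \<le> \<mu>"
  shows "eventually (\<lambda>K. \<forall>N. prob {\<omega> \<in> space M. \<exists>n\<le>N. K + real n * (\<mu> + d)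
      < (\<Sum>i<n. \<phi> (cyc (Suc i) \<omega>))} \<le> e) at_top"
proof -
  define F' where "F' = distr M borel (\<lambda>\<omega>. \<phi> (cyc 1 \<omega>))"
  interpret F': real_distribution F' unfolding F'_def by (rule real_distribution_distr) simp
  have F': "integrable_dist F'"
  proof
    show "integrable F' (\<lambda>y. y)" unfolding F'_def using int by (simp add: integrable_distr_eq)
  qed
  have distr_phi: "distr M borel (\<lambda>\<omega>. \<phi> (cyc (Suc i) \<omega>)) = F'" for i
  proof -
    have "distr M borel (\<lambda>\<omega>. \<phi> (cyc (Suc i) \<omega>)) = distr (distr M (cycle_space SX) (cyc (Suc i))) borel \<phi>"
      by (simp add: distr_distr comp_def)
    also have "\<dots> = F'" unfolding distr_cyc F'_def by (simp add: distr_distr comp_def)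
    finally show ?thesis .
  qed
  \<comment> \<open>Half of \<open>d\<close> pays for the truncation of the summands from below; the
    other half is the excess slope in the crossing bound.\<close>
  have "eventually (\<lambda>\<beta>. expectation (\<lambda>\<omega>. max (\<phi> (cyc 1 \<omega>)) (- \<beta>)) < \<mu> + d / 2) at_top"
    using \<open>0 < d\<close> mean by (intro order_tendstoD(2)[OF tendsto_expectation_max[OF int]]) auto
  then obtain \<beta> where beta: "expectation (\<lambda>\<omega>. max (\<phi> (cyc 1 \<omega>)) (- \<beta>)) < \<mu> + d / 2"
    by (auto simp: eventually_at_top_linorder)
  have "dominated_steps F' \<beta> (\<mu> + d / 2) M (\<lambda>i \<omega>. \<phi> (cyc (Suc i) \<omega>))"
    unfolding dominated_steps_def
  proof (intro conjI prob_space_axioms indep_cyc_functional exI[of _ "\<lambda>i \<omega>. \<phi> (cyc (Suc i) \<omega>)"] allI)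
    fix i
    have "(\<integral>\<omega>. max (\<phi> (cyc (Suc i) \<omega>)) (- \<beta>) \<partial>M) = (\<integral>z. max z (- \<beta>) \<partial>distr M borel (\<lambda>\<omega>. \<phi> (cyc (Suc i) \<omega>)))"
      by (simp add: integral_distr)
    also have "\<dots> = (\<integral>\<omega>. max (\<phi> (cyc 1 \<omega>)) (- \<beta>) \<partial>M)"
      unfolding distr_phi F'_def by (simp add: integral_distr)
    finally show "(\<integral>\<omega>. max (\<phi> (cyc (Suc i) \<omega>)) (- \<beta>) \<partial>M) \<le> \<mu> + d / 2" using beta by simp
  qed (auto simp: distr_phi)
  note ds = this
  obtain K0 where K0: "\<And>(P :: 'w measure) \<xi> K N. dominated_steps F' \<beta> (\<mu> + d / 2) P \<xi> \<Longrightarrow> K0 \<le> K \<Longrightarrow>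
      measure P {\<omega> \<in> space P. \<exists>n\<le>N. K + real n * ((\<mu> + d / 2) + d / 2) < (\<Sum>i<n. \<xi> i \<omega>)} \<le> e"
    by (rule crossing_bound[OF F', where d="d/2" and e=e and \<mu>="\<mu> + d / 2" and \<beta>=\<beta>])
       (use \<open>0 < d\<close> \<open>0 < e\<close> in auto)
  show ?thesis
    unfolding eventually_at_top_linorder
    using K0[OF ds] by (intro exI[of _ K0] allI impI) (simp add: add.assoc)
qed

text \<open>\<open>T k\<close> is at least the sum of the complete cycle lengths; the crossing bound
  is applied to the negated lengths.\<close>

lemma T_rarely_small:
  assumes "0 < \<eta>" "0 < e"
  shows "eventually (\<lambda>K. \<forall>k. prob {\<omega> \<in> space M. real (T k \<omega>) < real k * (mean_len - \<eta>) - K} \<le> e) at_top"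
proof -
  have "eventually (\<lambda>K. \<forall>N. prob {\<omega> \<in> space M. \<exists>n\<le>N. K + real n * (- mean_len + \<eta>)
      < (\<Sum>i<n. - real (len (Suc i) \<omega>))} \<le> e) at_top"
    using integrable_len assms
    by (intro cycle_functional_crossing[where \<phi>="\<lambda>p. - real (fst p)"]) (simp_all add: mean_len_def)
  then show ?thesis
  proof eventually_elim
    case (elim K)
    show ?case
    proof
      fix k
      have "prob {\<omega> \<in> space M. real (T k \<omega>) < real k * (mean_len - \<eta>) - K}
        \<le> prob {\<omega> \<in> space M. \<exists>n\<le>k. K + real n * (- mean_len + \<eta>) < (\<Sum>i<n. - real (len (Suc i) \<omega>))}"
      proof (rule finite_measure_mono)
        show "{\<omega> \<in> space M. real (T k \<omega>) < real k * (mean_len - \<eta>) - K}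
          \<subseteq> {\<omega> \<in> space M. \<exists>n\<le>k. K + real n * (- mean_len + \<eta>) < (\<Sum>i<n. - real (len (Suc i) \<omega>))}"
        proof safe
          fix \<omega> assume "\<omega> \<in> space M" "real (T k \<omega>) < real k * (mean_len - \<eta>) - K"
          then show "\<exists>n\<le>k. K + real n * (- mean_len + \<eta>) < (\<Sum>i<n. - real (len (Suc i) \<omega>))"
            using T_eq_sum_len[of \<omega> k] by (intro exI[of _ k]) (simp add: sum_negf algebra_simps)
        qed
      qed measurable
      with elim show "prob {\<omega> \<in> space M. real (T k \<omega>) < real k * (mean_len - \<eta>) - K} \<le> e"
        by (meson order_trans)
    qed
  qed
qed

text \<open>The initial cycle has a law of its own with no moment assumed. Being finite, it exceeds
  \<open>K / 2\<close> with small probability, and the other half of \<open>K\<close> is left to the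
  i.i.d. cycles.\<close>

lemma T_rarely_large:
  assumes "0 < \<eta>" "0 < e"
  shows "eventually (\<lambda>K. \<forall>k. prob {\<omega> \<in> space M. real k * (mean_len + \<eta>) + K < real (T k \<omega>)} \<le> e) at_top"
proof -
  have "eventually (\<lambda>K. \<forall>N. prob {\<omega> \<in> space M. \<exists>n\<le>N. K + real n * (mean_len + \<eta>)
      < (\<Sum>i<n. real (len (Suc i) \<omega>))} \<le> e / 2) at_top"
    using integrable_len assms
    by (intro cycle_functional_crossing[where \<phi>="\<lambda>p. real (fst p)"]) (simp_all add: mean_len_def)
  moreover have "eventually (\<lambda>K. prob {\<omega> \<in> space M. K < real (T 0 \<omega>)} \<le> e / 2) at_top"
    using assms by (intro eventually_prob_greater_le) auto
  ultimately have ev: "eventually (\<lambda>K. (\<forall>N. prob {\<omega> \<in> space M. \<exists>n\<le>N. K + real n * (mean_len + \<eta>)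
      < (\<Sum>i<n. real (len (Suc i) \<omega>))} \<le> e / 2) \<and> prob {\<omega> \<in> space M. K < real (T 0 \<omega>)} \<le> e / 2) at_top"
    by (rule eventually_conj)
  have "filterlim (\<lambda>K::real. K / 2) at_top at_top"
    using filterlim_at_top_mult_tendsto_pos[OF tendsto_const[of "1/2::real"] _ filterlim_ident] by simp
  from eventually_compose_filterlim[OF ev this] show ?thesis
  proof eventually_elim
    case (elim K)
    show ?case
    proof
      fix k
      have "prob {\<omega> \<in> space M. real k * (mean_len + \<eta>) + K < real (T k \<omega>)}
        \<le> prob ({\<omega> \<in> space M. \<exists>n\<le>k. K / 2 + real n * (mean_len + \<eta>) < (\<Sum>i<n. real (len (Suc i) \<omega>))}
            \<union> {\<omega> \<in> space M. K / 2 < real (T 0 \<omega>)})"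
      proof (rule finite_measure_mono)
        show "{\<omega> \<in> space M. real k * (mean_len + \<eta>) + K < real (T k \<omega>)}
          \<subseteq> {\<omega> \<in> space M. \<exists>n\<le>k. K / 2 + real n * (mean_len + \<eta>) < (\<Sum>i<n. real (len (Suc i) \<omega>))}
            \<union> {\<omega> \<in> space M. K / 2 < real (T 0 \<omega>)}"
        proof safe
          fix \<omega> assume "\<omega> \<in> space M" "real k * (mean_len + \<eta>) + K < real (T k \<omega>)" "\<not> K / 2 < real (T 0 \<omega>)"
          then show "\<exists>n\<le>k. K / 2 + real n * (mean_len + \<eta>) < (\<Sum>i<n. real (len (Suc i) \<omega>))"
            using T_eq_sum_len[of \<omega> k] by (intro exI[of _ k]) (simp add: not_less)
        qed
      qed measurable
      also have "\<dots> \<le> prob {\<omega> \<in> space M. \<exists>n\<le>k. K / 2 + real n * (mean_len + \<eta>) < (\<Sum>i<n. real (len (Suc i) \<omega>))}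
            + prob {\<omega> \<in> space M. K / 2 < real (T 0 \<omega>)}"
        by (rule measure_Un_le) measurable
      also have "\<dots> \<le> e / 2 + e / 2"
        using elim by (intro add_mono) auto
      finally show "prob {\<omega> \<in> space M. real k * (mean_len + \<eta>) + K < real (T k \<omega>)} \<le> e" by simp
    qed
  qed
qed

text \<open>Adding \<open>b\<close> makes \<open>f\<close> nonnegative, so the identity for
  nonnegative integrals applies; the added multiple of the cycle length is subtracted again.\<close>

lemma
  fixes f :: "'x \<Rightarrow> real"
  assumes f [measurable]: "f \<in> borel_measurable SX" and bnd: "\<And>x. x \<in> space SX \<Longrightarrow> \<bar>f x\<bar> \<le> b"
  shows integrable_cycle_sum: "integrable M (\<lambda>\<omega>. cycle_sum f (cyc 1 \<omega>))"
    and expectation_cycle_sum: "expectation (\<lambda>\<omega>. cycle_sum f (cyc 1 \<omega>)) = mean_len * (\<integral>x. f x \<partial>\<pi>)"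
proof -
  interpret pi: prob_space \<pi> by (rule prob_space_stationary_measure)
  note sets_stationary_measure [measurable_cong]
  have abs: "\<bar>cycle_sum f (cyc k \<omega>)\<bar> \<le> b * real (len k \<omega>)" if "\<omega> \<in> space M" for \<omega> k
  proof -
    have "\<bar>cycle_sum f (cyc k \<omega>)\<bar> \<le> (\<Sum>j<len k \<omega>. b)"
      unfolding cycle_sum_def using bnd cyc_space[OF that]
      by (intro order_trans[OF sum_abs] sum_mono) auto
    then show ?thesis by (simp add: mult.commute)
  qed
  show int: "integrable M (\<lambda>\<omega>. cycle_sum f (cyc 1 \<omega>))"
    by (rule Bochner_Integration.integrable_bound[OF integrable_mult_right[OF integrable_len, of b]])
       (use abs in \<open>auto intro!: AE_I2 order_trans[OF _ abs_ge_self]\<close>)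
  have fpi: "integrable \<pi> f"
    by (rule pi.integrable_const_bound[of _ b]) (auto simp: bnd space_stationary_measure)
  have b: "0 \<le> f x + b" if "x \<in> space SX" for x using bnd[OF that] by linarith
  have eq: "cycle_sum (\<lambda>x. ennreal (f x + b)) (cyc 1 \<omega>) = ennreal (cycle_sum f (cyc 1 \<omega>) + b * real (len 1 \<omega>))"
    if "\<omega> \<in> space M" for \<omega>
    using b cyc_space[OF that] by (simp add: cycle_sum_def sum_ennreal sum.distrib mult.commute)
  have nonneg: "0 \<le> cycle_sum f (cyc 1 \<omega>) + b * real (len 1 \<omega>)" if "\<omega> \<in> space M" for \<omega>
    using abs[OF that, of 1] by linarith
  have "ennreal mean_len * (\<integral>\<^sup>+x. ennreal (f x + b) \<partial>\<pi>) = (\<integral>\<^sup>+\<omega>. cycle_sum (\<lambda>x. ennreal (f x + b)) (cyc 1 \<omega>) \<partial>M)"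
    by (rule nn_integral_stationary_measure) simp
  also have "\<dots> = (\<integral>\<^sup>+\<omega>. ennreal (cycle_sum f (cyc 1 \<omega>) + b * real (len 1 \<omega>)) \<partial>M)"
    by (intro nn_integral_cong eq)
  also have "\<dots> = ennreal (expectation (\<lambda>\<omega>. cycle_sum f (cyc 1 \<omega>) + b * real (len 1 \<omega>)))"
    using int integrable_len nonneg by (intro nn_integral_eq_integral) (auto intro!: AE_I2)
  also have "(\<integral>\<^sup>+x. ennreal (f x + b) \<partial>\<pi>) = ennreal (\<integral>x. f x + b \<partial>\<pi>)"
    using fpi b by (intro nn_integral_eq_integral) (auto intro!: AE_I2 simp: space_stationary_measure)
  finally have "mean_len * (\<integral>x. f x + b \<partial>\<pi>) = expectation (\<lambda>\<omega>. cycle_sum f (cyc 1 \<omega>) + b * real (len 1 \<omega>))"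
  proof (subst (asm) ennreal_mult'[symmetric])
    have "0 \<le> (\<integral>x. f x + b \<partial>\<pi>)"
      using b by (intro Bochner_Integration.integral_nonneg) (simp add: space_stationary_measure)
    then have "0 \<le> mean_len * (\<integral>x. f x + b \<partial>\<pi>)" using mean_len_ge_1 by simp
    moreover have "0 \<le> expectation (\<lambda>\<omega>. cycle_sum f (cyc 1 \<omega>) + b * real (len 1 \<omega>))"
      using nonneg by (rule Bochner_Integration.integral_nonneg)
    moreover assume "ennreal (mean_len * (\<integral>x. f x + b \<partial>\<pi>))
      = ennreal (expectation (\<lambda>\<omega>. cycle_sum f (cyc 1 \<omega>) + b * real (len 1 \<omega>)))"
    ultimately show ?thesis by (rule ennreal_inj[THEN iffD1])
  qed (use mean_len_ge_1 in simp)
  moreover have "(\<integral>x. f x + b \<partial>\<pi>) = (\<integral>x. f x \<partial>\<pi>) + b"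
    using fpi by (simp add: pi.prob_space)
  moreover have "expectation (\<lambda>\<omega>. cycle_sum f (cyc 1 \<omega>) + b * real (len 1 \<omega>))
     = expectation (\<lambda>\<omega>. cycle_sum f (cyc 1 \<omega>)) + b * mean_len"
    using int integrable_len by (simp add: mean_len_def)
  ultimately show "expectation (\<lambda>\<omega>. cycle_sum f (cyc 1 \<omega>)) = mean_len * (\<integral>x. f x \<partial>\<pi>)"
    by (simp add: algebra_simps)
qed

text \<open>At the epochs this is the crossing bound for i.i.d. cycle sums. Between epochs an
  incomplete cycle contributes at most \<open>b\<close> times its length, and all these
  contributions are controlled together because the length is integrable.\<close>

lemma environment_crossing:
  fixes f :: "'x \<Rightarrow> real"
  assumes f [measurable]: "f \<in> borel_measurable SX" and bnd: "\<And>x. x \<in> space SX \<Longrightarrow> \<bar>f x\<bar> \<le> b"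
    and neg: "(\<integral>x. f x \<partial>\<pi>) < 0" and "0 < e"
  shows "eventually (\<lambda>K. \<forall>N. prob {\<omega> \<in> space M. \<exists>n\<le>N. K < (\<Sum>i<n. f (X (Suc i) \<omega>))} \<le> e) at_top"
proof -
  \<comment> \<open>A cycle sum has mean \<open>- 2 * \<delta>\<close>: one \<open>\<delta>\<close>
    is lost in the crossing bound, the other pays for the incomplete cycle.\<close>
  define \<delta> where "\<delta> = - (mean_len * (\<integral>x. f x \<partial>\<pi>)) / 2"
  have \<delta>: "0 < \<delta>" using neg mean_len_ge_1 by (simp add: \<delta>_def mult_less_0_iff)
  define L where "L = distr M borel (\<lambda>\<omega>. b * real (len 1 \<omega>))"
  interpret L: integrable_dist L
    unfolding L_def integrable_dist_def integrable_dist_axioms_def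
    using integrable_len by (auto simp: integrable_distr_eq intro: real_distribution_distr)
  define Z where "Z = (\<lambda>n \<omega>. \<Sum>l<n. cycle_sum f (cyc (Suc l) \<omega>))"
  have [measurable]: "Z n \<in> borel_measurable M" for n unfolding Z_def by measurable
  have "eventually (\<lambda>K. \<forall>N. prob {\<omega> \<in> space M. \<exists>n\<le>N. K + real n * (- (2 * \<delta>) + \<delta>) < Z n \<omega>} \<le> e / 3) at_top"
    unfolding Z_def using \<delta> \<open>0 < e\<close>
    by (intro cycle_functional_crossing integrable_cycle_sum[OF f bnd]) (auto simp: expectation_cycle_sum[OF f bnd, unfolded One_nat_def] \<delta>_def)
  moreover have "eventually (\<lambda>K. prob {\<omega> \<in> space M. K < b * real (T 0 \<omega>)} \<le> e / 3) at_top"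
    using \<open>0 < e\<close> by (intro eventually_prob_greater_le) auto
  moreover have "eventually (\<lambda>K. stop_loss L (K - \<delta>) < e / 3 * \<delta>) at_top"
  proof -
    have "((\<lambda>K. stop_loss L (K + (- \<delta>))) \<longlongrightarrow> 0) at_top"
      using filterlim_tendsto_add_at_top[OF tendsto_const[of "- \<delta>"] filterlim_ident]
      by (intro filterlim_compose[OF L.tendsto_stop_loss]) (simp add: add.commute)
    then show ?thesis using \<open>0 < e\<close> \<delta> by (intro order_tendstoD(2)) auto
  qed
  ultimately have ev: "eventually (\<lambda>K. (\<forall>N. prob {\<omega> \<in> space M. \<exists>n\<le>N. K + real n * (- (2 * \<delta>) + \<delta>) < Z n \<omega>} \<le> e / 3)
      \<and> prob {\<omega> \<in> space M. K < b * real (T 0 \<omega>)} \<le> e / 3 \<and> stop_loss L (K - \<delta>) < e / 3 * \<delta>) at_top"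
    by (intro eventually_conj)
  have "filterlim (\<lambda>K::real. K / 3) at_top at_top"
    using filterlim_at_top_mult_tendsto_pos[OF tendsto_const[of "1/3::real"] _ filterlim_ident] by simp
  from eventually_compose_filterlim[OF ev this] show ?thesis
  proof eventually_elim
    case (elim K)
    show ?case
    proof
      fix N
      define E1 where "E1 = {\<omega> \<in> space M. \<exists>n\<le>N. K / 3 + real n * (- (2 * \<delta>) + \<delta>) < Z n \<omega>}"
      define E2 where "E2 = {\<omega> \<in> space M. K / 3 < b * real (T 0 \<omega>)}"
      \<comment> \<open>Cycle \<open>Suc k\<close> is too long for the allowance
        \<open>real k * \<delta>\<close> that has accumulated by its start; the probabilities sum to
        at most a stop-loss value divided by \<open>\<delta>\<close>.\<close>
      define E3 where "E3 = (\<lambda>k. {\<omega> \<in> space M. K / 3 + real k * \<delta> < b * real (len (Suc k) \<omega>)})"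
      have [measurable]: "E1 \<in> events" "E2 \<in> events" "\<And>k. E3 k \<in> events"
        unfolding E1_def E2_def E3_def by measurable
      have E3: "prob (E3 k) = tail L (K / 3 + real k * \<delta>)" for k
      proof -
        have "prob (E3 k) = prob ((cyc (Suc k)) -` {p \<in> space (cycle_space SX). K / 3 + real k * \<delta> < b * real (fst p)} \<inter> space M)"
          using measurable_space[OF measurable_cyc] unfolding E3_def by (intro arg_cong[where f=prob]) auto
        also have "\<dots> = measure (distr M (cycle_space SX) (cyc (Suc k))) {p \<in> space (cycle_space SX). K / 3 + real k * \<delta> < b * real (fst p)}"
          by (subst measure_distr) auto
        also have "\<dots> = prob {\<omega> \<in> space M. K / 3 + real k * \<delta> < b * real (len 1 \<omega>)}"
          unfolding distr_cyc using measurable_space[OF measurable_cyc]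
          by (subst measure_distr) (auto intro!: arg_cong[where f=prob])
        also have "\<dots> = tail L (K / 3 + real k * \<delta>)"
          unfolding L_def tail_def by (subst measure_distr) (auto intro!: arg_cong[where f=prob])
        finally show ?thesis .
      qed
      have "{\<omega> \<in> space M. \<exists>n\<le>N. K < (\<Sum>i<n. f (X (Suc i) \<omega>))} \<subseteq> E1 \<union> E2 \<union> (\<Union>k<Suc N. E3 k)"
      proof
        fix \<omega> assume "\<omega> \<in> {\<omega> \<in> space M. \<exists>n\<le>N. K < (\<Sum>i<n. f (X (Suc i) \<omega>))}"
        then obtain n where w: "\<omega> \<in> space M" and n: "n \<le> N" "K < (\<Sum>i<n. f (X (Suc i) \<omega>))" by auto
        have fb: "f (X (Suc i) \<omega>) \<le> b" "0 \<le> b" for i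
          using bnd[OF measurable_space[OF measurable_X w], of i] by (auto simp: abs_le_iff)
        show "\<omega> \<in> E1 \<union> E2 \<union> (\<Union>k<Suc N. E3 k)"
        proof (rule ccontr)
          assume neg: "\<omega> \<notin> E1 \<union> E2 \<union> (\<Union>k<Suc N. E3 k)"
          have e1: "Z k \<omega> \<le> K / 3 - real k * \<delta>" if "k \<le> N" for k
            using neg w that by (force simp: E1_def not_less algebra_simps)
          have e2: "b * real (T 0 \<omega>) \<le> K / 3" using neg w by (simp add: E2_def)
          have e3: "b * real (len (Suc k) \<omega>) \<le> K / 3 + real k * \<delta>" if "k \<le> N" for k
            using neg w that by (force simp: E3_def not_less)
          have K0: "0 \<le> K / 3" using e2 fb(2) by (meson mult_nonneg_nonneg of_nat_0_le_iff order_trans)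
          have ub: "(\<Sum>i\<in>A. f (X (Suc i) \<omega>)) \<le> b * real (card A)" for A
          proof -
            have "(\<Sum>i\<in>A. f (X (Suc i) \<omega>)) \<le> (\<Sum>i\<in>A. b)" by (intro sum_mono fb)
            then show ?thesis by (simp add: mult.commute)
          qed
          have "(\<Sum>i<n. f (X (Suc i) \<omega>)) \<le> K"
          proof (cases "n \<le> T 0 \<omega>")
            case True
            have "(\<Sum>i<n. f (X (Suc i) \<omega>)) \<le> b * real n" using ub[of "{..<n}"] by simp
            also have "\<dots> \<le> b * real (T 0 \<omega>)" using True fb by (intro mult_left_mono) auto
            finally show ?thesis using e2 K0 by linarith
          next
            case False
            \<comment> \<open>The last epoch not after \<open>n\<close>. Since epochs are at least
              their index, \<open>k \<le> n \<le> N\<close>, so finitely many events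
              \<open>E3 k\<close> suffice.\<close>
            define k where "k = (GREATEST k. T k \<omega> \<le> n)"
            have bk: "\<And>k. T k \<omega> \<le> n \<Longrightarrow> k \<le> n" by (rule order_trans[OF T_ge[OF w]])
            have k1: "T k \<omega> \<le> n" unfolding k_def
              by (rule GreatestI_nat[of "\<lambda>k. T k \<omega> \<le> n" 0 n]) (use False bk in auto)
            have "\<not> T (Suc k) \<omega> \<le> n"
            proof
              assume "T (Suc k) \<omega> \<le> n"
              then have "Suc k \<le> (GREATEST k. T k \<omega> \<le> n)"
                by (rule Greatest_le_nat[where P="\<lambda>k. T k \<omega> \<le> n" and b=n]) (rule bk)
              then show False by (simp add: k_def[symmetric])
            qed
            then have k2: "n - T k \<omega> \<le> len (Suc k) \<omega>" using T_Suc[OF w, of k] by simp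
            have kN: "k \<le> N" using bk[OF k1] n(1) by simp
            have "(\<Sum>i<n. f (X (Suc i) \<omega>)) = (\<Sum>i<T k \<omega>. f (X (Suc i) \<omega>)) + (\<Sum>i\<in>{T k \<omega>..<n}. f (X (Suc i) \<omega>))"
              using k1 by (simp add: lessThan_atLeast0 sum.atLeastLessThan_concat)
            also have "(\<Sum>i<T k \<omega>. f (X (Suc i) \<omega>)) = (\<Sum>i<T 0 \<omega>. f (X (Suc i) \<omega>)) + Z k \<omega>"
              using sum_cycles[OF w, of "\<lambda>i. f (X (Suc i) \<omega>)" k] by (simp add: Z_def cycle_sum_def cyc_value)
            also have "(\<Sum>i<T 0 \<omega>. f (X (Suc i) \<omega>)) + Z k \<omega> + (\<Sum>i\<in>{T k \<omega>..<n}. f (X (Suc i) \<omega>))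
              \<le> b * real (T 0 \<omega>) + (K / 3 - real k * \<delta>) + b * real (len (Suc k) \<omega>)"
            proof (intro add_mono e1[OF kN])
              show "(\<Sum>i<T 0 \<omega>. f (X (Suc i) \<omega>)) \<le> b * real (T 0 \<omega>)" using ub[of "{..<T 0 \<omega>}"] by simp
              have "(\<Sum>i\<in>{T k \<omega>..<n}. f (X (Suc i) \<omega>)) \<le> b * real (n - T k \<omega>)" using ub[of "{T k \<omega>..<n}"] by simp
              also have "\<dots> \<le> b * real (len (Suc k) \<omega>)" using k2 fb by (intro mult_left_mono) auto
              finally show "(\<Sum>i\<in>{T k \<omega>..<n}. f (X (Suc i) \<omega>)) \<le> b * real (len (Suc k) \<omega>)" .
            qed
            also have "\<dots> \<le> K" using e2 e3[OF kN] by linarith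
            finally show ?thesis .
          qed
          with n show False by simp
        qed
      qed
      then have "prob {\<omega> \<in> space M. \<exists>n\<le>N. K < (\<Sum>i<n. f (X (Suc i) \<omega>))} \<le> prob (E1 \<union> E2 \<union> (\<Union>k<Suc N. E3 k))"
        by (rule finite_measure_mono) measurable
      also have "\<dots> \<le> prob E1 + prob E2 + prob (\<Union>k<Suc N. E3 k)"
        by (intro order_trans[OF measure_Un_le] add_right_mono measure_Un_le) measurable
      finally have *: "prob {\<omega> \<in> space M. \<exists>n\<le>N. K < (\<Sum>i<n. f (X (Suc i) \<omega>))}
        \<le> prob E1 + prob E2 + prob (\<Union>k<Suc N. E3 k)" .
      have "prob (\<Union>k<Suc N. E3 k) \<le> (\<Sum>k<Suc N. prob (E3 k))"
        by (rule measure_UNION_le) auto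
      also have "\<dots> \<le> stop_loss L (K / 3 - \<delta>) / \<delta>"
        unfolding E3 using L.sum_tail_le[OF \<delta>, where y="K / 3 - \<delta>" and N="Suc N"] by simp
      also have "\<dots> \<le> e / 3" using elim \<delta> by (simp add: divide_le_eq)
      finally have "prob (\<Union>k<Suc N. E3 k) \<le> e / 3" .
      moreover have "prob E1 \<le> e / 3" "prob E2 \<le> e / 3" using elim unfolding E1_def E2_def by auto
      ultimately show "prob {\<omega> \<in> space M. \<exists>n\<le>N. K < (\<Sum>i<n. f (X (Suc i) \<omega>))} \<le> e"
        using * by linarith
    qed
  qed
qed

end

section \<open>The expected number of big jumps\<close>

text \<open>\<open>T k\<close> is the total length of the cycles 0 to \<open>k\<close> and is
  therefore independent of cycle \<open>Suc k\<close>, which has the law of cycle 1.\<close>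

lemma (in regenerative_process) nn_integral_past_cyc:
  assumes [measurable]: "\<phi> \<in> borel_measurable (cycle_space SX)"
  shows "(\<integral>\<^sup>+\<omega>. indicator {\<omega> \<in> space M. Q (T k \<omega>)} \<omega> * \<phi> (cyc (Suc k) \<omega>) \<partial>M)
    = ennreal (prob {\<omega> \<in> space M. Q (T k \<omega>)}) * (\<integral>\<^sup>+\<omega>. \<phi> (cyc 1 \<omega>) \<partial>M)"
proof -
  let ?N = "\<lambda>_::nat. cycle_space SX"
  define A where "A = (\<lambda>x :: nat \<Rightarrow> nat \<times> (nat \<Rightarrow> 'x). if Q (\<Sum>l\<le>k. fst (x l)) then 1 else 0 :: ennreal)"
  define B where "B = (\<lambda>x :: nat \<Rightarrow> nat \<times> (nat \<Rightarrow> 'x). \<phi> (x (Suc k)))"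
  have fstm: "(\<lambda>x. fst (x l)) \<in> measurable (PiM {..k} ?N) (count_space UNIV)" if "l \<le> k" for l
  proof -
    have "(\<lambda>x. x l) \<in> measurable (PiM {..k} ?N) (cycle_space SX)"
      using that by (intro measurable_component_singleton) simp
    from measurable_compose[OF this measurable_fst_cycle] show ?thesis .
  qed
  have "(\<lambda>x. \<Sum>l\<in>L. fst (x l)) \<in> measurable (PiM {..k} ?N) (count_space UNIV)" if "finite L" "L \<subseteq> {..k}" for L
    using that
  proof (induction L)
    case (insert l L)
    then have "(\<lambda>x. fst (x l)) \<in> measurable (PiM {..k} ?N) (count_space UNIV)" by (intro fstm) auto
    moreover have "(\<lambda>x. \<Sum>l\<in>L. fst (x l)) \<in> measurable (PiM {..k} ?N) (count_space UNIV)" using insert by auto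
    ultimately have "(\<lambda>x. fst (x l) + (\<Sum>l\<in>L. fst (x l))) \<in> measurable (PiM {..k} ?N) (count_space UNIV)"
      by measurable
    then show ?case using insert by simp
  qed simp
  then have "(\<lambda>x. \<Sum>l\<le>k. fst (x l)) \<in> measurable (PiM {..k} ?N) (count_space UNIV)" by simp
  then have Am: "A \<in> borel_measurable (PiM {..k} ?N)"
    unfolding A_def by (rule measurable_compose[where g="\<lambda>n. if Q n then 1 else 0"]) simp
  have Bm: "B \<in> borel_measurable (PiM {Suc k} ?N)" unfolding B_def by measurable
  have "indep_var borel (A \<circ> (\<lambda>\<omega>. \<lambda>i\<in>{..k}. cyc i \<omega>)) borel (B \<circ> (\<lambda>\<omega>. \<lambda>i\<in>{Suc k}. cyc i \<omega>))"
    by (intro indep_var_compose[OF indep_var_restrict[OF cyc_indep] Am Bm]) auto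
  then have "indep_vars (\<lambda>_. borel) (case_bool (A \<circ> (\<lambda>\<omega>. \<lambda>i\<in>{..k}. cyc i \<omega>)) (B \<circ> (\<lambda>\<omega>. \<lambda>i\<in>{Suc k}. cyc i \<omega>))) UNIV"
    unfolding indep_var_def by (subst (asm) indep_vars_cong) (auto split: bool.split)
  from indep_vars_nn_integral[OF _ this]
  have "(\<integral>\<^sup>+\<omega>. A (\<lambda>i\<in>{..k}. cyc i \<omega>) * B (\<lambda>i\<in>{Suc k}. cyc i \<omega>) \<partial>M)
      = (\<integral>\<^sup>+\<omega>. A (\<lambda>i\<in>{..k}. cyc i \<omega>) \<partial>M) * (\<integral>\<^sup>+\<omega>. B (\<lambda>i\<in>{Suc k}. cyc i \<omega>) \<partial>M)"
    by (simp add: UNIV_bool mult.commute comp_def)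
  moreover have A: "A (\<lambda>i\<in>{..k}. cyc i \<omega>) = indicator {\<omega> \<in> space M. Q (T k \<omega>)} \<omega>" if "\<omega> \<in> space M" for \<omega>
  proof -
    have "(\<Sum>l\<le>k. fst ((\<lambda>i\<in>{..k}. cyc i \<omega>) l)) = (\<Sum>l\<le>k. len l \<omega>)" by (intro sum.cong) auto
    also have "\<dots> = T k \<omega>"
      using T_eq_sum_len[OF that, of k] by (simp add: sum.atMost_shift len_0)
    finally show ?thesis using that by (simp add: A_def)
  qed
  ultimately have "(\<integral>\<^sup>+\<omega>. indicator {\<omega> \<in> space M. Q (T k \<omega>)} \<omega> * \<phi> (cyc (Suc k) \<omega>) \<partial>M)
      = (\<integral>\<^sup>+\<omega>. indicator {\<omega> \<in> space M. Q (T k \<omega>)} \<omega> \<partial>M) * (\<integral>\<^sup>+\<omega>. \<phi> (cyc (Suc k) \<omega>) \<partial>M)"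
    by (simp add: B_def A cong: nn_integral_cong)
  also have "(\<integral>\<^sup>+\<omega>. indicator {\<omega> \<in> space M. Q (T k \<omega>)} \<omega> \<partial>M) = emeasure M {\<omega> \<in> space M. Q (T k \<omega>)}"
    by (rule nn_integral_indicator) measurable
  finally show ?thesis unfolding nn_integral_cyc[OF assms, of k] emeasure_eq_measure .
qed

section \<open>Tails of the steps, collected over one cycle\<close>

locale modulated_tails = regenerative_process M SX X T + H: heavy_int_tail H F
  for M :: "'w measure" and SX :: "'x measure" and X T and H F :: "real measure" +
  fixes Fx :: "'x \<Rightarrow> real measure" and c :: "'x \<Rightarrow> real"
  assumes Fx_dist: "x \<in> space SX \<Longrightarrow> integrable_dist (Fx x)"
    and Fx_meas: "(\<lambda>x. measure (Fx x) {..y}) \<in> borel_measurable SX"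
    and c_meas [measurable]: "c \<in> borel_measurable SX"
    and c_bounds: "x \<in> space SX \<Longrightarrow> 0 \<le> c x" "x \<in> space SX \<Longrightarrow> c x \<le> 1"
    and tail_le: "x \<in> space SX \<Longrightarrow> tail (Fx x) y \<le> tail F y"
    and int_tail_lim: "x \<in> space SX \<Longrightarrow> ((\<lambda>y. int_tail (Fx x) y / int_tail F y) \<longlongrightarrow> c x) at_top"
begin

lemma Fx_kernel [measurable]: "Fx \<in> measurable SX (subprob_algebra borel)"
proof (rule measurable_subprob_algebra_generated[where \<Omega>=UNIV and G="range (\<lambda>a::real. {..a})"])
  show "sets borel = sigma_sets UNIV (range (\<lambda>a::real. {..a}))"
    by (simp add: borel_eq_atMost)
  show "Int_stable (range (\<lambda>a::real. {..a}))"
    by (auto simp: Int_stable_def)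
next
  fix x assume x: "x \<in> space SX"
  then interpret Fx: integrable_dist "Fx x" by (rule Fx_dist)
  show "subprob_space (Fx x)" by (rule prob_space_imp_subprob_space) (rule Fx.prob_space_axioms)
  show "sets (Fx x) = sets borel" by simp
next
  fix A :: "real set" assume "A \<in> range (\<lambda>a. {..a})"
  then obtain a where A: "A = {..a}" by auto
  have "emeasure (Fx x) A = ennreal (measure (Fx x) {..a})" if "x \<in> space SX" for x
  proof -
    interpret Fx: integrable_dist "Fx x" using that by (rule Fx_dist)
    show ?thesis by (simp add: A Fx.emeasure_eq_measure)
  qed
  then show "(\<lambda>x. emeasure (Fx x) A) \<in> borel_measurable SX"
    using Fx_meas[of a] by (subst measurable_cong) auto
next
  have "emeasure (Fx x) UNIV = 1" if "x \<in> space SX" for x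
  proof -
    interpret Fx: integrable_dist "Fx x" using that by (rule Fx_dist)
    show ?thesis using Fx.emeasure_space_1 by simp
  qed
  then show "(\<lambda>x. emeasure (Fx x) UNIV) \<in> borel_measurable SX"
    by (subst measurable_cong) auto
qed auto

lemma measurable_tail_Fx [measurable]: "(\<lambda>x. tail (Fx x) y) \<in> borel_measurable SX"
  unfolding tail_def by measurable

lemma measurable_stop_loss_Fx [measurable]: "(\<lambda>x. stop_loss (Fx x) y) \<in> borel_measurable SX"
  unfolding stop_loss_def by (rule measurable_compose[OF Fx_kernel]) measurable

lemma stop_loss_Fx_bounds:
  assumes "x \<in> space SX"
  shows "0 \<le> stop_loss (Fx x) y" "stop_loss (Fx x) y \<le> stop_loss F y"
  using assms
  by (auto intro!: stop_loss_mono_tail H.F.integrable_dist_axioms Fx_dist tail_le integrable_dist.stop_loss_nonneg)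

text \<open>The hypothesis on integrated tails with both caps eventually inactive; a fixed shift
  \<open>b\<close> is absorbed by long-tailedness of \<open>H\<close>.\<close>

lemma stop_loss_Fx_lim:
  assumes x: "x \<in> space SX"
  shows "((\<lambda>y. stop_loss (Fx x) (y + b) / tail H y) \<longlongrightarrow> c x) at_top"
proof -
  interpret Fx: integrable_dist "Fx x" using x by (rule Fx_dist)
  have "eventually (\<lambda>y. stop_loss F y < 1) at_top"
    by (rule order_tendstoD(2)[OF H.F.tendsto_stop_loss]) simp
  then have "eventually (\<lambda>y. int_tail (Fx x) y / int_tail F y = stop_loss (Fx x) y / tail H y) at_top"
    using H.stop_loss_eq_tail
  proof eventually_elim
    case (elim y)
    then show ?case
      using stop_loss_Fx_bounds[OF x, of y] by (simp add: H.F.int_tail_eq Fx.int_tail_eq)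
  qed
  then have "((\<lambda>y. stop_loss (Fx x) y / tail H y) \<longlongrightarrow> c x) at_top"
    using int_tail_lim[OF x] by (subst (asm) tendsto_cong)
  from filterlim_compose[OF this H.filterlim_shift[of b]]
  have "((\<lambda>y. stop_loss (Fx x) (y + b) / tail H (y + b)) \<longlongrightarrow> c x) at_top" .
  from tendsto_mult[OF this H.long_tailed[of "- b"]]
  have "((\<lambda>y. stop_loss (Fx x) (y + b) / tail H (y + b) * (tail H (y + b) / tail H y)) \<longlongrightarrow> c x) at_top"
    by simp
  moreover have "stop_loss (Fx x) (y + b) / tail H (y + b) * (tail H (y + b) / tail H y) = stop_loss (Fx x) (y + b) / tail H y" for y
    using H.tail_pos[of "y + b"] by simp
  ultimately show ?thesis by (simp only:)
qed

definition C :: real where "C = (\<integral>x. c x \<partial>\<pi>)"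

lemma C_nonneg: "0 \<le> C"
  unfolding C_def using c_bounds
  by (intro Bochner_Integration.integral_nonneg) (auto simp: space_stationary_measure)

text \<open>The term \<open>real j * d\<close> is the rise of the required jump size during the
  first \<open>j\<close> steps of the cycle. Sums of \<open>cycle_tails\<close> over equally spaced
  starting levels are approximated by \<open>cycle_loss\<close> divided by the spacing.\<close>

definition cycle_loss :: "real \<Rightarrow> real \<Rightarrow> nat \<times> (nat \<Rightarrow> 'x) \<Rightarrow> real" where
  "cycle_loss d y p = (\<Sum>j<fst p. stop_loss (Fx (snd p j)) (y + real j * d))"

definition cycle_tails :: "real \<Rightarrow> real \<Rightarrow> nat \<times> (nat \<Rightarrow> 'x) \<Rightarrow> ennreal" where
  "cycle_tails d y p = (\<Sum>j<fst p. ennreal (tail (Fx (snd p j)) (y + real j * d)))"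

lemma measurable_cycle_loss [measurable]: "cycle_loss d y \<in> borel_measurable (cycle_space SX)"
  unfolding cycle_loss_def
  by (rule measurable_compose_countable[where f="\<lambda>n p. \<Sum>j<n. stop_loss (Fx (snd p j)) (y + real j * d)" and g=fst])
     measurable

lemma measurable_cycle_tails [measurable]: "cycle_tails d y \<in> borel_measurable (cycle_space SX)"
  unfolding cycle_tails_def
  by (rule measurable_compose_countable[where f="\<lambda>n p. \<Sum>j<n. ennreal (tail (Fx (snd p j)) (y + real j * d))" and g=fst])
     measurable

lemma cycle_loss_bounds:
  assumes "\<omega> \<in> space M" "0 \<le> d"
  shows "0 \<le> cycle_loss d y (cyc k \<omega>)" "cycle_loss d y (cyc k \<omega>) \<le> real (len k \<omega>) * stop_loss F y"
proof -
  show "0 \<le> cycle_loss d y (cyc k \<omega>)"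
    unfolding cycle_loss_def by (intro sum_nonneg stop_loss_Fx_bounds cyc_space assms)
  have "cycle_loss d y (cyc k \<omega>) \<le> (\<Sum>j<len k \<omega>. stop_loss F y)"
    unfolding cycle_loss_def
  proof (rule sum_mono)
    fix j
    have "stop_loss (Fx (snd (cyc k \<omega>) j)) (y + real j * d) \<le> stop_loss F (y + real j * d)"
      by (intro stop_loss_Fx_bounds cyc_space assms)
    also have "\<dots> \<le> stop_loss F y" using assms by (intro H.F.stop_loss_antimono) simp
    finally show "stop_loss (Fx (snd (cyc k \<omega>) j)) (y + real j * d) \<le> stop_loss F y" .
  qed
  then show "cycle_loss d y (cyc k \<omega>) \<le> real (len k \<omega>) * stop_loss F y" by simp
qed

lemma integrable_cycle_loss:
  assumes "0 \<le> d"
  shows "integrable M (\<lambda>\<omega>. cycle_loss d y (cyc 1 \<omega>))"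
  by (rule Bochner_Integration.integrable_bound[OF integrable_mult_left[OF integrable_len, of "stop_loss F y"]])
     (use cycle_loss_bounds[OF _ assms] in \<open>auto intro!: AE_I2 order_trans[OF _ abs_ge_self]\<close>)

text \<open>For a given cycle only finitely many fixed shifts \<open>real j * d\<close> occur, and
  long-tailedness removes them; the limit is the cycle sum of \<open>c\<close>. Domination by a
  multiple of the cycle length lets the limit pass under the expectation.\<close>

lemma expectation_cycle_loss_lim:
  assumes d: "0 \<le> d"
  shows "((\<lambda>y. expectation (\<lambda>\<omega>. cycle_loss d (y + b) (cyc 1 \<omega>)) / tail H y) \<longlongrightarrow> mean_len * C) at_top"
proof -
  have "((\<lambda>y. expectation (\<lambda>\<omega>. cycle_loss d (y + b) (cyc 1 \<omega>) / tail H y)) \<longlongrightarrow> expectation (\<lambda>\<omega>. cycle_sum c (cyc 1 \<omega>))) at_top"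
  proof (rule integral_dominated_convergence_at_top[where w="\<lambda>\<omega>. 2 * real (len 1 \<omega>)"])
    show "\<forall>\<^sub>F y in at_top. AE \<omega> in M. norm (cycle_loss d (y + b) (cyc 1 \<omega>) / tail H y) \<le> 2 * real (len 1 \<omega>)"
    proof (rule eventually_mono[OF H.eventually_stop_loss_le[of 2 b]])
      fix y assume elim: "stop_loss F (y + b) \<le> 2 * tail H y"
      show "AE \<omega> in M. norm (cycle_loss d (y + b) (cyc 1 \<omega>) / tail H y) \<le> 2 * real (len 1 \<omega>)"
      proof (rule AE_I2)
        fix \<omega> assume w: "\<omega> \<in> space M"
        have "cycle_loss d (y + b) (cyc 1 \<omega>) \<le> real (len 1 \<omega>) * stop_loss F (y + b)"
          by (rule cycle_loss_bounds[OF w d])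
        also have "\<dots> \<le> real (len 1 \<omega>) * (2 * tail H y)" using elim by (intro mult_left_mono) auto
        finally show "norm (cycle_loss d (y + b) (cyc 1 \<omega>) / tail H y) \<le> 2 * real (len 1 \<omega>)"
          using H.tail_pos[of y] cycle_loss_bounds(1)[OF w d, of "y + b" 1]
          by (simp add: divide_le_eq abs_div_pos mult_ac)
      qed
    qed simp
    show "AE \<omega> in M. ((\<lambda>y. cycle_loss d (y + b) (cyc 1 \<omega>) / tail H y) \<longlongrightarrow> cycle_sum c (cyc 1 \<omega>)) at_top"
    proof (rule AE_I2)
      fix \<omega> assume w: "\<omega> \<in> space M"
      have "((\<lambda>y. stop_loss (Fx (snd (cyc 1 \<omega>) j)) (y + b + real j * d) / tail H y) \<longlongrightarrow> c (snd (cyc 1 \<omega>) j)) at_top" for j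
        using stop_loss_Fx_lim[OF cyc_space[OF w, of 1 j], of "b + real j * d"] by (simp add: add.assoc)
      then show "((\<lambda>y. cycle_loss d (y + b) (cyc 1 \<omega>) / tail H y) \<longlongrightarrow> cycle_sum c (cyc 1 \<omega>)) at_top"
        unfolding cycle_loss_def cycle_sum_def sum_divide_distrib by (intro tendsto_sum)
    qed
  qed (use integrable_len in auto)
  moreover have "expectation (\<lambda>\<omega>. cycle_sum c (cyc 1 \<omega>)) = mean_len * C"
    unfolding C_def using c_bounds by (intro expectation_cycle_sum[where b=1]) auto
  ultimately show ?thesis by simp
qed

text \<open>The sums over grid and cycle are exchanged, so that each position falls under the
  one-law estimates \<open>suminf_tail_le\<close> and \<open>suminf_tail_ge\<close>.\<close>

lemma suminf_cycle_tails:
  assumes w: "\<omega> \<in> space M" and d: "0 < d"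
  shows "(\<Sum>i. cycle_tails r (y + d + real i * d) (cyc k \<omega>)) \<le> ennreal (cycle_loss r y (cyc k \<omega>) / d)"
    and "ennreal (cycle_loss r y (cyc k \<omega>) / d) \<le> (\<Sum>i. cycle_tails r (y + real i * d) (cyc k \<omega>))"
proof -
  have swap: "(\<Sum>i. cycle_tails r (z + real i * d) (cyc k \<omega>))
    = (\<Sum>j<len k \<omega>. \<Sum>i. ennreal (tail (Fx (snd (cyc k \<omega>) j)) (z + real j * r + real i * d)))" for z
    unfolding cycle_tails_def by (subst suminf_sum) (auto intro: summableI simp: algebra_simps)
  have loss: "ennreal (cycle_loss r y (cyc k \<omega>) / d) = (\<Sum>j<len k \<omega>. ennreal (stop_loss (Fx (snd (cyc k \<omega>) j)) (y + real j * r) / d))"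
    unfolding cycle_loss_def sum_divide_distrib using d
    by (intro sum_ennreal[symmetric] divide_nonneg_pos stop_loss_Fx_bounds cyc_space[OF w])
  show "(\<Sum>i. cycle_tails r (y + d + real i * d) (cyc k \<omega>)) \<le> ennreal (cycle_loss r y (cyc k \<omega>) / d)"
    unfolding swap loss
  proof (rule sum_mono)
    fix j
    interpret Fx: integrable_dist "Fx (snd (cyc k \<omega>) j)" by (intro Fx_dist cyc_space w)
    show "(\<Sum>i. ennreal (tail (Fx (snd (cyc k \<omega>) j)) (y + d + real j * r + real i * d)))
      \<le> ennreal (stop_loss (Fx (snd (cyc k \<omega>) j)) (y + real j * r) / d)"
      using Fx.suminf_tail_le[OF d, of "y + real j * r"] by (simp add: algebra_simps)
  qed
  show "ennreal (cycle_loss r y (cyc k \<omega>) / d) \<le> (\<Sum>i. cycle_tails r (y + real i * d) (cyc k \<omega>))"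
    unfolding swap loss
  proof (rule sum_mono)
    fix j
    interpret Fx: integrable_dist "Fx (snd (cyc k \<omega>) j)" by (intro Fx_dist cyc_space w)
    show "ennreal (stop_loss (Fx (snd (cyc k \<omega>) j)) (y + real j * r) / d)
      \<le> (\<Sum>i. ennreal (tail (Fx (snd (cyc k \<omega>) j)) (y + real j * r + real i * d)))"
      by (rule Fx.suminf_tail_ge[OF d])
  qed
qed

lemma cycle_tails_antimono:
  assumes "\<omega> \<in> space M" "y \<le> z"
  shows "cycle_tails r z (cyc k \<omega>) \<le> cycle_tails r y (cyc k \<omega>)"
  unfolding cycle_tails_def
proof (intro sum_mono ennreal_leI)
  fix j
  interpret Fx: integrable_dist "Fx (snd (cyc k \<omega>) j)" by (intro Fx_dist cyc_space assms)
  show "tail (Fx (snd (cyc k \<omega>) j)) (z + real j * r) \<le> tail (Fx (snd (cyc k \<omega>) j)) (y + real j * r)"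
    using assms by (intro Fx.tail_antimono) simp
qed

lemma cycle_tails_le:
  assumes "\<omega> \<in> space M" "0 \<le> r"
  shows "cycle_tails r y (cyc k \<omega>) \<le> ennreal (tail F y) * ennreal (real (len k \<omega>))"
proof -
  have "cycle_tails r y (cyc k \<omega>) \<le> (\<Sum>j<len k \<omega>. ennreal (tail F y))"
    unfolding cycle_tails_def
  proof (intro sum_mono ennreal_leI)
    fix j
    have "tail (Fx (snd (cyc k \<omega>) j)) (y + real j * r) \<le> tail F (y + real j * r)"
      by (intro tail_le cyc_space assms)
    also have "\<dots> \<le> tail F y" using assms by (intro H.F.tail_antimono) simp
    finally show "tail (Fx (snd (cyc k \<omega>) j)) (y + real j * r) \<le> tail F y" .
  qed
  then show ?thesis by (simp add: mult.commute ennreal_of_nat_eq_real_of_nat)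
qed

text \<open>The expected number of steps that exceed a level rising by \<open>d\<close> per unit of
  time. Step \<open>Suc n\<close> is taken from the line at time \<open>n\<close>, hence
  \<open>X (Suc n)\<close> paired with \<open>real n * d\<close>.\<close>

definition jump_mass :: "real \<Rightarrow> real \<Rightarrow> ennreal" where
  "jump_mass d y = (\<integral>\<^sup>+\<omega>. (\<Sum>n. ennreal (tail (Fx (X (Suc n) \<omega>)) (y + real n * d))) \<partial>M)"

text \<open>The partial sums are followed along the subsequence of epochs, which determines the
  limit because the series of nonnegative terms converges in \<open>ennreal\<close>.\<close>

lemma suminf_cycles:
  assumes w: "\<omega> \<in> space M"
  shows "(\<Sum>n. ennreal (tail (Fx (X (Suc n) \<omega>)) (y + real n * d)))
    = (\<Sum>n<T 0 \<omega>. ennreal (tail (Fx (X (Suc n) \<omega>)) (y + real n * d)))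
      + (\<Sum>k. cycle_tails d (y + real (T k \<omega>) * d) (cyc (Suc k) \<omega>))"
proof -
  let ?t = "\<lambda>n. ennreal (tail (Fx (X (Suc n) \<omega>)) (y + real n * d))"
  have "(\<lambda>N. \<Sum>n<N. ?t n) \<longlonglongrightarrow> (\<Sum>n. ?t n)"
    by (intro summable_LIMSEQ summableI)
  from LIMSEQ_subseq_LIMSEQ[OF this T_strict_mono[OF w]]
  have "(\<lambda>k. \<Sum>n<T k \<omega>. ?t n) \<longlonglongrightarrow> (\<Sum>n. ?t n)" by (simp add: comp_def)
  moreover have "(\<lambda>k. \<Sum>n<T k \<omega>. ?t n)
     \<longlonglongrightarrow> (\<Sum>n<T 0 \<omega>. ?t n) + (\<Sum>k. cycle_tails d (y + real (T k \<omega>) * d) (cyc (Suc k) \<omega>))"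
  proof (rule Lim_transform_eventually)
    show "(\<lambda>k. (\<Sum>n<T 0 \<omega>. ?t n) + (\<Sum>l<k. cycle_tails d (y + real (T l \<omega>) * d) (cyc (Suc l) \<omega>)))
     \<longlonglongrightarrow> (\<Sum>n<T 0 \<omega>. ?t n) + (\<Sum>k. cycle_tails d (y + real (T k \<omega>) * d) (cyc (Suc k) \<omega>))"
      by (intro tendsto_add tendsto_const summable_LIMSEQ summableI)
    have "(\<Sum>n<T 0 \<omega>. ?t n) + (\<Sum>l<k. cycle_tails d (y + real (T l \<omega>) * d) (cyc (Suc l) \<omega>)) = (\<Sum>n<T k \<omega>. ?t n)" for k
      using sum_cycles[OF w, of ?t k]
      by (simp add: cycle_tails_def cyc_value algebra_simps)
    then show "\<forall>\<^sub>F k in sequentially. (\<Sum>n<T 0 \<omega>. ?t n) + (\<Sum>l<k. cycle_tails d (y + real (T l \<omega>) * d) (cyc (Suc l) \<omega>))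
      = (\<Sum>n<T k \<omega>. ?t n)"
      by (intro always_eventually allI)
  qed
  ultimately show ?thesis by (rule LIMSEQ_unique)
qed

end

section \<open>Initial cycle and two-sided asymptotics of the jump mass\<close>

context modulated_tails
begin

lemma measurable_initial_sum [measurable]:
  fixes h :: "nat \<Rightarrow> 'w \<Rightarrow> 'b::{second_countable_topology, topological_comm_monoid_add}"
  assumes [measurable]: "\<And>n. h n \<in> borel_measurable M"
  shows "(\<lambda>\<omega>. \<Sum>n<T 0 \<omega>. h n \<omega>) \<in> borel_measurable M"
  by (rule measurable_compose_countable[where f="\<lambda>k \<omega>. \<Sum>n<k. h n \<omega>" and g="T 0"]) measurable

lemma initial_sum_le:
  assumes "0 < d"
  shows "0 \<le> (\<Sum>n<N. tail F (y + real n * d))" "(\<Sum>n<N. tail F (y + real n * d)) \<le> stop_loss F (y - d) / d"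
  using H.F.sum_tail_le[OF assms, where y="y - d" and N=N] by (auto intro!: sum_nonneg H.F.tail_bounds)

lemma integrable_initial_sum:
  assumes "0 < d"
  shows "integrable M (\<lambda>\<omega>. \<Sum>n<T 0 \<omega>. tail F (y + real n * d))"
  by (rule integrable_const_bound[of _ "stop_loss F (y - d) / d"])
     (use initial_sum_le[OF assms] in \<open>auto intro!: AE_I2\<close>)

text \<open>Each single term is negligible against \<open>tail H\<close>, while the whole sum is at
  most about \<open>tail H y / d\<close> however long the initial cycle is. Dominated convergence
  thus works with a constant majorant and no moment of \<open>T 0\<close>.\<close>

lemma initial_sum_negligible:
  assumes d: "0 < d"
  shows "((\<lambda>y. expectation (\<lambda>\<omega>. \<Sum>n<T 0 \<omega>. tail F (y + b + real n * d)) / tail H y) \<longlongrightarrow> 0) at_top"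
proof -
  have "((\<lambda>y. expectation (\<lambda>\<omega>. (\<Sum>n<T 0 \<omega>. tail F (y + b + real n * d)) / tail H y)) \<longlongrightarrow> expectation (\<lambda>\<omega>. 0)) at_top"
  proof (rule integral_dominated_convergence_at_top[where w="\<lambda>\<omega>. 2 / d"])
    show "\<forall>\<^sub>F y in at_top. AE \<omega> in M. norm ((\<Sum>n<T 0 \<omega>. tail F (y + b + real n * d)) / tail H y) \<le> 2 / d"
    proof (rule eventually_mono[OF H.eventually_stop_loss_le[of 2 "b - d"]])
      fix y assume y: "stop_loss F (y + (b - d)) \<le> 2 * tail H y"
      show "AE \<omega> in M. norm ((\<Sum>n<T 0 \<omega>. tail F (y + b + real n * d)) / tail H y) \<le> 2 / d"
      proof (rule AE_I2)
        fix \<omega>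
        have "(\<Sum>n<T 0 \<omega>. tail F (y + b + real n * d)) \<le> stop_loss F (y + b - d) / d"
          by (rule initial_sum_le[OF d])
        also have "\<dots> \<le> 2 * tail H y / d"
          using y d by (intro divide_right_mono) (auto simp: algebra_simps)
        finally show "norm ((\<Sum>n<T 0 \<omega>. tail F (y + b + real n * d)) / tail H y) \<le> 2 / d"
          using H.tail_pos[of y] initial_sum_le(1)[OF d, of "y + b" "T 0 \<omega>"]
          by (simp add: divide_le_eq abs_div_pos mult_ac)
      qed
    qed simp
    show "AE \<omega> in M. ((\<lambda>y. (\<Sum>n<T 0 \<omega>. tail F (y + b + real n * d)) / tail H y) \<longlongrightarrow> 0) at_top"
    proof (rule AE_I2)
      fix \<omega>
      have "((\<lambda>y. \<Sum>n<T 0 \<omega>. tail F (y + (b + real n * d)) / tail H y) \<longlongrightarrow> (\<Sum>n<T 0 \<omega>. 0)) at_top"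
        by (intro tendsto_sum H.tail_F_negligible)
      then show "((\<lambda>y. (\<Sum>n<T 0 \<omega>. tail F (y + b + real n * d)) / tail H y) \<longlongrightarrow> 0) at_top"
        by (simp add: sum_divide_distrib add.assoc)
    qed
  qed auto
  then show ?thesis by simp
qed

lemma suminf_nn_integral_cycle_tails:
  assumes d: "0 < d" and r: "0 \<le> r"
  shows "(\<Sum>i. \<integral>\<^sup>+\<omega>. cycle_tails r (y + d + real i * d) (cyc 1 \<omega>) \<partial>M)
      \<le> ennreal (expectation (\<lambda>\<omega>. cycle_loss r y (cyc 1 \<omega>)) / d)"
    and "ennreal (expectation (\<lambda>\<omega>. cycle_loss r y (cyc 1 \<omega>)) / d)
      \<le> (\<Sum>i. \<integral>\<^sup>+\<omega>. cycle_tails r (y + real i * d) (cyc 1 \<omega>) \<partial>M)"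
proof -
  have e: "(\<integral>\<^sup>+\<omega>. ennreal (cycle_loss r y (cyc 1 \<omega>) / d) \<partial>M) = ennreal (expectation (\<lambda>\<omega>. cycle_loss r y (cyc 1 \<omega>)) / d)"
    using d cycle_loss_bounds(1)[OF _ r] integrable_cycle_loss[OF r]
    by (subst nn_integral_eq_integral) (auto intro!: AE_I2)
  show "(\<Sum>i. \<integral>\<^sup>+\<omega>. cycle_tails r (y + d + real i * d) (cyc 1 \<omega>) \<partial>M)
      \<le> ennreal (expectation (\<lambda>\<omega>. cycle_loss r y (cyc 1 \<omega>)) / d)"
    unfolding e[symmetric]
    by (subst nn_integral_suminf[symmetric]) (auto intro!: nn_integral_mono suminf_cycle_tails[OF _ d])
  show "ennreal (expectation (\<lambda>\<omega>. cycle_loss r y (cyc 1 \<omega>)) / d)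
      \<le> (\<Sum>i. \<integral>\<^sup>+\<omega>. cycle_tails r (y + real i * d) (cyc 1 \<omega>) \<partial>M)"
    unfolding e[symmetric]
    by (subst nn_integral_suminf[symmetric]) (auto intro!: nn_integral_mono suminf_cycle_tails[OF _ d])
qed

text \<open>Outside a rare event the random start \<open>T k\<close> of a cycle may be replaced by a
  linear function of \<open>k\<close>, and the cycle levels form an arithmetic progression. On the
  rare event the cruder \<open>k \<le> T k\<close> is used with tails of \<open>F\<close>;
  independence of the following cycle brings out the factor \<open>e\<close>.\<close>

lemma jump_mass_le:
  assumes d: "0 < d" and \<eta>: "0 < \<eta>" "\<eta> < mean_len" and "0 \<le> e"
    and K: "\<And>k. prob {\<omega> \<in> space M. real (T k \<omega>) < real k * (mean_len - \<eta>) - K} \<le> e"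
  shows "jump_mass d z \<le> ennreal (expectation (\<lambda>\<omega>. \<Sum>n<T 0 \<omega>. tail F (z + real n * d)))
     + (ennreal (expectation (\<lambda>\<omega>. cycle_loss d (z - K * d - (mean_len - \<eta>) * d) (cyc 1 \<omega>)) / ((mean_len - \<eta>) * d))
     + ennreal (e * mean_len * (stop_loss F (z - d) / d)))"
proof -
  define d' where "d' = (mean_len - \<eta>) * d"
  have d': "0 < d'" using \<eta> d by (simp add: d'_def)
  \<comment> \<open>The level \<open>y + d' + real k * d'\<close> is
    \<open>z - K * d + real k * d'\<close>, not above \<open>z + real (T k \<omega>) * d\<close>
    outside \<open>Bad k\<close>; the extra \<open>d'\<close> is the mesh shift of
    \<open>suminf_tail_le\<close>.\<close>
  define y where "y = z - K * d - d'"
  define Bad where "Bad = (\<lambda>k. {\<omega> \<in> space M. real (T k \<omega>) < real k * (mean_len - \<eta>) - K})"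
  have [measurable]: "Bad k \<in> events" for k unfolding Bad_def by measurable
  define V where "V = (\<lambda>k \<omega>. cycle_tails d (y + d' + real k * d') (cyc (Suc k) \<omega>)
      + ennreal (tail F (z + real k * d)) * (indicator (Bad k) \<omega> * ennreal (real (len (Suc k) \<omega>))))"
  have "jump_mass d z \<le> (\<integral>\<^sup>+\<omega>. ennreal (\<Sum>n<T 0 \<omega>. tail F (z + real n * d)) + (\<Sum>k. V k \<omega>) \<partial>M)"
    unfolding jump_mass_def
  proof (rule nn_integral_mono)
    fix \<omega> assume w: "\<omega> \<in> space M"
    have "(\<Sum>n<T 0 \<omega>. ennreal (tail (Fx (X (Suc n) \<omega>)) (z + real n * d))) \<le> (\<Sum>n<T 0 \<omega>. ennreal (tail F (z + real n * d)))"
      by (intro sum_mono ennreal_leI tail_le measurable_space[OF measurable_X w])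
    also have "\<dots> = ennreal (\<Sum>n<T 0 \<omega>. tail F (z + real n * d))"
      by (rule sum_ennreal) (rule H.F.tail_bounds)
    finally have 1: "(\<Sum>n<T 0 \<omega>. ennreal (tail (Fx (X (Suc n) \<omega>)) (z + real n * d)))
      \<le> ennreal (\<Sum>n<T 0 \<omega>. tail F (z + real n * d))" .
    have 2: "cycle_tails d (z + real (T k \<omega>) * d) (cyc (Suc k) \<omega>) \<le> V k \<omega>" for k
    proof (cases "\<omega> \<in> Bad k")
      case True
      have "cycle_tails d (z + real (T k \<omega>) * d) (cyc (Suc k) \<omega>)
        \<le> ennreal (tail F (z + real (T k \<omega>) * d)) * ennreal (real (len (Suc k) \<omega>))"
        using d by (intro cycle_tails_le w) simp
      also have "\<dots> \<le> ennreal (tail F (z + real k * d)) * ennreal (real (len (Suc k) \<omega>))"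
        using T_ge[OF w, of k] d
        by (intro mult_right_mono ennreal_leI H.F.tail_antimono) (auto intro!: mult_right_mono)
      finally show ?thesis using True by (auto simp: V_def intro: add_increasing)
    next
      case False
      then have "real k * (mean_len - \<eta>) - K \<le> real (T k \<omega>)" using w by (simp add: Bad_def)
      then have "(real k * (mean_len - \<eta>) - K) * d \<le> real (T k \<omega>) * d" using d by (intro mult_right_mono) auto
      then have "cycle_tails d (z + real (T k \<omega>) * d) (cyc (Suc k) \<omega>)
        \<le> cycle_tails d (y + d' + real k * d') (cyc (Suc k) \<omega>)"
        by (intro cycle_tails_antimono w) (simp add: y_def d'_def algebra_simps)
      then show ?thesis by (auto simp: V_def intro: add_increasing2)
    qed
    show "(\<Sum>n. ennreal (tail (Fx (X (Suc n) \<omega>)) (z + real n * d)))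
      \<le> ennreal (\<Sum>n<T 0 \<omega>. tail F (z + real n * d)) + (\<Sum>k. V k \<omega>)"
      unfolding suminf_cycles[OF w] by (intro add_mono 1 suminf_le 2 summableI)
  qed
  also have "\<dots> = (\<integral>\<^sup>+\<omega>. ennreal (\<Sum>n<T 0 \<omega>. tail F (z + real n * d)) \<partial>M) + (\<Sum>k. \<integral>\<^sup>+\<omega>. V k \<omega> \<partial>M)"
  proof -
    have "V k \<in> borel_measurable M" for k unfolding V_def by measurable
    then show ?thesis by (subst nn_integral_add) (auto simp: nn_integral_suminf)
  qed
  also have "(\<integral>\<^sup>+\<omega>. ennreal (\<Sum>n<T 0 \<omega>. tail F (z + real n * d)) \<partial>M)
     = ennreal (expectation (\<lambda>\<omega>. \<Sum>n<T 0 \<omega>. tail F (z + real n * d)))"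
    using initial_sum_le(1)[OF d] by (intro nn_integral_eq_integral integrable_initial_sum d) auto
  also have "(\<Sum>k. \<integral>\<^sup>+\<omega>. V k \<omega> \<partial>M) \<le> (\<Sum>k. (\<integral>\<^sup>+\<omega>. cycle_tails d (y + d' + real k * d') (cyc 1 \<omega>) \<partial>M)
      + ennreal (e * mean_len) * ennreal (tail F (z + real k * d)))"
  proof (intro suminf_le summableI)
    fix k
    have "(\<integral>\<^sup>+\<omega>. indicator (Bad k) \<omega> * ennreal (real (len (Suc k) \<omega>)) \<partial>M)
       = ennreal (prob (Bad k)) * ennreal mean_len"
      unfolding Bad_def nn_integral_len[symmetric]
      by (rule nn_integral_past_cyc[where \<phi>="\<lambda>p. ennreal (real (fst p))"]) measurable
    also have "\<dots> \<le> ennreal e * ennreal mean_len"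
      unfolding Bad_def by (intro mult_right_mono ennreal_leI K) auto
    also have "\<dots> = ennreal (e * mean_len)"
      using \<open>0 \<le> e\<close> by (simp add: ennreal_mult')
    finally have bad: "(\<integral>\<^sup>+\<omega>. indicator (Bad k) \<omega> * ennreal (real (len (Suc k) \<omega>)) \<partial>M) \<le> ennreal (e * mean_len)" .
    have "(\<integral>\<^sup>+\<omega>. V k \<omega> \<partial>M) = (\<integral>\<^sup>+\<omega>. cycle_tails d (y + d' + real k * d') (cyc (Suc k) \<omega>) \<partial>M)
      + ennreal (tail F (z + real k * d)) * (\<integral>\<^sup>+\<omega>. indicator (Bad k) \<omega> * ennreal (real (len (Suc k) \<omega>)) \<partial>M)"
      unfolding V_def by (simp add: nn_integral_add nn_integral_cmult)
    also have "(\<integral>\<^sup>+\<omega>. cycle_tails d (y + d' + real k * d') (cyc (Suc k) \<omega>) \<partial>M)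
       = (\<integral>\<^sup>+\<omega>. cycle_tails d (y + d' + real k * d') (cyc 1 \<omega>) \<partial>M)"
      by (rule nn_integral_cyc) measurable
    finally have V: "(\<integral>\<^sup>+\<omega>. V k \<omega> \<partial>M) = (\<integral>\<^sup>+\<omega>. cycle_tails d (y + d' + real k * d') (cyc 1 \<omega>) \<partial>M)
      + ennreal (tail F (z + real k * d)) * (\<integral>\<^sup>+\<omega>. indicator (Bad k) \<omega> * ennreal (real (len (Suc k) \<omega>)) \<partial>M)" .
    show "(\<integral>\<^sup>+\<omega>. V k \<omega> \<partial>M) \<le> (\<integral>\<^sup>+\<omega>. cycle_tails d (y + d' + real k * d') (cyc 1 \<omega>) \<partial>M)
      + ennreal (e * mean_len) * ennreal (tail F (z + real k * d))"
      unfolding V mult.commute[of "ennreal (e * mean_len)"]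
      by (intro add_left_mono mult_left_mono bad) auto
  qed
  also have "\<dots> = (\<Sum>k. \<integral>\<^sup>+\<omega>. cycle_tails d (y + d' + real k * d') (cyc 1 \<omega>) \<partial>M)
      + ennreal (e * mean_len) * (\<Sum>k. ennreal (tail F (z + real k * d)))"
    by (simp add: suminf_add[symmetric] summableI)
  also have "\<dots> \<le> ennreal (expectation (\<lambda>\<omega>. cycle_loss d y (cyc 1 \<omega>)) / d')
      + ennreal (e * mean_len) * ennreal (stop_loss F (z - d) / d)"
    using H.F.suminf_tail_le[OF d, of "z - d"] d
    by (intro add_mono mult_left_mono suminf_nn_integral_cycle_tails[OF d']) auto
  finally show ?thesis
    using \<open>0 \<le> e\<close> mean_len_ge_1 by (simp add: y_def d'_def ennreal_mult'[symmetric] add_left_mono)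
qed

text \<open>Only cycles that start no later than a linear bound are kept. That event concerns the
  past, so by independence it costs a factor of at least \<open>1 - e\<close>; the initial cycle is
  dropped.\<close>

lemma jump_mass_ge:
  assumes d: "0 < d" and \<eta>: "0 < \<eta>" and e: "e \<le> 1"
    and K: "\<And>k. prob {\<omega> \<in> space M. real k * (mean_len + \<eta>) + K < real (T k \<omega>)} \<le> e"
  shows "ennreal ((1 - e) * (expectation (\<lambda>\<omega>. cycle_loss d (z + K * d) (cyc 1 \<omega>)) / ((mean_len + \<eta>) * d)))
    \<le> jump_mass d z"
proof -
  define d' where "d' = (mean_len + \<eta>) * d"
  have d': "0 < d'" using \<eta> d mean_len_ge_1 by (simp add: d'_def)
  define y where "y = z + K * d"
  define Good where "Good = (\<lambda>k. {\<omega> \<in> space M. real (T k \<omega>) \<le> real k * (mean_len + \<eta>) + K})"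
  have [measurable]: "Good k \<in> events" for k unfolding Good_def by measurable
  define V where "V = (\<lambda>k \<omega>. indicator (Good k) \<omega> * cycle_tails d (y + real k * d') (cyc (Suc k) \<omega>))"
  have "ennreal ((1 - e) * (expectation (\<lambda>\<omega>. cycle_loss d y (cyc 1 \<omega>)) / d'))
     = ennreal (1 - e) * ennreal (expectation (\<lambda>\<omega>. cycle_loss d y (cyc 1 \<omega>)) / d')"
    by (rule ennreal_mult') (use e in simp)
  also have "\<dots> \<le> ennreal (1 - e) * (\<Sum>k. \<integral>\<^sup>+\<omega>. cycle_tails d (y + real k * d') (cyc 1 \<omega>) \<partial>M)"
    using d by (intro mult_left_mono suminf_nn_integral_cycle_tails(2)[OF d']) auto
  also have "\<dots> = (\<Sum>k. ennreal (1 - e) * (\<integral>\<^sup>+\<omega>. cycle_tails d (y + real k * d') (cyc 1 \<omega>) \<partial>M))"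
    by simp
  also have "\<dots> \<le> (\<Sum>k. \<integral>\<^sup>+\<omega>. V k \<omega> \<partial>M)"
  proof (intro suminf_le summableI)
    fix k
    have "1 - e \<le> prob (Good k)"
    proof -
      have "prob (Good k) = 1 - prob (space M - Good k)" by (simp add: prob_compl)
      moreover have "space M - Good k = {\<omega> \<in> space M. real k * (mean_len + \<eta>) + K < real (T k \<omega>)}"
        by (auto simp: Good_def)
      ultimately show ?thesis using K[of k] by simp
    qed
    moreover have "(\<integral>\<^sup>+\<omega>. V k \<omega> \<partial>M) = ennreal (prob (Good k)) * (\<integral>\<^sup>+\<omega>. cycle_tails d (y + real k * d') (cyc 1 \<omega>) \<partial>M)"
      unfolding V_def Good_def by (rule nn_integral_past_cyc) measurable
    ultimately show "ennreal (1 - e) * (\<integral>\<^sup>+\<omega>. cycle_tails d (y + real k * d') (cyc 1 \<omega>) \<partial>M) \<le> (\<integral>\<^sup>+\<omega>. V k \<omega> \<partial>M)"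
      by (simp add: mult_right_mono ennreal_leI)
  qed
  also have "\<dots> = (\<integral>\<^sup>+\<omega>. (\<Sum>k. V k \<omega>) \<partial>M)"
    by (rule nn_integral_suminf[symmetric]) (simp add: V_def)
  also have "\<dots> \<le> jump_mass d z"
    unfolding jump_mass_def
  proof (rule nn_integral_mono)
    fix \<omega> assume w: "\<omega> \<in> space M"
    have "V k \<omega> \<le> cycle_tails d (z + real (T k \<omega>) * d) (cyc (Suc k) \<omega>)" for k
    proof (cases "\<omega> \<in> Good k")
      case True
      then have "real (T k \<omega>) \<le> real k * (mean_len + \<eta>) + K" by (simp add: Good_def)
      then have "real (T k \<omega>) * d \<le> (real k * (mean_len + \<eta>) + K) * d" using d by (intro mult_right_mono) auto
      then have "cycle_tails d (y + real k * d') (cyc (Suc k) \<omega>) \<le> cycle_tails d (z + real (T k \<omega>) * d) (cyc (Suc k) \<omega>)"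
        by (intro cycle_tails_antimono w) (simp add: y_def d'_def algebra_simps)
      then show ?thesis using True by (simp add: V_def)
    qed (simp add: V_def)
    then have "(\<Sum>k. V k \<omega>) \<le> (\<Sum>k. cycle_tails d (z + real (T k \<omega>) * d) (cyc (Suc k) \<omega>))"
      by (intro suminf_le summableI)
    then show "(\<Sum>k. V k \<omega>) \<le> (\<Sum>n. ennreal (tail (Fx (X (Suc n) \<omega>)) (z + real n * d)))"
      unfolding suminf_cycles[OF w] by (rule add_increasing[OF zero_le])
  qed
  finally show ?thesis by (simp add: y_def d'_def)
qed

lemma eventually_jump_mass_le:
  assumes d: "0 < d" and e: "0 < e"
  shows "eventually (\<lambda>y. jump_mass d (y + b) \<le> ennreal ((C / d + e) * tail H y)) at_top"
proof -
  have m: "0 < mean_len" using mean_len_ge_1 by simp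
  have "((\<lambda>\<eta>. mean_len * C / ((mean_len - \<eta>) * d)) \<longlongrightarrow> mean_len * C / ((mean_len - 0) * d)) (at_right 0)"
    using m d by (intro tendsto_intros) auto
  then have "eventually (\<lambda>\<eta>. mean_len * C / ((mean_len - \<eta>) * d) < C / d + e / 4) (at_right 0)"
    using m d e by (intro order_tendstoD(2)) auto
  moreover have "eventually (\<lambda>\<eta>. \<eta> < mean_len) (at_right 0)"
    using m by (auto simp: eventually_at_right_field)
  ultimately have "eventually (\<lambda>\<eta>. mean_len * C / ((mean_len - \<eta>) * d) < C / d + e / 4 \<and> \<eta> < mean_len \<and> 0 < \<eta>) (at_right 0)"
    using eventually_at_right_less[of "0::real"] by eventually_elim auto
  then obtain \<eta> where \<eta>: "mean_len * C / ((mean_len - \<eta>) * d) < C / d + e / 4" "\<eta> < mean_len" "0 < \<eta>"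
    using eventually_happens'[OF trivial_limit_at_right_real] by blast
  \<comment> \<open>With \<open>stop_loss \<le> 2 * tail H y\<close> the error from late cycle
    counts becomes \<open>e1 * mean_len * 2 / d = e / 4\<close> times the tail.\<close>
  define e1 where "e1 = e * d / (8 * mean_len)"
  have e1: "0 < e1" using e d m by (simp add: e1_def)
  obtain K where K: "\<And>k. prob {\<omega> \<in> space M. real (T k \<omega>) < real k * (mean_len - \<eta>) - K} \<le> e1"
    using eventually_happens'[OF _ T_rarely_small[OF \<eta>(3) e1]] by auto
  define d' where "d' = (mean_len - \<eta>) * d"
  have d': "0 < d'" using \<eta> d by (simp add: d'_def)
  have "eventually (\<lambda>y. expectation (\<lambda>\<omega>. \<Sum>n<T 0 \<omega>. tail F (y + b + real n * d)) / tail H y < e / 4) at_top"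
    using e by (intro order_tendstoD(2)[OF initial_sum_negligible[OF d]]) auto
  moreover have "eventually (\<lambda>y. expectation (\<lambda>\<omega>. cycle_loss d (y + (b - K * d - d')) (cyc 1 \<omega>)) / tail H y
      < mean_len * C + e / 4 * d') at_top"
    using e d' d by (intro order_tendstoD(2)[OF expectation_cycle_loss_lim]) auto
  moreover have "eventually (\<lambda>y. stop_loss F (y + (b - d)) \<le> 2 * tail H y) at_top"
    by (rule H.eventually_stop_loss_le) simp
  ultimately show ?thesis
  proof eventually_elim
    case (elim y)
    note t = H.tail_pos[of y]
    have 1: "expectation (\<lambda>\<omega>. \<Sum>n<T 0 \<omega>. tail F (y + b + real n * d)) \<le> e / 4 * tail H y"
      using elim(1) t by (simp add: divide_less_eq)
    have 2: "expectation (\<lambda>\<omega>. cycle_loss d (y + b - K * d - d') (cyc 1 \<omega>)) / d' \<le> (C / d + e / 4 + e / 4) * tail H y"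
    proof -
      have "expectation (\<lambda>\<omega>. cycle_loss d (y + b - K * d - d') (cyc 1 \<omega>)) \<le> (mean_len * C + e / 4 * d') * tail H y"
        using elim(2) t by (simp add: divide_less_eq algebra_simps)
      then have "expectation (\<lambda>\<omega>. cycle_loss d (y + b - K * d - d') (cyc 1 \<omega>)) / d' \<le> (mean_len * C + e / 4 * d') * tail H y / d'"
        using d' by (intro divide_right_mono) auto
      also have "\<dots> = (mean_len * C / d' + e / 4) * tail H y" using d' by (simp add: field_simps)
      also have "\<dots> \<le> (C / d + e / 4 + e / 4) * tail H y"
        using \<eta>(1) t unfolding d'_def by (intro mult_right_mono) auto
      finally show ?thesis .
    qed
    have 3: "e1 * mean_len * (stop_loss F (y + b - d) / d) \<le> e / 4 * tail H y"
    proof -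
      have "e1 * mean_len * (stop_loss F (y + b - d) / d) = e / 8 * stop_loss F (y + (b - d))"
        using m d by (simp add: e1_def algebra_simps)
      also have "\<dots> \<le> e / 8 * (2 * tail H y)" using elim(3) e by (intro mult_left_mono) auto
      finally show ?thesis by simp
    qed
    have "jump_mass d (y + b) \<le> ennreal (e / 4 * tail H y) + (ennreal ((C / d + e / 4 + e / 4) * tail H y) + ennreal (e / 4 * tail H y))"
      using jump_mass_le[OF d \<eta>(3,2) less_imp_le[OF e1] K, of "y + b"] 1 2 3 unfolding d'_def
      by (elim order_trans) (intro add_mono ennreal_leI)
    also have "\<dots> = ennreal (e / 4 * tail H y + ((C / d + e / 4 + e / 4) * tail H y + e / 4 * tail H y))"
      using e t d C_nonneg by (simp add: ennreal_plus[symmetric] del: ennreal_plus)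
    also have "e / 4 * tail H y + ((C / d + e / 4 + e / 4) * tail H y + e / 4 * tail H y) = (C / d + e) * tail H y"
      by (simp add: algebra_simps)
    finally show ?case .
  qed
qed

lemma eventually_jump_mass_ge:
  assumes d: "0 < d" and e: "0 < e"
  shows "eventually (\<lambda>y. ennreal ((C / d - e) * tail H y) \<le> jump_mass d (y + b)) at_top"
proof -
  have m: "0 < mean_len" using mean_len_ge_1 by simp
  have "((\<lambda>\<eta>. (1 - \<eta>) * (mean_len * C / ((mean_len + \<eta>) * d))) \<longlongrightarrow> (1 - 0) * (mean_len * C / ((mean_len + 0) * d))) (at_right 0)"
    using m d by (intro tendsto_intros) auto
  then have "eventually (\<lambda>\<eta>. C / d - e / 2 < (1 - \<eta>) * (mean_len * C / ((mean_len + \<eta>) * d))) (at_right 0)"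
    using m d e by (intro order_tendstoD(1)) auto
  moreover have "eventually (\<lambda>\<eta>::real. \<eta> < 1) (at_right 0)"
    by (auto simp: eventually_at_right_field intro: exI[of _ 1])
  ultimately have "eventually (\<lambda>\<eta>. C / d - e / 2 < (1 - \<eta>) * (mean_len * C / ((mean_len + \<eta>) * d)) \<and> \<eta> < 1 \<and> 0 < \<eta>) (at_right 0)"
    using eventually_at_right_less[of "0::real"] by eventually_elim auto
  then obtain \<eta> where \<eta>: "C / d - e / 2 < (1 - \<eta>) * (mean_len * C / ((mean_len + \<eta>) * d))" "\<eta> < 1" "0 < \<eta>"
    using eventually_happens'[OF trivial_limit_at_right_real] by blast
  \<comment> \<open>The same \<open>\<eta>\<close> serves as slope excess and as exceptional
    probability; it was chosen with both losses accounted for.\<close>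
  obtain K where K: "\<And>k. prob {\<omega> \<in> space M. real k * (mean_len + \<eta>) + K < real (T k \<omega>)} \<le> \<eta>"
    using eventually_happens'[OF _ T_rarely_large[OF \<eta>(3) \<eta>(3)]] by auto
  define d' where "d' = (mean_len + \<eta>) * d"
  have d': "0 < d'" using \<eta> d m by (simp add: d'_def)
  have "eventually (\<lambda>y. mean_len * C - e / 2 * d'
      < expectation (\<lambda>\<omega>. cycle_loss d (y + (b + K * d)) (cyc 1 \<omega>)) / tail H y) at_top"
    using e d' d by (intro order_tendstoD(1)[OF expectation_cycle_loss_lim]) auto
  then show ?thesis
  proof eventually_elim
    case (elim y)
    note t = H.tail_pos[of y]
    have "(mean_len * C - e / 2 * d') * tail H y \<le> expectation (\<lambda>\<omega>. cycle_loss d (y + b + K * d) (cyc 1 \<omega>))"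
      using elim t by (simp add: less_divide_eq algebra_simps)
    then have "(mean_len * C - e / 2 * d') * tail H y / d' \<le> expectation (\<lambda>\<omega>. cycle_loss d (y + b + K * d) (cyc 1 \<omega>)) / d'"
      using d' by (intro divide_right_mono) auto
    then have "(1 - \<eta>) * ((mean_len * C / d' - e / 2) * tail H y) \<le> (1 - \<eta>) * (expectation (\<lambda>\<omega>. cycle_loss d (y + b + K * d) (cyc 1 \<omega>)) / d')"
      using d' \<eta> by (intro mult_left_mono) (auto simp: field_simps)
    moreover have "(C / d - e) * tail H y \<le> (1 - \<eta>) * ((mean_len * C / d' - e / 2) * tail H y)"
    proof -
      have "C / d - e \<le> (1 - \<eta>) * (mean_len * C / d') - (1 - \<eta>) * (e / 2)"
      proof -
        have "(1 - \<eta>) * (e / 2) \<le> e / 2" using \<eta> e by (simp add: mult_left_le_one_le)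
        with \<eta>(1) show ?thesis unfolding d'_def by linarith
      qed
      then have "(C / d - e) * tail H y \<le> ((1 - \<eta>) * (mean_len * C / d') - (1 - \<eta>) * (e / 2)) * tail H y"
        using t by (intro mult_right_mono) auto
      then show ?thesis by (simp add: algebra_simps)
    qed
    ultimately have "ennreal ((C / d - e) * tail H y) \<le> ennreal ((1 - \<eta>) * (expectation (\<lambda>\<omega>. cycle_loss d (y + b + K * d) (cyc 1 \<omega>)) / d'))"
      by (intro ennreal_leI) linarith
    also have "\<dots> \<le> jump_mass d (y + b)"
      unfolding d'_def by (rule jump_mass_ge[OF d \<eta>(3) less_imp_le[OF \<eta>(2)] K])
    finally show ?case .
  qed
qed

end

section \<open>Replacing the increments by quantile transforms\<close>

definition quantile :: "real measure \<Rightarrow> real \<Rightarrow> real" where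
  "quantile G u = Inf {y. u \<le> cdf G y}"

text \<open>The open interval keeps the set whose infimum defines \<open>quantile\<close> nonempty
  and bounded below.\<close>

definition unif :: "real measure" where
  "unif = restrict_space lborel {0<..<1}"

definition unif_seq :: "(nat \<Rightarrow> real) measure" where
  "unif_seq = PiM UNIV (\<lambda>_. unif)"

lemma space_unif: "space unif = {0<..<1}"
  by (simp add: unif_def space_restrict_space)

lemma prob_space_unif: "prob_space unif"
  by (auto simp: unif_def emeasure_restrict_space space_restrict_space intro!: prob_spaceI)

interpretation unif: prob_space unif
  by (rule prob_space_unif)

interpretation unif_seq: prob_space unif_seq
  unfolding unif_seq_def by (rule prob_space_PiM) (rule prob_space_unif)

lemma measurable_unif_borel: "(\<lambda>u. u) \<in> borel_measurable unif"
  unfolding unif_def by (rule measurable_restrict_space1) simp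

lemma measurable_unif_seq_component: "(\<lambda>u. u i) \<in> measurable unif_seq unif"
  unfolding unif_seq_def by (rule measurable_component_singleton) simp

lemma distr_unif_seq_component: "distr unif_seq unif (\<lambda>u. u i) = unif"
  unfolding unif_seq_def by (rule distr_PiM_component) (auto intro: prob_space_unif)

lemma indep_unif_seq: "unif_seq.indep_vars (\<lambda>_. unif) (\<lambda>i u. u i) UNIV"
proof (subst unif_seq.indep_vars_iff_distr_eq_PiM')
  have "distr unif_seq (PiM UNIV (\<lambda>_. unif)) (\<lambda>u. \<lambda>i\<in>UNIV. u i) = unif_seq"
    unfolding unif_seq_def by (simp add: restrict_UNIV distr_id2)
  then show "distr unif_seq (PiM UNIV (\<lambda>_. unif)) (\<lambda>u. \<lambda>i\<in>UNIV. u i)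
     = PiM UNIV (\<lambda>i. distr unif_seq unif (\<lambda>u. u i))"
    unfolding distr_unif_seq_component by (simp add: unif_seq_def)
qed (auto intro: measurable_unif_seq_component)

context real_distribution
begin

lemma quantile_le_iff:
  assumes "u \<in> {0<..<1}"
  shows "quantile M u \<le> y \<longleftrightarrow> u \<le> cdf M y"
proof -
  interpret cdf_distribution M by unfold_locales
  show ?thesis using pseudoinverse[of u y] assms by (simp add: quantile_def)
qed

lemma measurable_quantile [measurable]: "quantile M \<in> borel_measurable unif"
proof -
  interpret cdf_distribution M by unfold_locales
  have "quantile M = I" by (simp add: quantile_def[abs_def])
  then show ?thesis
    using measurable_CI by (simp add: unif_def cong: measurable_cong_sets) 
qed

lemma distr_quantile: "distr unif borel (quantile M) = M"
proof -
  interpret cdf_distribution M by unfold_locales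
  have "quantile M = I" by (simp add: quantile_def[abs_def])
  then show ?thesis using distr_I_eq_M by (simp add: unif_def)
qed

lemma tail_eq_cdf: "tail M y = 1 - cdf M y"
  unfolding tail_def cdf_def by (subst prob_compl[symmetric]) (auto intro!: arg_cong[where f=prob])

end

lemma quantile_mono_tail:
  assumes "real_distribution F" "real_distribution G" and le: "\<And>y. tail G y \<le> tail F y"
    and u: "u \<in> {0<..<1}"
  shows "quantile G u \<le> quantile F u"
proof -
  interpret F: real_distribution F by fact
  interpret G: real_distribution G by fact
  have "u \<le> cdf F (quantile F u)" using F.quantile_le_iff[OF u, of "quantile F u"] by simp
  also have "\<dots> \<le> cdf G (quantile F u)"
    using le[of "quantile F u"] by (simp add: F.tail_eq_cdf G.tail_eq_cdf)
  finally show ?thesis using G.quantile_le_iff[OF u] by simp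
qed

section \<open>Steps of the walk driven by independent uniforms\<close>

context modulated_tails
begin

text \<open>For fixed \<open>\<omega>\<close> these are independent with the conditional laws of the
  increments. The uniforms do not involve \<open>\<omega>\<close>, so one sequence
  \<open>quantile F (u i)\<close> bounds the steps in every environment. Index \<open>i\<close>
  belongs to time \<open>Suc i\<close>.\<close>

definition step :: "'w \<Rightarrow> nat \<Rightarrow> (nat \<Rightarrow> real) \<Rightarrow> real" where
  "step \<omega> i u = quantile (Fx (X (Suc i) \<omega>)) (u i)"

lemma Fx_X: "\<omega> \<in> space M \<Longrightarrow> integrable_dist (Fx (X (Suc i) \<omega>))"
  by (intro Fx_dist measurable_space[OF measurable_X])

lemma measurable_measure_Fx:
  assumes "B \<in> sets borel"
  shows "(\<lambda>\<omega>. measure (Fx (X (Suc i) \<omega>)) B) \<in> borel_measurable M"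
  by (rule measurable_compose[OF measurable_compose[OF measurable_X Fx_kernel]
        measurable_measure_subprob_algebra[OF assms]])

text \<open>Joint measurability follows from the Galois connection between quantile and distribution
  function: the sublevel set is \<open>{u \<le> F_x(y)}\<close>, and only measurability in
  \<open>x\<close> for each fixed \<open>y\<close> is given.\<close>

lemma measurable_quantile_Fx: "(\<lambda>p. quantile (Fx (fst p)) (snd p)) \<in> borel_measurable (SX \<Otimes>\<^sub>M unif)"
proof (rule borel_measurableI_le)
  fix y :: real
  have "{p \<in> space (SX \<Otimes>\<^sub>M unif). quantile (Fx (fst p)) (snd p) \<le> y}
    = {p \<in> space (SX \<Otimes>\<^sub>M unif). snd p \<le> measure (Fx (fst p)) {..y}}"
  proof (intro Collect_cong conj_cong refl)
    fix p assume "p \<in> space (SX \<Otimes>\<^sub>M unif)"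
    then have p: "fst p \<in> space SX" "snd p \<in> {0<..<1}" by (auto simp: space_pair_measure space_unif)
    interpret Fx: integrable_dist "Fx (fst p)" using p by (intro Fx_dist)
    show "quantile (Fx (fst p)) (snd p) \<le> y \<longleftrightarrow> snd p \<le> measure (Fx (fst p)) {..y}"
      using Fx.quantile_le_iff[OF p(2)] by (simp add: cdf_def)
  qed
  moreover have [measurable]: "(\<lambda>p. measure (Fx (fst p)) {..y}) \<in> borel_measurable (SX \<Otimes>\<^sub>M unif)"
    by (rule measurable_compose[OF measurable_fst Fx_meas])
  moreover have [measurable]: "(\<lambda>p. snd p :: real) \<in> borel_measurable (SX \<Otimes>\<^sub>M unif)"
    by (rule measurable_compose[OF measurable_snd measurable_unif_borel])
  ultimately show "{p \<in> space (SX \<Otimes>\<^sub>M unif). quantile (Fx (fst p)) (snd p) \<le> y} \<in> sets (SX \<Otimes>\<^sub>M unif)"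
    by simp
qed

lemma measurable_step_pair [measurable]: "(\<lambda>p. step (fst p) i (snd p)) \<in> borel_measurable (M \<Otimes>\<^sub>M unif_seq)"
proof -
  have "(\<lambda>p. (X (Suc i) (fst p), snd p i)) \<in> measurable (M \<Otimes>\<^sub>M unif_seq) (SX \<Otimes>\<^sub>M unif)"
    by (intro measurable_Pair measurable_compose[OF measurable_fst measurable_X]
         measurable_compose[OF measurable_snd measurable_unif_seq_component])
  from measurable_compose[OF this measurable_quantile_Fx] show ?thesis by (simp add: step_def)
qed

lemma measurable_quantile_X:
  assumes "\<omega> \<in> space M"
  shows "quantile (Fx (X (Suc i) \<omega>)) \<in> borel_measurable unif"
proof -
  interpret Fx: integrable_dist "Fx (X (Suc i) \<omega>)" using assms by (rule Fx_X)
  show ?thesis by measurable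
qed

lemma measurable_step [measurable]: "\<omega> \<in> space M \<Longrightarrow> step \<omega> i \<in> borel_measurable unif_seq"
  unfolding step_def
  by (rule measurable_compose[OF measurable_unif_seq_component measurable_quantile_X])

lemma indep_step:
  assumes "\<omega> \<in> space M"
  shows "unif_seq.indep_vars (\<lambda>_. borel) (step \<omega>) UNIV"
  using unif_seq.indep_vars_compose2[OF indep_unif_seq measurable_quantile_X[OF assms]]
  by (simp add: step_def[abs_def])

lemma distr_step:
  assumes "\<omega> \<in> space M"
  shows "distr unif_seq borel (step \<omega> i) = Fx (X (Suc i) \<omega>)"
proof -
  interpret Fx: integrable_dist "Fx (X (Suc i) \<omega>)" using assms by (rule Fx_X)
  have "distr unif_seq borel (step \<omega> i) = distr (distr unif_seq unif (\<lambda>u. u i)) borel (quantile (Fx (X (Suc i) \<omega>)))"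
    using assms by (simp add: distr_distr comp_def step_def[abs_def] measurable_unif_seq_component measurable_quantile_X)
  then show ?thesis by (simp add: distr_unif_seq_component Fx.distr_quantile)
qed

lemma prob_step_greater:
  assumes "\<omega> \<in> space M"
  shows "unif_seq.prob {u \<in> space unif_seq. t < step \<omega> i u} = tail (Fx (X (Suc i) \<omega>)) t"
  unfolding distr_step[OF assms, of i, symmetric] tail_def
  using assms by (subst measure_distr) (auto intro!: arg_cong[where f=unif_seq.prob])

lemma step_le_quantile:
  assumes w: "\<omega> \<in> space M" and u: "u \<in> space unif_seq"
  shows "step \<omega> i u \<le> quantile F (u i)"
  unfolding step_def
proof (rule quantile_mono_tail)
  show "real_distribution F" ..
  show "real_distribution (Fx (X (Suc i) \<omega>))" using Fx_X[OF w] by (simp add: integrable_dist_def)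
  show "u i \<in> {0<..<1}" using measurable_space[OF measurable_unif_seq_component u] by (simp add: space_unif)
qed (intro tail_le measurable_space[OF measurable_X w])

text \<open>The monotone coupling by quantiles turns the ordering of tails into a pointwise bound by
  variables of law \<open>F\<close>.\<close>

lemma dominated_steps_step:
  assumes w: "\<omega> \<in> space M" and \<mu>: "\<And>x. x \<in> space SX \<Longrightarrow> trunc_mean (Fx x) \<beta> \<le> \<mu>"
  shows "dominated_steps F \<beta> \<mu> unif_seq (step \<omega>)"
  unfolding dominated_steps_def
proof (intro conjI unif_seq.prob_space_axioms indep_step[OF w] allI exI[of _ "\<lambda>i u. quantile F (u i)"] ballI)
  fix i
  show m: "(\<lambda>u. quantile F (u i)) \<in> borel_measurable unif_seq"
    by (rule measurable_compose[OF measurable_unif_seq_component H.F.measurable_quantile])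
  have "distr unif_seq borel (\<lambda>u. quantile F (u i)) = distr (distr unif_seq unif (\<lambda>u. u i)) borel (quantile F)"
    by (simp add: distr_distr comp_def measurable_unif_seq_component)
  then show "distr unif_seq borel (\<lambda>u. quantile F (u i)) = F"
    by (simp add: distr_unif_seq_component H.F.distr_quantile)
  show "step \<omega> i u \<le> quantile F (u i)" if "u \<in> space unif_seq" for u
    by (rule step_le_quantile[OF w that])
  have "(\<integral>u. max (step \<omega> i u) (- \<beta>) \<partial>unif_seq) = (\<integral>z. max z (- \<beta>) \<partial>distr unif_seq borel (step \<omega> i))"
    using w by (simp add: integral_distr)
  also have "\<dots> \<le> \<mu>"
    unfolding distr_step[OF w] using \<mu>[OF measurable_space[OF measurable_X w, of i]] by (simp add: trunc_mean_def)
  finally show "(\<integral>u. max (step \<omega> i u) (- \<beta>) \<partial>unif_seq) \<le> \<mu>" .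
qed

end

section \<open>The law of the increments in the product model\<close>

locale modulated_walk = modulated_tails M SX X T H F Fx c
  for M :: "'w measure" and SX :: "'x measure" and X T and H F :: "real measure" and Fx c +
  fixes \<xi> :: "nat \<Rightarrow> 'w \<Rightarrow> real"
  assumes walk: "modulated_increments M SX X Fx \<xi>"
begin

lemma measurable_xi [measurable]: "\<xi> (Suc n) \<in> borel_measurable M"
  using walk by (auto simp: modulated_increments_def)

lemma subalgebra_proc_sigma: "subalgebra M (proc_sigma M SX X)"
proof -
  have "sigma_sets (space M) (\<Union>n\<in>{1..}. {X n -` A \<inter> space M |A. A \<in> sets SX}) \<subseteq> events"
  proof (rule sets.sigma_sets_subset, rule subsetI)
    fix S assume "S \<in> (\<Union>n\<in>{1..}. {X n -` A \<inter> space M |A. A \<in> sets SX})"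
    then obtain n A where "1 \<le> n" "A \<in> sets SX" "S = X n -` A \<inter> space M" by auto
    then show "S \<in> events"
      using measurable_sets[OF measurable_X[of "n - 1"]] by simp
  qed
  moreover have "(\<Union>n\<in>{1..}. {X n -` A \<inter> space M |A. A \<in> sets SX}) \<subseteq> Pow (space M)" by auto
  ultimately show ?thesis
    by (simp add: subalgebra_def proc_sigma_def sets_measure_of space_measure_of_conv)
qed

text \<open>The defining conditional expectation is integrated out, using that conditioning
  preserves the mean.\<close>

lemma prob_xi_rectangle:
  assumes B: "\<And>i. i < N \<Longrightarrow> B i \<in> sets borel"
  shows "prob {\<omega> \<in> space M. \<forall>i<N. \<xi> (Suc i) \<omega> \<in> B i} = expectation (\<lambda>\<omega>. \<Prod>i<N. measure (Fx (X (Suc i) \<omega>)) (B i))"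
proof -
  interpret sub: finite_measure_subalgebra M "proc_sigma M SX X"
    by unfold_locales (rule subalgebra_proc_sigma)
  define I where "I = Suc ` {..<N}"
  define B' where "B' = (\<lambda>n. B (n - 1))"
  have I: "finite I" "I \<subseteq> {1..}" "\<forall>n\<in>I. B' n \<in> sets borel" by (auto simp: I_def B'_def B)
  have prod: "(\<Prod>n\<in>I. g n) = (\<Prod>i<N. g (Suc i))" for g :: "nat \<Rightarrow> real"
    unfolding I_def by (subst prod.reindex) auto
  have "AE \<omega> in M. real_cond_exp M (proc_sigma M SX X) (\<lambda>\<omega>'. \<Prod>n\<in>I. indicator (B' n) (\<xi> n \<omega>')) \<omega>
      = (\<Prod>n\<in>I. measure (Fx (X n \<omega>)) (B' n))"
    using walk I unfolding modulated_increments_def by blast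
  then have ae: "AE \<omega> in M. real_cond_exp M (proc_sigma M SX X) (\<lambda>\<omega>'. \<Prod>i<N. indicator (B i) (\<xi> (Suc i) \<omega>')) \<omega>
      = (\<Prod>i<N. measure (Fx (X (Suc i) \<omega>)) (B i))"
    by (simp add: prod B'_def)
  have Bm: "(\<lambda>\<omega>. indicator (B i) (\<xi> (Suc i) \<omega>) :: real) \<in> borel_measurable M" if "i < N" for i
    using B[OF that] by measurable
  have ind: "(\<Prod>i<N. indicator (B i) (\<xi> (Suc i) \<omega>)) = (indicator {\<omega> \<in> space M. \<forall>i<N. \<xi> (Suc i) \<omega> \<in> B i} \<omega> :: real)"
    if "\<omega> \<in> space M" for \<omega>
  proof (cases "\<forall>i<N. \<xi> (Suc i) \<omega> \<in> B i")
    case False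
    then obtain i where "i < N" "\<xi> (Suc i) \<omega> \<notin> B i" by auto
    then have "(\<Prod>i<N. indicator (B i) (\<xi> (Suc i) \<omega>) :: real) = 0"
      by (intro prod_zero) (auto intro!: bexI[of _ i])
    then show ?thesis using False by simp
  qed (use that in simp)
  have int: "integrable M (\<lambda>\<omega>. \<Prod>i<N. indicator (B i) (\<xi> (Suc i) \<omega>) :: real)"
  proof (rule integrable_const_bound[of _ 1])
    show "AE \<omega> in M. norm (\<Prod>i<N. indicator (B i) (\<xi> (Suc i) \<omega>) :: real) \<le> 1"
      by (rule AE_I2) (simp add: ind split: split_indicator)
  qed (use Bm in measurable)
  define E where "E = {\<omega> \<in> space M. \<forall>i<N. \<xi> (Suc i) \<omega> \<in> B i}"
  have "E \<inter> space M = E" unfolding E_def by blast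
  then have "expectation (indicator E) = prob E" by (metis Bochner_Integration.integral_indicator)
  then have "prob E = expectation (indicator E)" by (rule sym)
  also have "\<dots> = expectation (\<lambda>\<omega>. \<Prod>i<N. indicator (B i) (\<xi> (Suc i) \<omega>))"
    unfolding E_def by (rule Bochner_Integration.integral_cong) (simp_all only: ind)
  also have "\<dots> = expectation (real_cond_exp M (proc_sigma M SX X) (\<lambda>\<omega>'. \<Prod>i<N. indicator (B i) (\<xi> (Suc i) \<omega>')))"
    by (rule sub.real_cond_exp_int(2)[symmetric, OF int])
  also have "\<dots> = expectation (\<lambda>\<omega>. \<Prod>i<N. measure (Fx (X (Suc i) \<omega>)) (B i))"
  proof (rule integral_cong_AE[OF _ _ ae])
    have "(\<lambda>\<omega>. measure (Fx (X (Suc i) \<omega>)) (B i)) \<in> borel_measurable M" if "i < N" for i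
      by (rule measurable_measure_Fx[OF B[OF that]])
    then show "(\<lambda>\<omega>. \<Prod>i<N. measure (Fx (X (Suc i) \<omega>)) (B i)) \<in> borel_measurable M" by measurable
  qed measurable
  finally show ?thesis unfolding E_def .
qed

lemma prob_step_rectangle:
  assumes w: "\<omega> \<in> space M" and B: "\<And>i. i < N \<Longrightarrow> B i \<in> sets borel"
  shows "unif_seq.prob {u \<in> space unif_seq. \<forall>i<N. step \<omega> i u \<in> B i} = (\<Prod>i<N. measure (Fx (X (Suc i) \<omega>)) (B i))"
proof (cases "N = 0")
  case True
  then show ?thesis by (simp add: unif_seq.prob_space)
next
  case False
  have "unif_seq.prob (\<Inter>i\<in>{..<N}. step \<omega> i -` B i \<inter> space unif_seq) = (\<Prod>i<N. unif_seq.prob (step \<omega> i -` B i \<inter> space unif_seq))"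
    using False B by (intro unif_seq.indep_varsD[OF indep_step[OF w]]) auto
  also have "(\<Inter>i\<in>{..<N}. step \<omega> i -` B i \<inter> space unif_seq) = {u \<in> space unif_seq. \<forall>i<N. step \<omega> i u \<in> B i}"
    using False by auto
  also have "(\<Prod>i<N. unif_seq.prob (step \<omega> i -` B i \<inter> space unif_seq)) = (\<Prod>i<N. measure (Fx (X (Suc i) \<omega>)) (B i))"
  proof (rule prod.cong)
    fix i assume "i \<in> {..<N}"
    then show "unif_seq.prob (step \<omega> i -` B i \<inter> space unif_seq) = measure (Fx (X (Suc i) \<omega>)) (B i)"
      unfolding distr_step[OF w, of i, symmetric] using w B by (subst measure_distr) auto
  qed simp
  finally show ?thesis .
qed

text \<open>The epochs \<open>T\<close> need not be functions of \<open>X\<close>, so they may depend on the increments \<open>\<xi>\<close> even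
  conditionally on \<open>X\<close>.  On the product space with the quantile steps they do not, and only the
  law of \<open>\<xi>\<close> matters for the maximum.\<close>

lemma distr_xi_eq:
  "distr M (PiM {..<N} (\<lambda>_. borel)) (\<lambda>\<omega>. \<lambda>i\<in>{..<N}. \<xi> (Suc i) \<omega>)
   = distr (M \<Otimes>\<^sub>M unif_seq) (PiM {..<N} (\<lambda>_. borel)) (\<lambda>p. \<lambda>i\<in>{..<N}. step (fst p) i (snd p))" (is "?P = ?Q")
proof (rule measure_eqI_PiM_finite)
  have Pm: "(\<lambda>\<omega>. \<lambda>i\<in>{..<N}. \<xi> (Suc i) \<omega>) \<in> measurable M (PiM {..<N} (\<lambda>_. borel))" by measurable
  have Qm: "(\<lambda>p. \<lambda>i\<in>{..<N}. step (fst p) i (snd p)) \<in> measurable (M \<Otimes>\<^sub>M unif_seq) (PiM {..<N} (\<lambda>_. borel))"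
    by measurable
  fix A :: "nat \<Rightarrow> real set" assume A: "\<And>i. i \<in> {..<N} \<Longrightarrow> A i \<in> sets borel"
  then have AS: "Pi\<^sub>E {..<N} A \<in> sets (PiM {..<N} (\<lambda>_. borel))" by (intro sets_PiM_I_finite) auto
  have Q_pre: "(\<lambda>p. \<lambda>i\<in>{..<N}. step (fst p) i (snd p)) -` (Pi\<^sub>E {..<N} A) \<inter> space (M \<Otimes>\<^sub>M unif_seq)
       = {p \<in> space (M \<Otimes>\<^sub>M unif_seq). \<forall>i<N. step (fst p) i (snd p) \<in> A i}"
    by (simp only: set_eq_iff vimage_eq Int_iff mem_Collect_eq restrict_PiE_iff lessThan_iff Ball_def conj_commute simp_thms)
  have "emeasure ?P (Pi\<^sub>E {..<N} A) = emeasure M {\<omega> \<in> space M. \<forall>i<N. \<xi> (Suc i) \<omega> \<in> A i}"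
    unfolding emeasure_distr[OF Pm AS]
    by (rule arg_cong[where f="emeasure M"]) (simp only: set_eq_iff vimage_eq Int_iff mem_Collect_eq restrict_PiE_iff lessThan_iff Ball_def conj_commute simp_thms)
  also have "\<dots> = ennreal (expectation (\<lambda>\<omega>. \<Prod>i<N. measure (Fx (X (Suc i) \<omega>)) (A i)))"
    using A by (simp add: emeasure_eq_measure prob_xi_rectangle)
  also have "\<dots> = (\<integral>\<^sup>+\<omega>. ennreal (\<Prod>i<N. measure (Fx (X (Suc i) \<omega>)) (A i)) \<partial>M)"
  proof (rule nn_integral_eq_integral[symmetric])
    have m: "(\<lambda>\<omega>. measure (Fx (X (Suc i) \<omega>)) (A i)) \<in> borel_measurable M" if "i < N" for i
      by (rule measurable_measure_Fx) (use A that in simp)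
    show "integrable M (\<lambda>\<omega>. \<Prod>i<N. measure (Fx (X (Suc i) \<omega>)) (A i))"
    proof (rule integrable_const_bound[of _ 1])
      show "AE \<omega> in M. norm (\<Prod>i<N. measure (Fx (X (Suc i) \<omega>)) (A i)) \<le> 1"
      proof (rule AE_I2)
        fix \<omega> assume "\<omega> \<in> space M"
        then have "measure (Fx (X (Suc i) \<omega>)) (A i) \<le> 1" for i
          using Fx_X[of \<omega> i] by (auto simp: integrable_dist_def real_distribution_def intro: prob_space.prob_le_1)
        then show "norm (\<Prod>i<N. measure (Fx (X (Suc i) \<omega>)) (A i)) \<le> 1"
          by (auto simp: abs_prod intro!: prod_le_1)
      qed
    qed (use m in measurable)
  qed (auto intro!: prod_nonneg)
  also have "\<dots> = (\<integral>\<^sup>+\<omega>. emeasure unif_seq {u \<in> space unif_seq. \<forall>i<N. step \<omega> i u \<in> A i} \<partial>M)"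
    using A by (intro nn_integral_cong) (simp add: unif_seq.emeasure_eq_measure prob_step_rectangle)
  also have "\<dots> = (\<integral>\<^sup>+\<omega>. emeasure unif_seq (Pair \<omega> -` {p \<in> space (M \<Otimes>\<^sub>M unif_seq). \<forall>i<N. step (fst p) i (snd p) \<in> A i}) \<partial>M)"
    by (intro nn_integral_cong arg_cong[where f="emeasure unif_seq"]) (auto simp: space_pair_measure)
  also have "\<dots> = emeasure (M \<Otimes>\<^sub>M unif_seq) {p \<in> space (M \<Otimes>\<^sub>M unif_seq). \<forall>i<N. step (fst p) i (snd p) \<in> A i}"
  proof (rule unif_seq.emeasure_pair_measure_alt[symmetric])
    show "{p \<in> space (M \<Otimes>\<^sub>M unif_seq). \<forall>i<N. step (fst p) i (snd p) \<in> A i} \<in> sets (M \<Otimes>\<^sub>M unif_seq)"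
      using measurable_sets[OF Qm AS] unfolding Q_pre .
  qed
  also have "\<dots> = emeasure ?Q (Pi\<^sub>E {..<N} A)"
    unfolding emeasure_distr[OF Qm AS] Q_pre ..
  finally show "emeasure ?P (Pi\<^sub>E {..<N} A) = emeasure ?Q (Pi\<^sub>E {..<N} A)" .
next
  interpret P: prob_space ?P by (rule prob_space_distr) measurable
  show "range (\<lambda>_::nat. space (PiM {..<N} (\<lambda>_. borel :: real measure))) \<subseteq> prod_algebra {..<N} (\<lambda>_. borel)"
    by (auto simp: space_PiM intro!: prod_algebraI_finite) 
  show "(\<Union>i::nat. space (PiM {..<N} (\<lambda>_. borel :: real measure))) = space (PiM {..<N} (\<lambda>_. borel))" by simp
  show "emeasure ?P (space (PiM {..<N} (\<lambda>_. borel))) \<noteq> \<infinity>" for i :: nat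
    by (simp add: P.emeasure_eq_measure)
qed auto

text \<open>The event depends on the first \<open>N\<close> increments only, so the equality of
  their laws suffices; Fubini then displays it as an average over frozen environments.\<close>

lemma emeasure_max_transfer:
  "emeasure M {\<omega> \<in> space M. \<exists>n\<le>N. y < (\<Sum>i<n. \<xi> (Suc i) \<omega>)}
   = (\<integral>\<^sup>+\<omega>. emeasure unif_seq {u \<in> space unif_seq. \<exists>n\<le>N. y < (\<Sum>i<n. step \<omega> i u)} \<partial>M)"
proof -
  define E where "E = {x \<in> space (PiM {..<N} (\<lambda>_. borel)). \<exists>n\<le>N. y < (\<Sum>i<n. x i :: real)}"
  have E: "E \<in> sets (PiM {..<N} (\<lambda>_. borel))" 
    unfolding E_def using measurable_component_borel[measurable] by measurable
  have res: "(\<Sum>i<n. (\<lambda>i\<in>{..<N}. g i) i) = (\<Sum>i<n. g i)" if "n \<le> N" for n and g :: "nat \<Rightarrow> real"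
    using that by (intro sum.cong) auto
  have E_iff: "(\<lambda>i\<in>{..<N}. g i) \<in> E \<longleftrightarrow> (\<exists>n\<le>N. y < (\<Sum>i<n. g i))" for g :: "nat \<Rightarrow> real"
  proof -
    have "(\<lambda>i\<in>{..<N}. g i) \<in> space (PiM {..<N} (\<lambda>_. borel :: real measure))" by (simp add: space_PiM)
    moreover have "(\<exists>n\<le>N. y < (\<Sum>i<n. (\<lambda>i\<in>{..<N}. g i) i)) \<longleftrightarrow> (\<exists>n\<le>N. y < (\<Sum>i<n. g i))"
      using res[of _ g] by metis
    ultimately show ?thesis unfolding E_def by blast
  qed
  have "emeasure M {\<omega> \<in> space M. \<exists>n\<le>N. y < (\<Sum>i<n. \<xi> (Suc i) \<omega>)}
    = emeasure (distr M (PiM {..<N} (\<lambda>_. borel)) (\<lambda>\<omega>. \<lambda>i\<in>{..<N}. \<xi> (Suc i) \<omega>)) E"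
    using E by (subst emeasure_distr) (auto simp: E_iff simp del: restrict_apply intro!: arg_cong[where f="emeasure M"])
  also have "\<dots> = emeasure (M \<Otimes>\<^sub>M unif_seq) {p \<in> space (M \<Otimes>\<^sub>M unif_seq). \<exists>n\<le>N. y < (\<Sum>i<n. step (fst p) i (snd p))}"
    unfolding distr_xi_eq using E
    by (subst emeasure_distr) (auto simp: E_iff simp del: restrict_apply intro!: arg_cong[where f="emeasure (M \<Otimes>\<^sub>M unif_seq)"])
  also have "\<dots> = (\<integral>\<^sup>+\<omega>. emeasure unif_seq (Pair \<omega> -` {p \<in> space (M \<Otimes>\<^sub>M unif_seq). \<exists>n\<le>N. y < (\<Sum>i<n. step (fst p) i (snd p))}) \<partial>M)"
    by (rule unif_seq.emeasure_pair_measure_alt) measurable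
  also have "\<dots> = (\<integral>\<^sup>+\<omega>. emeasure unif_seq {u \<in> space unif_seq. \<exists>n\<le>N. y < (\<Sum>i<n. step \<omega> i u)} \<partial>M)"
    by (intro nn_integral_cong arg_cong[where f="emeasure unif_seq"]) (auto simp: space_pair_measure)
  finally show ?thesis .
qed

end

section \<open>Crossing of lines by the modulated walk\<close>

context modulated_tails
begin

lemma trunc_mean_bounds:
  assumes x: "x \<in> space SX" and "0 \<le> \<beta>"
  shows "- \<beta> \<le> trunc_mean (Fx x) \<beta>" "trunc_mean (Fx x) \<beta> \<le> stop_loss F 0"
    and "(\<integral>y. y \<partial>Fx x) \<le> trunc_mean (Fx x) \<beta>"
proof -
  interpret Fx: integrable_dist "Fx x" using x by (rule Fx_dist)
  have "(\<integral>y. - \<beta> \<partial>Fx x) \<le> trunc_mean (Fx x) \<beta>"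
    unfolding trunc_mean_def by (intro integral_mono Fx.integrable_max_const) auto
  then show "- \<beta> \<le> trunc_mean (Fx x) \<beta>" by (simp add: Fx.prob_space[simplified])
  have "trunc_mean (Fx x) \<beta> \<le> stop_loss (Fx x) 0"
    unfolding trunc_mean_def stop_loss_def using \<open>0 \<le> \<beta>\<close>
    by (intro integral_mono Fx.integrable_max_const Fx.integrable_excess) auto
  also have "\<dots> \<le> stop_loss F 0" by (rule stop_loss_Fx_bounds[OF x])
  finally show "trunc_mean (Fx x) \<beta> \<le> stop_loss F 0" .
  show "(\<integral>y. y \<partial>Fx x) \<le> trunc_mean (Fx x) \<beta>"
    unfolding trunc_mean_def by (intro integral_mono Fx.integrable_max_const Fx.integrable_id) auto
qed

lemma trunc_mean_antimono:
  assumes "x \<in> space SX" "\<beta> \<le> \<beta>'"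
  shows "trunc_mean (Fx x) \<beta>' \<le> trunc_mean (Fx x) \<beta>"
proof -
  interpret Fx: integrable_dist "Fx x" using assms by (intro Fx_dist)
  show ?thesis
    unfolding trunc_mean_def using assms by (intro integral_mono Fx.integrable_max_const) auto
qed

text \<open>The supremum decreases in \<open>\<beta>\<close>, so the limit defining
  \<open>kappa\<close> exists and is an infimum. A negative infimum gives one \<open>\<beta>\<close>
  with negative supremum, and \<open>\<mu>\<close> is placed strictly between it and 0.\<close>

lemma kappa_neg_imp_uniform:
  assumes "kappa SX Fx < 0"
  obtains \<beta> \<mu> where "\<mu> < 0" "\<And>x. x \<in> space SX \<Longrightarrow> trunc_mean (Fx x) \<beta> \<le> \<mu>"
proof -
  define f where "f = (\<lambda>\<beta>::real. SUP x\<in>space SX. ereal (trunc_mean (Fx x) \<beta>))"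
  have anti: "f \<beta>' \<le> f \<beta>" if "\<beta> \<le> \<beta>'" for \<beta> \<beta>'
    unfolding f_def using trunc_mean_antimono[OF _ that] by (intro SUP_mono) auto
  have "(f \<longlongrightarrow> (INF \<beta>. f \<beta>)) at_top"
  proof (rule order_tendstoI)
    fix a assume "a < (INF \<beta>. f \<beta>)"
    then show "eventually (\<lambda>\<beta>. a < f \<beta>) at_top"
      by (intro always_eventually allI) (auto intro: less_le_trans INF_lower)
  next
    fix a assume "(INF \<beta>. f \<beta>) < a"
    then obtain \<beta> where "f \<beta> < a" by (auto simp: INF_less_iff)
    then show "eventually (\<lambda>\<beta>. f \<beta> < a) at_top"
      by (intro eventually_mono[OF eventually_ge_at_top[of \<beta>]]) (rule le_less_trans[OF anti])
  qed
  then have "kappa SX Fx = (INF \<beta>. f \<beta>)"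
    unfolding kappa_def f_def by (intro tendsto_Lim) auto
  with assms obtain \<beta> where "f \<beta> < 0" by (auto simp: INF_less_iff)
  then obtain \<mu> where \<mu>: "f \<beta> < ereal \<mu>" "ereal \<mu> < 0" using ereal_dense2 by blast
  show thesis
  proof (rule that)
    show "\<mu> < 0" using \<mu> by simp
    fix x assume "x \<in> space SX"
    then have "ereal (trunc_mean (Fx x) \<beta>) \<le> f \<beta>" unfolding f_def by (rule SUP_upper)
    from le_less_trans[OF this \<mu>(1)] have "ereal (trunc_mean (Fx x) \<beta>) < ereal \<mu>" .
    then show "trunc_mean (Fx x) \<beta> \<le> \<mu>" by simp
  qed
qed

lemma measurable_trunc_mean [measurable]: "(\<lambda>x. trunc_mean (Fx x) \<beta>) \<in> borel_measurable SX"
  unfolding trunc_mean_def by (rule measurable_compose[OF Fx_kernel]) measurable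

text \<open>Dominated convergence: from below the truncated mean is bounded by the mean, integrable
  by assumption, and from above by the stop-loss of \<open>F\<close> at 0.\<close>

lemma trunc_mean_lim:
  assumes int: "integrable \<pi> (\<lambda>x. \<integral>y. y \<partial>Fx x)"
  shows "((\<lambda>\<beta>. \<integral>x. trunc_mean (Fx x) \<beta> \<partial>\<pi>) \<longlongrightarrow> (\<integral>x. (\<integral>y. y \<partial>Fx x) \<partial>\<pi>)) at_top"
proof -
  interpret pi: prob_space \<pi> by (rule prob_space_stationary_measure)
  note sets_stationary_measure [measurable_cong]
  show ?thesis
  proof (rule integral_dominated_convergence_at_top[where w="\<lambda>x. \<bar>\<integral>y. y \<partial>Fx x\<bar> + stop_loss F 0"])
    show "\<forall>\<^sub>F \<beta> in at_top. AE x in \<pi>. norm (trunc_mean (Fx x) \<beta>) \<le> \<bar>\<integral>y. y \<partial>Fx x\<bar> + stop_loss F 0"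
    proof (rule eventually_mono[OF eventually_ge_at_top[of 0]])
      fix \<beta> :: real assume b: "0 \<le> \<beta>"
      show "AE x in \<pi>. norm (trunc_mean (Fx x) \<beta>) \<le> \<bar>\<integral>y. y \<partial>Fx x\<bar> + stop_loss F 0"
      proof (rule AE_I2)
        fix x assume "x \<in> space \<pi>"
        then have x: "x \<in> space SX" by (simp add: space_stationary_measure)
        show "norm (trunc_mean (Fx x) \<beta>) \<le> \<bar>\<integral>y. y \<partial>Fx x\<bar> + stop_loss F 0"
          using trunc_mean_bounds[OF x b] H.F.stop_loss_nonneg[of 0] unfolding real_norm_def by linarith
      qed
    qed
    show "AE x in \<pi>. ((\<lambda>\<beta>. trunc_mean (Fx x) \<beta>) \<longlongrightarrow> (\<integral>y. y \<partial>Fx x)) at_top"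
    proof (rule AE_I2)
      fix x assume "x \<in> space \<pi>"
      then interpret Fx: integrable_dist "Fx x" by (intro Fx_dist) (simp add: space_stationary_measure)
      show "((\<lambda>\<beta>. trunc_mean (Fx x) \<beta>) \<longlongrightarrow> (\<integral>y. y \<partial>Fx x)) at_top"
        unfolding trunc_mean_def by (rule Fx.tendsto_expectation_max[OF Fx.integrable_id])
    qed
  qed (use int in auto)
qed

lemma measurable_prob_step:
  assumes "{p \<in> space (M \<Otimes>\<^sub>M unif_seq). Q (fst p) (snd p)} \<in> sets (M \<Otimes>\<^sub>M unif_seq)"
  shows "(\<lambda>\<omega>. emeasure unif_seq {u \<in> space unif_seq. Q \<omega> u}) \<in> borel_measurable M"
proof -
  have "(\<lambda>\<omega>. emeasure unif_seq (Pair \<omega> -` {p \<in> space (M \<Otimes>\<^sub>M unif_seq). Q (fst p) (snd p)})) \<in> borel_measurable M"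
    by (rule unif_seq.measurable_emeasure_Pair[OF assms])
  moreover have "emeasure unif_seq {u \<in> space unif_seq. Q \<omega> u}
     = emeasure unif_seq (Pair \<omega> -` {p \<in> space (M \<Otimes>\<^sub>M unif_seq). Q (fst p) (snd p)})" if "\<omega> \<in> space M" for \<omega>
    using that by (intro arg_cong[where f="emeasure unif_seq"]) (auto simp: space_pair_measure)
  ultimately show ?thesis by (subst measurable_cong) auto
qed

lemma integral_step:
  assumes w: "\<omega> \<in> space M" and [measurable]: "h \<in> borel_measurable borel"
  shows "(\<integral>u. h (step \<omega> i u) \<partial>unif_seq) = (\<integral>z. h z \<partial>Fx (X (Suc i) \<omega>) :: real)"
  unfolding distr_step[OF w, of i, symmetric] using w by (simp add: integral_distr)

lemma integrable_step:
  assumes w: "\<omega> \<in> space M" and [measurable]: "h \<in> borel_measurable borel"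
  shows "integrable unif_seq (\<lambda>u. h (step \<omega> i u)) \<longleftrightarrow> integrable (Fx (X (Suc i) \<omega>)) (h :: real \<Rightarrow> real)"
  unfolding distr_step[OF w, of i, symmetric] using w by (simp add: integrable_distr_eq)

lemma nn_integral_le_const_plus:
  assumes le: "\<And>\<omega>. \<omega> \<in> space M \<Longrightarrow> \<omega> \<notin> B \<Longrightarrow> f \<omega> \<le> ennreal e1" and f1: "\<And>\<omega>. f \<omega> \<le> 1"
    and [measurable]: "B \<in> events" and B: "prob B \<le> e2" and "0 \<le> e1" "0 \<le> e2"
  shows "(\<integral>\<^sup>+\<omega>. f \<omega> \<partial>M) \<le> ennreal (e1 + e2)"
proof -
  have "(\<integral>\<^sup>+\<omega>. f \<omega> \<partial>M) \<le> (\<integral>\<^sup>+\<omega>. ennreal e1 + indicator B \<omega> \<partial>M)"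
    using le f1 by (intro nn_integral_mono) (auto split: split_indicator intro: add_increasing)
  also have "\<dots> = ennreal e1 + ennreal (prob B)"
    by (simp add: nn_integral_add emeasure_eq_measure prob_space)
  also have "\<dots> \<le> ennreal e1 + ennreal e2" by (intro add_left_mono ennreal_leI B)
  finally show ?thesis using assms by simp
qed

text \<open>The walk is split into the conditional truncated means, a bounded functional of the
  environment handled by \<open>environment_crossing\<close>, and the steps centred by them, for
  which \<open>crossing_bound\<close> is uniform over the environments.\<close>

lemma walk_rarely_above_line:
  assumes int: "integrable \<pi> (\<lambda>x. \<integral>y. y \<partial>Fx x)"
    and a: "a < - (\<integral>x. (\<integral>y. y \<partial>Fx x) \<partial>\<pi>)" and e: "0 < e"
  obtains K where "0 < K"
    and "\<And>N. (\<integral>\<^sup>+\<omega>. emeasure unif_seq {u \<in> space unif_seq. \<exists>n\<le>N. K - real n * a < (\<Sum>i<n. step \<omega> i u)} \<partial>M) \<le> ennreal e"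
proof -
  interpret pi: prob_space \<pi> by (rule prob_space_stationary_measure)
  note sets_stationary_measure [measurable_cong]
  \<comment> \<open>Half of the gap between \<open>a\<close> and the stationary drift: one
    \<open>\<epsilon>\<close> is the slope granted to the centred steps, the other covers the
    truncation and keeps the mean of \<open>f\<close> negative.\<close>
  define \<epsilon> where "\<epsilon> = (- (\<integral>x. (\<integral>y. y \<partial>Fx x) \<partial>\<pi>) - a) / 2"
  have eps: "0 < \<epsilon>" using a by (simp add: \<epsilon>_def)
  have "eventually (\<lambda>\<beta>. (\<integral>x. trunc_mean (Fx x) \<beta> \<partial>\<pi>) < - a - \<epsilon>) at_top"
    using a by (intro order_tendstoD(2)[OF trunc_mean_lim[OF int]]) (simp add: \<epsilon>_def field_simps)
  then have "eventually (\<lambda>\<beta>. (\<integral>x. trunc_mean (Fx x) \<beta> \<partial>\<pi>) < - a - \<epsilon> \<and> 0 \<le> \<beta>) at_top"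
    using eventually_ge_at_top[of 0] by eventually_elim auto
  then obtain \<beta> where \<beta>: "(\<integral>x. trunc_mean (Fx x) \<beta> \<partial>\<pi>) < - a - \<epsilon>" "0 \<le> \<beta>"
    using eventually_happens'[OF trivial_limit_at_top_linorder] by blast
  define B where "B = stop_loss F 0"
  have B: "0 \<le> B" unfolding B_def by (rule H.F.stop_loss_nonneg)
  have tm: "- \<beta> \<le> trunc_mean (Fx x) \<beta>" "trunc_mean (Fx x) \<beta> \<le> B" if "x \<in> space SX" for x
    using trunc_mean_bounds[OF that \<beta>(2)] by (auto simp: B_def)
  define f where "f = (\<lambda>x. trunc_mean (Fx x) \<beta> + a + \<epsilon>)"
  have f_bnd: "\<bar>f x\<bar> \<le> \<beta> + B + \<bar>a\<bar> + \<epsilon>" if "x \<in> space SX" for x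
    using tm[OF that] B \<beta>(2) eps unfolding f_def by linarith
  have tm_int: "integrable \<pi> (\<lambda>x. trunc_mean (Fx x) \<beta>)"
    by (rule pi.integrable_const_bound[of _ "\<beta> + B"])
       (use tm B \<beta>(2) in \<open>force intro!: AE_I2 simp: space_stationary_measure abs_le_iff\<close>)+
  have f_neg: "(\<integral>x. f x \<partial>\<pi>) < 0"
    unfolding f_def using tm_int \<beta>(1) by (simp add: pi.prob_space)
  have f_meas: "f \<in> borel_measurable SX" unfolding f_def by measurable
  have "eventually (\<lambda>K. (\<forall>N. prob {\<omega> \<in> space M. \<exists>n\<le>N. K < (\<Sum>i<n. f (X (Suc i) \<omega>))} \<le> e / 2) \<and> 0 < K) at_top"
    using environment_crossing[OF f_meas f_bnd f_neg, of "e / 2"] e eventually_gt_at_top[of 0]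
    by (intro eventually_conj) auto
  from eventually_happens'[OF trivial_limit_at_top_linorder this]
  obtain K2 where K2': "(\<forall>N. prob {\<omega> \<in> space M. \<exists>n\<le>N. K2 < (\<Sum>i<n. f (X (Suc i) \<omega>))} \<le> e / 2) \<and> 0 < K2" ..
  note K2 = K2'[THEN conjunct1, THEN spec] K2'[THEN conjunct2]
  \<comment> \<open>Centring subtracts a mean that is at least \<open>- \<beta>\<close>, so it
    raises a step by at most \<open>\<beta>\<close>.\<close>
  define F' where "F' = distr F borel (\<lambda>z. z + \<beta>)"
  have F': "integrable_dist F'" unfolding F'_def by (rule H.F.integrable_dist_shift)
  obtain K1 where K1: "0 < K1"
    and cross: "\<And>(P :: (nat \<Rightarrow> real) measure) \<xi> K N. dominated_steps F' (\<beta> + B) 0 P \<xi> \<Longrightarrow> K1 \<le> K \<Longrightarrow>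
      measure P {\<omega> \<in> space P. \<exists>n\<le>N. K + real n * (0 + \<epsilon>) < (\<Sum>i<n. \<xi> i \<omega>)} \<le> e / 2"
    by (rule crossing_bound[OF F' eps, where e="e/2" and \<mu>=0 and \<beta>="\<beta> + B"]) (use e in auto)
  show thesis
  proof (rule that[of "K1 + K2"])
    show "0 < K1 + K2" using K1 K2 by simp
    fix N
    define bad where "bad = {\<omega> \<in> space M. \<exists>n\<le>N. K2 < (\<Sum>i<n. f (X (Suc i) \<omega>))}"
    have bad_meas: "bad \<in> events" unfolding bad_def using f_meas by measurable
    have "(\<integral>\<^sup>+\<omega>. emeasure unif_seq {u \<in> space unif_seq. \<exists>n\<le>N. K1 + K2 - real n * a < (\<Sum>i<n. step \<omega> i u)} \<partial>M)
       \<le> ennreal (e / 2 + e / 2)"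
    proof (rule nn_integral_le_const_plus[OF _ _ bad_meas])
      show "prob bad \<le> e / 2" unfolding bad_def by (rule K2)
      fix \<omega> assume w: "\<omega> \<in> space M" and good: "\<omega> \<notin> bad"
      define m where "m = (\<lambda>i. trunc_mean (Fx (X (Suc i) \<omega>)) \<beta>)"
      have m: "- \<beta> \<le> m i" "m i \<le> B" for i
        unfolding m_def using tm measurable_space[OF measurable_X w] by auto
      define \<zeta> where "\<zeta> = (\<lambda>i u. step \<omega> i u - m i)"
      have [measurable]: "step \<omega> i \<in> borel_measurable unif_seq" for i using w by measurable
      have ds: "dominated_steps F' (\<beta> + B) 0 unif_seq \<zeta>"
        unfolding dominated_steps_def
      proof (intro conjI unif_seq.prob_space_axioms allI exI[of _ "\<lambda>i u. quantile F (u i) + \<beta>"] ballI)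
        show "unif_seq.indep_vars (\<lambda>_. borel) \<zeta> UNIV"
          unfolding \<zeta>_def by (rule unif_seq.indep_vars_compose2[OF indep_step[OF w]]) auto
        fix i
        have q: "(\<lambda>u. quantile F (u i)) \<in> borel_measurable unif_seq"
          by (rule measurable_compose[OF measurable_unif_seq_component H.F.measurable_quantile])
        then show "(\<lambda>u. quantile F (u i) + \<beta>) \<in> borel_measurable unif_seq" by measurable
        have "distr unif_seq borel (\<lambda>u. quantile F (u i) + \<beta>)
            = distr (distr (distr unif_seq unif (\<lambda>u. u i)) borel (quantile F)) borel (\<lambda>z. z + \<beta>)"
          using q by (simp add: distr_distr comp_def measurable_unif_seq_component)
        then show "distr unif_seq borel (\<lambda>u. quantile F (u i) + \<beta>) = F'"
          by (simp add: distr_unif_seq_component H.F.distr_quantile F'_def)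
        show "\<zeta> i u \<le> quantile F (u i) + \<beta>" if "u \<in> space unif_seq" for u
        proof -
          have "step \<omega> i u \<le> quantile F (u i)" by (rule step_le_quantile[OF w that])
          with m[of i] show ?thesis by (simp add: \<zeta>_def)
        qed
        interpret Fx: integrable_dist "Fx (X (Suc i) \<omega>)" using w by (rule Fx_X)
        have i1: "integrable unif_seq (\<lambda>u. max (step \<omega> i u) (- \<beta>))"
          using Fx.integrable_max_const by (subst integrable_step[OF w, of "\<lambda>z. max z (- \<beta>)"]) simp_all
        \<comment> \<open>As \<open>m i \<le> B\<close>, truncating the centred step at
          \<open>- (\<beta> + B)\<close> is below centring the step truncated at
          \<open>- \<beta>\<close>, which has mean 0.\<close>
        have "(\<integral>u. max (\<zeta> i u) (- (\<beta> + B)) \<partial>unif_seq) \<le> (\<integral>u. max (step \<omega> i u) (- \<beta>) - m i \<partial>unif_seq)"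
        proof (rule integral_mono)
          show "integrable unif_seq (\<lambda>u. max (step \<omega> i u) (- \<beta>) - m i)" using i1 by simp
          have "integrable (Fx (X (Suc i) \<omega>)) (\<lambda>z. max (z - m i) (- (\<beta> + B)))"
            by (intro integrable_max Bochner_Integration.integrable_diff Fx.integrable_id Fx.integrable_const)
          then have "integrable unif_seq (\<lambda>u. max (step \<omega> i u - m i) (- (\<beta> + B)))"
            by (subst integrable_step[OF w, of "\<lambda>z. max (z - m i) (- (\<beta> + B))"]) simp_all
          then show "integrable unif_seq (\<lambda>u. max (\<zeta> i u) (- (\<beta> + B)))" by (simp add: \<zeta>_def)
          show "max (\<zeta> i u) (- (\<beta> + B)) \<le> max (step \<omega> i u) (- \<beta>) - m i" for u
            using m[of i] by (auto simp: \<zeta>_def)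
        qed
        also have "\<dots> = 0"
          using i1 integral_step[OF w, of "\<lambda>z. max z (- \<beta>)" i]
          by (simp add: unif_seq.prob_space m_def trunc_mean_def)
        finally show "(\<integral>u. max (\<zeta> i u) (- (\<beta> + B)) \<partial>unif_seq) \<le> 0" .
      qed
      have "unif_seq.prob {u \<in> space unif_seq. \<exists>n\<le>N. K1 + K2 - real n * a < (\<Sum>i<n. step \<omega> i u)}
        \<le> unif_seq.prob {u \<in> space unif_seq. \<exists>n\<le>N. K1 + real n * (0 + \<epsilon>) < (\<Sum>i<n. \<zeta> i u)}"
      proof (intro unif_seq.finite_measure_mono subsetI CollectI conjI)
        fix u assume u: "u \<in> {u \<in> space unif_seq. \<exists>n\<le>N. K1 + K2 - real n * a < (\<Sum>i<n. step \<omega> i u)}"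
        then obtain n where n: "n \<le> N" "K1 + K2 - real n * a < (\<Sum>i<n. step \<omega> i u)" by auto
        have "(\<Sum>i<n. f (X (Suc i) \<omega>)) \<le> K2" using good w n by (auto simp: bad_def not_less)
        moreover have "(\<Sum>i<n. f (X (Suc i) \<omega>)) = (\<Sum>i<n. m i) + real n * (a + \<epsilon>)"
          by (simp add: f_def m_def sum.distrib algebra_simps)
        moreover have "(\<Sum>i<n. \<zeta> i u) = (\<Sum>i<n. step \<omega> i u) - (\<Sum>i<n. m i)" by (simp add: \<zeta>_def sum_subtractf)
        ultimately show "\<exists>n\<le>N. K1 + real n * (0 + \<epsilon>) < (\<Sum>i<n. \<zeta> i u)"
          using n by (intro exI[of _ n]) (simp add: algebra_simps)
        show "u \<in> space unif_seq" using u by simp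
      qed (simp add: \<zeta>_def)
      also have "\<dots> \<le> e / 2" by (rule cross[OF ds]) simp
      finally show "emeasure unif_seq {u \<in> space unif_seq. \<exists>n\<le>N. K1 + K2 - real n * a < (\<Sum>i<n. step \<omega> i u)} \<le> ennreal (e / 2)"
        by (simp add: unif_seq.emeasure_eq_measure ennreal_leI)
    qed (use e in \<open>auto intro: unif_seq.emeasure_le_1\<close>)
    then show "(\<integral>\<^sup>+\<omega>. emeasure unif_seq {u \<in> space unif_seq. \<exists>n\<le>N. K1 + K2 - real n * a < (\<Sum>i<n. step \<omega> i u)} \<partial>M) \<le> ennreal e"
      by simp
  qed
qed

end

context modulated_tails
begin

text \<open>The lower tails of the steps have only a mean under the stationary measure.  Truncation at \<open>- \<beta>\<close>
  leaves a walk with bounded downward steps; the truncated part \<open>W\<close> below has a small mean per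
  cycle and is controlled at a fixed time by Markov's inequality, first in the environment and then
  conditionally on it.\<close>

lemma walk_rarely_below_line:
  assumes int: "integrable \<pi> (\<lambda>x. \<integral>y. y \<partial>Fx x)"
    and a: "- (\<integral>x. (\<integral>y. y \<partial>Fx x) \<partial>\<pi>) < a" and e: "0 < e"
  obtains K where "0 < K"
    and "\<And>n. (\<integral>\<^sup>+\<omega>. emeasure unif_seq {u \<in> space unif_seq. (\<Sum>i<n. step \<omega> i u) \<le> - (K + real n * a)} \<partial>M) \<le> ennreal e"
proof -
  interpret pi: prob_space \<pi> by (rule prob_space_stationary_measure)
  note sets_stationary_measure [measurable_cong]
  define \<mu> where "\<mu> = (\<integral>x. (\<integral>y. y \<partial>Fx x) \<partial>\<pi>)"
  \<comment> \<open>A quarter of the gap: the mean of \<open>f\<close> is at most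
    \<open>- \<epsilon>\<close>, the centred truncated steps and the truncated-away part take
    \<open>\<epsilon>\<close> each, and one remains in the final comparison.\<close>
  define \<epsilon> where "\<epsilon> = (a + \<mu>) / 4"
  have eps: "0 < \<epsilon>" using a by (simp add: \<epsilon>_def \<mu>_def)
  have a_eq: "a = 4 * \<epsilon> - \<mu>" by (simp add: \<epsilon>_def field_simps)
  \<comment> \<open>Five exceptional probabilities of size \<open>\<theta>\<close> occur:
    \<open>bad1\<close>, \<open>bad3\<close>, \<open>bad4\<close>, the crossing by the centred steps
    and the Markov bound for \<open>W\<close>.\<close>
  define \<theta> where "\<theta> = e / 6"
  have th: "0 < \<theta>" using e by (simp add: \<theta>_def)
  have m: "0 < mean_len" using mean_len_ge_1 by simp
  \<comment> \<open>One factor \<open>\<theta>\<close> is consumed by Markov's inequality over the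
    environment, the other by the conditional one; \<open>\<epsilon> / mean_len\<close> converts a
    slope per step into a mean per cycle.\<close>
  have "eventually (\<lambda>\<beta>. (\<integral>x. trunc_mean (Fx x) \<beta> \<partial>\<pi>) < \<mu> + \<theta> * \<epsilon> * \<theta> / mean_len) at_top"
    using th eps m by (intro order_tendstoD(2)[OF trunc_mean_lim[OF int]]) (simp add: \<mu>_def)
  from eventually_happens'[OF trivial_limit_at_top_linorder eventually_conj[OF this eventually_ge_at_top[of 0]]]
  obtain \<beta> where \<beta>: "(\<integral>x. trunc_mean (Fx x) \<beta> \<partial>\<pi>) < \<mu> + \<theta> * \<epsilon> * \<theta> / mean_len" "0 \<le> \<beta>"
    by (elim exE conjE)
  define B where "B = stop_loss F 0"
  have B: "0 \<le> B" unfolding B_def by (rule H.F.stop_loss_nonneg)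
  have tm: "- \<beta> \<le> trunc_mean (Fx x) \<beta>" "trunc_mean (Fx x) \<beta> \<le> B" "(\<integral>y. y \<partial>Fx x) \<le> trunc_mean (Fx x) \<beta>"
    if "x \<in> space SX" for x
    using trunc_mean_bounds[OF that \<beta>(2)] by (auto simp: B_def)
  have tm_int: "integrable \<pi> (\<lambda>x. trunc_mean (Fx x) \<beta>)"
    by (rule pi.integrable_const_bound[of _ "\<beta> + B"])
       (use tm B \<beta>(2) in \<open>force intro!: AE_I2 simp: space_stationary_measure abs_le_iff\<close>)+
  have mean_meas [measurable]: "(\<lambda>x. \<integral>y. y \<partial>Fx x) \<in> borel_measurable SX"
    by (rule measurable_compose[OF Fx_kernel]) measurable
  define g where "g = (\<lambda>x. trunc_mean (Fx x) \<beta> - (\<integral>y. y \<partial>Fx x))"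
  have g_meas [measurable]: "g \<in> borel_measurable SX" unfolding g_def by measurable
  have g_nonneg: "0 \<le> g x" if "x \<in> space SX" for x using tm[OF that] by (simp add: g_def)
  have g_pi: "mean_len * (\<integral>x. g x \<partial>\<pi>) \<le> \<theta> * \<epsilon> * \<theta>"
  proof -
    have "(\<integral>x. g x \<partial>\<pi>) = (\<integral>x. trunc_mean (Fx x) \<beta> \<partial>\<pi>) - \<mu>"
      unfolding g_def \<mu>_def by (rule Bochner_Integration.integral_diff[OF tm_int int])
    with \<beta>(1) have "(\<integral>x. g x \<partial>\<pi>) \<le> \<theta> * \<epsilon> * \<theta> / mean_len" by simp
    then show ?thesis using m by (simp add: field_simps)
  qed
  have g_cycle: "(\<integral>\<^sup>+\<omega>. cycle_sum (\<lambda>x. ennreal (g x)) (cyc (Suc l) \<omega>) \<partial>M) \<le> ennreal (\<theta> * \<epsilon> * \<theta>)" for l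
  proof -
    have "(\<integral>\<^sup>+\<omega>. cycle_sum (\<lambda>x. ennreal (g x)) (cyc (Suc l) \<omega>) \<partial>M) = (\<integral>\<^sup>+\<omega>. cycle_sum (\<lambda>x. ennreal (g x)) (cyc 1 \<omega>) \<partial>M)"
      by (rule nn_integral_cyc) measurable
    also have "\<dots> = ennreal mean_len * (\<integral>\<^sup>+x. ennreal (g x) \<partial>\<pi>)"
      by (rule nn_integral_stationary_measure[symmetric]) measurable
    also have "(\<integral>\<^sup>+x. ennreal (g x) \<partial>\<pi>) = ennreal (\<integral>x. g x \<partial>\<pi>)"
      unfolding g_def using tm_int int g_nonneg
      by (intro nn_integral_eq_integral Bochner_Integration.integrable_diff AE_I2)
         (auto simp: space_stationary_measure g_def)
    also have "ennreal mean_len * \<dots> = ennreal (mean_len * (\<integral>x. g x \<partial>\<pi>))"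
      using m by (simp add: ennreal_mult')
    also have "\<dots> \<le> ennreal (\<theta> * \<epsilon> * \<theta>)" by (rule ennreal_leI[OF g_pi])
    finally show ?thesis .
  qed
  define f where "f = (\<lambda>x. - trunc_mean (Fx x) \<beta> - (a - 3 * \<epsilon>))"
  have f_bnd: "\<bar>f x\<bar> \<le> \<beta> + B + \<bar>a - 3 * \<epsilon>\<bar>" if "x \<in> space SX" for x
    using tm[OF that] B \<beta>(2) unfolding f_def by linarith
  have f_neg: "(\<integral>x. f x \<partial>\<pi>) < 0"
  proof -
    have "\<mu> \<le> (\<integral>x. trunc_mean (Fx x) \<beta> \<partial>\<pi>)"
      unfolding \<mu>_def using tm by (intro integral_mono int tm_int) (simp add: space_stationary_measure)
    moreover have "(\<integral>x. f x \<partial>\<pi>) = - (\<integral>x. trunc_mean (Fx x) \<beta> \<partial>\<pi>) - (a - 3 * \<epsilon>)"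
      unfolding f_def using tm_int by (simp add: pi.prob_space)
    ultimately show ?thesis using eps a_eq by linarith
  qed
  have f_meas [measurable]: "f \<in> borel_measurable SX" unfolding f_def by measurable
  have "eventually (\<lambda>K. \<forall>N. prob {\<omega> \<in> space M. \<exists>n\<le>N. K < (\<Sum>i<n. f (X (Suc i) \<omega>))} \<le> \<theta>) at_top"
    by (rule environment_crossing[OF f_meas f_bnd f_neg th])
  from eventually_happens'[OF trivial_limit_at_top_linorder eventually_conj[OF this eventually_gt_at_top[of 0]]]
  obtain K2 where K2: "\<forall>N. prob {\<omega> \<in> space M. \<exists>n\<le>N. K2 < (\<Sum>i<n. f (X (Suc i) \<omega>))} \<le> \<theta>" "0 < K2"
    by (elim exE conjE)
  \<comment> \<open>The initial cycle carries no moment assumption, so its contribution is bounded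
    only in probability, by \<open>K'\<close>. Dividing by \<open>\<theta>\<close> gives the
    constant \<open>K3\<close> that survives the conditional Markov bound.\<close>
  have V_meas: "(\<lambda>\<omega>. \<Sum>i<T 0 \<omega>. g (X (Suc i) \<omega>)) \<in> borel_measurable M" by measurable
  from eventually_happens'[OF trivial_limit_at_top_linorder eventually_conj[OF
      eventually_prob_greater_le[OF V_meas th] eventually_gt_at_top[of 0]]]
  obtain K' where K': "prob {\<omega> \<in> space M. K' < (\<Sum>i<T 0 \<omega>. g (X (Suc i) \<omega>))} \<le> \<theta>" "0 < K'"
    by (elim exE conjE)
  define K3 where "K3 = K' / \<theta>"
  have K3: "0 < K3" "\<theta> * K3 = K'" using K' th by (simp_all add: K3_def)
  \<comment> \<open>Now the upper tails of the steps are the unbounded side: truncating the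
    reflected step at \<open>- (\<beta> + t)\<close> raises its mean by at most the stop-loss at
    \<open>t\<close>.\<close>
  have "eventually (\<lambda>t. stop_loss F t < \<epsilon> / 2) at_top"
    using eps by (intro order_tendstoD(2)[OF H.F.tendsto_stop_loss]) simp
  from eventually_happens'[OF trivial_limit_at_top_linorder eventually_conj[OF this eventually_ge_at_top[of 0]]]
  obtain t where t: "stop_loss F t < \<epsilon> / 2" "0 \<le> t" by (elim exE conjE)
  \<comment> \<open>The reflected centred step is at most \<open>B + \<beta>\<close>, so a point
    mass dominates it.\<close>
  define F' where "F' = distr unif_seq borel (\<lambda>_. B + \<beta>)"
  have F': "integrable_dist F'"
    unfolding integrable_dist_def integrable_dist_axioms_def F'_def
  proof
    show "real_distribution (distr unif_seq borel (\<lambda>_. B + \<beta>))"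
      by (rule unif_seq.real_distribution_distr) simp
    show "integrable (distr unif_seq borel (\<lambda>_. B + \<beta>)) (\<lambda>y. y)"
      by (subst integrable_distr_eq) (simp_all del: unif_seq.distr_const)
  qed
  obtain K1 where K1: "0 < K1"
    and cross: "\<And>(P :: (nat \<Rightarrow> real) measure) \<xi> K N. dominated_steps F' (\<beta> + t) (\<epsilon> / 2) P \<xi> \<Longrightarrow> K1 \<le> K \<Longrightarrow>
      measure P {\<omega> \<in> space P. \<exists>n\<le>N. K + real n * (\<epsilon> / 2 + \<epsilon> / 2) < (\<Sum>i<n. \<xi> i \<omega>)} \<le> \<theta>"
    by (rule crossing_bound[OF F' _ th, where d="\<epsilon> / 2" and \<mu>="\<epsilon> / 2" and \<beta>="\<beta> + t"]) (use eps in auto)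
  show thesis
  proof (rule that[of "K1 + K2 + K3 + 1"])
    show "0 < K1 + K2 + K3 + 1" using K1 K2 K3 by simp
    fix n
    define bad1 where "bad1 = {\<omega> \<in> space M. \<exists>k\<le>n. K2 < (\<Sum>i<k. f (X (Suc i) \<omega>))}"
    define bad2 where "bad2 = {\<omega> \<in> space M. \<theta> * (real n * \<epsilon> + K3) < (\<Sum>i<n. g (X (Suc i) \<omega>))}"
    define bad3 where "bad3 = {\<omega> \<in> space M. K' < (\<Sum>i<T 0 \<omega>. g (X (Suc i) \<omega>))}"
    define bad4 where "bad4 = {\<omega> \<in> space M. ennreal (\<theta> * real n * \<epsilon>) < (\<Sum>l<n. cycle_sum (\<lambda>x. ennreal (g x)) (cyc (Suc l) \<omega>))}"
    have [measurable]: "bad1 \<in> events" "bad2 \<in> events" "bad3 \<in> events" "bad4 \<in> events"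
      unfolding bad1_def bad2_def bad3_def bad4_def by measurable
    have bad4: "prob bad4 \<le> \<theta>"
    proof (cases "n = 0")
      case False
      then have n: "0 < \<theta> * real n * \<epsilon>" using th eps by simp
      have "bad4 \<subseteq> {\<omega> \<in> space M. 1 \<le> ennreal (1 / (\<theta> * real n * \<epsilon>)) * (\<Sum>l<n. cycle_sum (\<lambda>x. ennreal (g x)) (cyc (Suc l) \<omega>))}"
      proof
        fix \<omega> assume w: "\<omega> \<in> bad4"
        have "1 = ennreal (1 / (\<theta> * real n * \<epsilon>)) * ennreal (\<theta> * real n * \<epsilon>)"
          using n th eps False by (simp add: ennreal_mult''[symmetric])
        also have "\<dots> \<le> ennreal (1 / (\<theta> * real n * \<epsilon>)) * (\<Sum>l<n. cycle_sum (\<lambda>x. ennreal (g x)) (cyc (Suc l) \<omega>))"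
          using w by (intro mult_left_mono) (auto simp: bad4_def)
        finally show "\<omega> \<in> {\<omega> \<in> space M. 1 \<le> ennreal (1 / (\<theta> * real n * \<epsilon>)) * (\<Sum>l<n. cycle_sum (\<lambda>x. ennreal (g x)) (cyc (Suc l) \<omega>))}"
          using w by (simp add: bad4_def)
      qed
      then have "emeasure M bad4 \<le> emeasure M {\<omega> \<in> space M. 1 \<le> ennreal (1 / (\<theta> * real n * \<epsilon>)) * (\<Sum>l<n. cycle_sum (\<lambda>x. ennreal (g x)) (cyc (Suc l) \<omega>))}"
        by (rule emeasure_mono) measurable
      also have "\<dots> \<le> ennreal (1 / (\<theta> * real n * \<epsilon>)) * (\<integral>\<^sup>+\<omega>. (\<Sum>l<n. cycle_sum (\<lambda>x. ennreal (g x)) (cyc (Suc l) \<omega>)) * indicator (space M) \<omega> \<partial>M)"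
        by (rule nn_integral_Markov_inequality) measurable
      also have "(\<integral>\<^sup>+\<omega>. (\<Sum>l<n. cycle_sum (\<lambda>x. ennreal (g x)) (cyc (Suc l) \<omega>)) * indicator (space M) \<omega> \<partial>M)
         = (\<Sum>l<n. \<integral>\<^sup>+\<omega>. cycle_sum (\<lambda>x. ennreal (g x)) (cyc (Suc l) \<omega>) \<partial>M)"
        by (subst nn_integral_sum[symmetric]) (auto intro!: nn_integral_cong)
      also have "ennreal (1 / (\<theta> * real n * \<epsilon>)) * \<dots> \<le> ennreal (1 / (\<theta> * real n * \<epsilon>)) * (\<Sum>l<n. ennreal (\<theta> * \<epsilon> * \<theta>))"
        by (intro mult_left_mono sum_mono g_cycle) auto
      also have "(\<Sum>l<n. ennreal (\<theta> * \<epsilon> * \<theta>)) = ennreal (real n * (\<theta> * \<epsilon> * \<theta>))"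
        using th eps by (simp add: ennreal_mult' ennreal_of_nat_eq_real_of_nat)
      also have "ennreal (1 / (\<theta> * real n * \<epsilon>)) * \<dots> = ennreal (1 / (\<theta> * real n * \<epsilon>) * (real n * (\<theta> * \<epsilon> * \<theta>)))"
        using n by (intro ennreal_mult'[symmetric]) simp
      also have "1 / (\<theta> * real n * \<epsilon>) * (real n * (\<theta> * \<epsilon> * \<theta>)) = \<theta>"
        using th eps False by (simp add: field_simps)
      finally show ?thesis using th by (simp add: emeasure_eq_measure)
    qed (use th in \<open>simp add: bad4_def\<close>)
    have bad2_sub: "bad2 \<subseteq> bad3 \<union> bad4"
    proof
      fix \<omega> assume "\<omega> \<in> bad2"
      then have w: "\<omega> \<in> space M" and b: "\<theta> * (real n * \<epsilon> + K3) < (\<Sum>i<n. g (X (Suc i) \<omega>))" by (auto simp: bad2_def)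
      show "\<omega> \<in> bad3 \<union> bad4"
      proof (rule ccontr)
        assume "\<omega> \<notin> bad3 \<union> bad4"
        then have b3: "(\<Sum>i<T 0 \<omega>. g (X (Suc i) \<omega>)) \<le> K'"
          and b4: "(\<Sum>l<n. cycle_sum (\<lambda>x. ennreal (g x)) (cyc (Suc l) \<omega>)) \<le> ennreal (\<theta> * real n * \<epsilon>)"
          using w by (auto simp: bad3_def bad4_def not_less)
        have gn: "0 \<le> g (X (Suc i) \<omega>)" for i by (intro g_nonneg measurable_space[OF measurable_X w])
        \<comment> \<open>Since \<open>n \<le> T n \<omega>\<close> and \<open>g\<close> is
          nonnegative, the initial cycle and \<open>n\<close> full cycles cover the first
          \<open>n\<close> steps.\<close>
        have "(\<Sum>i<n. g (X (Suc i) \<omega>)) \<le> (\<Sum>i<T n \<omega>. g (X (Suc i) \<omega>))"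
          using T_ge[OF w, of n] gn by (intro sum_mono2) auto
        also have "\<dots> = (\<Sum>i<T 0 \<omega>. g (X (Suc i) \<omega>)) + (\<Sum>l<n. cycle_sum g (cyc (Suc l) \<omega>))"
          using sum_cycles[OF w, of "\<lambda>i. g (X (Suc i) \<omega>)" n] by (simp add: cycle_sum_def cyc_value)
        also have "(\<Sum>l<n. cycle_sum g (cyc (Suc l) \<omega>)) \<le> \<theta> * real n * \<epsilon>"
        proof -
          have "ennreal (\<Sum>l<n. cycle_sum g (cyc (Suc l) \<omega>)) = (\<Sum>l<n. cycle_sum (\<lambda>x. ennreal (g x)) (cyc (Suc l) \<omega>))"
            unfolding cycle_sum_def using g_nonneg cyc_space[OF w] by (simp add: sum_ennreal sum_nonneg)
          with b4 have "ennreal (\<Sum>l<n. cycle_sum g (cyc (Suc l) \<omega>)) \<le> ennreal (\<theta> * real n * \<epsilon>)" by simp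
          then show ?thesis using th eps by (subst (asm) ennreal_le_iff) auto
        qed
        also have "(\<Sum>i<T 0 \<omega>. g (X (Suc i) \<omega>)) + \<theta> * real n * \<epsilon> \<le> \<theta> * (real n * \<epsilon> + K3)"
          using b3 K3 by (simp add: algebra_simps)
        finally show False using b by simp
      qed
    qed
    have bad: "prob (bad1 \<union> bad2) \<le> 3 * \<theta>"
    proof -
      have "prob (bad1 \<union> bad2) \<le> prob bad1 + prob bad2" by (rule measure_Un_le) measurable
      also have "prob bad2 \<le> prob (bad3 \<union> bad4)" by (rule finite_measure_mono[OF bad2_sub]) measurable
      also have "\<dots> \<le> prob bad3 + prob bad4" by (rule measure_Un_le) measurable
      finally have "prob (bad1 \<union> bad2) \<le> prob bad1 + (prob bad3 + prob bad4)" by simp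
      moreover have "prob bad1 \<le> \<theta>" unfolding bad1_def by (rule K2(1)[THEN spec])
      moreover have "prob bad3 \<le> \<theta>" unfolding bad3_def by (rule K'(1))
      ultimately show ?thesis using bad4 by linarith
    qed
    have "(\<integral>\<^sup>+\<omega>. emeasure unif_seq {u \<in> space unif_seq. (\<Sum>i<n. step \<omega> i u) \<le> - (K1 + K2 + K3 + 1 + real n * a)} \<partial>M)
      \<le> ennreal (2 * \<theta> + 3 * \<theta>)"
    proof (rule nn_integral_le_const_plus[OF _ _ _ bad])
      show "bad1 \<union> bad2 \<in> events" by measurable
      fix \<omega> assume w: "\<omega> \<in> space M" and good: "\<omega> \<notin> bad1 \<union> bad2"
      define m where "m = (\<lambda>i. trunc_mean (Fx (X (Suc i) \<omega>)) \<beta>)"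
      have m: "- \<beta> \<le> m i" "m i \<le> B" for i
        unfolding m_def using tm measurable_space[OF measurable_X w] by auto
      define \<zeta> where "\<zeta> = (\<lambda>i u. m i - max (step \<omega> i u) (- \<beta>))"
      have [measurable]: "step \<omega> i \<in> borel_measurable unif_seq" for i by (rule measurable_step[OF w])
      have i1: "integrable unif_seq (\<lambda>u. max (step \<omega> i u) (- \<beta>))" for i
      proof -
        interpret Fx: integrable_dist "Fx (X (Suc i) \<omega>)" using w by (rule Fx_X)
        show ?thesis using Fx.integrable_max_const by (subst integrable_step[OF w, of "\<lambda>z. max z (- \<beta>)"]) simp_all
      qed
      have E1: "(\<integral>u. max (step \<omega> i u) (- \<beta>) \<partial>unif_seq) = m i" for i
        using integral_step[OF w, of "\<lambda>z. max z (- \<beta>)" i] by (simp add: m_def trunc_mean_def)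
      have ds: "dominated_steps F' (\<beta> + t) (\<epsilon> / 2) unif_seq \<zeta>"
        unfolding dominated_steps_def
      proof (intro conjI unif_seq.prob_space_axioms allI exI[of _ "\<lambda>i u. B + \<beta>"] ballI)
        show "unif_seq.indep_vars (\<lambda>_. borel) \<zeta> UNIV"
          unfolding \<zeta>_def by (rule unif_seq.indep_vars_compose2[OF indep_step[OF w]]) auto
        fix i
        show "(\<lambda>u. B + \<beta>) \<in> borel_measurable unif_seq" by simp
        show "distr unif_seq borel (\<lambda>u. B + \<beta>) = F'" by (simp add: F'_def)
        show "\<zeta> i u \<le> B + \<beta>" for u using m[of i] by (simp add: \<zeta>_def)
        interpret Fx: integrable_dist "Fx (X (Suc i) \<omega>)" using w by (rule Fx_X)
        have i2: "integrable unif_seq (\<lambda>u. max 0 (step \<omega> i u - t))"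
          using Fx.integrable_excess by (subst integrable_step[OF w, of "\<lambda>z. max 0 (z - t)"]) simp_all
        have i3: "integrable unif_seq (\<zeta> i)"
          unfolding \<zeta>_def using i1[of i] by simp
        have "(\<integral>u. max (\<zeta> i u) (- (\<beta> + t)) \<partial>unif_seq) \<le> (\<integral>u. \<zeta> i u + max 0 (step \<omega> i u - t) \<partial>unif_seq)"
        proof (rule integral_mono)
          show "integrable unif_seq (\<lambda>u. max (\<zeta> i u) (- (\<beta> + t)))"
            by (intro integrable_max i3 unif_seq.integrable_const)
          show "integrable unif_seq (\<lambda>u. \<zeta> i u + max 0 (step \<omega> i u - t))"
            by (intro Bochner_Integration.integrable_add i2 i3)
          show "max (\<zeta> i u) (- (\<beta> + t)) \<le> \<zeta> i u + max 0 (step \<omega> i u - t)" for u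
            using m[of i] t(2) \<beta>(2) by (auto simp: \<zeta>_def)
        qed
        also have "\<dots> = (\<integral>u. \<zeta> i u \<partial>unif_seq) + (\<integral>u. max 0 (step \<omega> i u - t) \<partial>unif_seq)"
          by (rule Bochner_Integration.integral_add[OF i3 i2])
        also have "(\<integral>u. \<zeta> i u \<partial>unif_seq) = 0"
          unfolding \<zeta>_def using i1[of i] E1[of i] by (simp add: unif_seq.prob_space)
        also have "(\<integral>u. max 0 (step \<omega> i u - t) \<partial>unif_seq) = stop_loss (Fx (X (Suc i) \<omega>)) t"
          using integral_step[OF w, of "\<lambda>z. max 0 (z - t)" i] by (simp add: stop_loss_def)
        also have "\<dots> \<le> stop_loss F t" by (intro stop_loss_Fx_bounds measurable_space[OF measurable_X w])
        finally show "(\<integral>u. max (\<zeta> i u) (- (\<beta> + t)) \<partial>unif_seq) \<le> \<epsilon> / 2" using t(1) by simp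
      qed
      \<comment> \<open>What truncation at \<open>- \<beta>\<close> adds to the walk. Its
        conditional mean is the sum of \<open>g\<close> over the environment, at most
        \<open>\<theta> * r\<close> outside \<open>bad2\<close>.\<close>
      define W where "W = (\<lambda>u. \<Sum>i<n. max (step \<omega> i u) (- \<beta>) - step \<omega> i u)"
      define r where "r = real n * \<epsilon> + K3"
      have r: "0 < r" using eps K3 by (simp add: r_def add_nonneg_pos)
      have [measurable]: "W \<in> borel_measurable unif_seq" unfolding W_def by measurable
      have W0: "0 \<le> W u" for u unfolding W_def by (intro sum_nonneg) simp
      have i4: "integrable unif_seq (step \<omega> i)" for i
      proof -
        interpret Fx: integrable_dist "Fx (X (Suc i) \<omega>)" using w by (rule Fx_X)
        show ?thesis
          by (rule integrable_step[OF w, of "\<lambda>z. z", THEN iffD2])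
             (rule measurable_ident_sets[OF refl], rule Fx.integrable_id)
      qed
      have W_int: "integrable unif_seq W"
        unfolding W_def by (intro Bochner_Integration.integrable_sum Bochner_Integration.integrable_diff i1 i4)
      have "(\<integral>u. W u \<partial>unif_seq) = (\<Sum>i<n. \<integral>u. max (step \<omega> i u) (- \<beta>) - step \<omega> i u \<partial>unif_seq)"
        unfolding W_def by (intro Bochner_Integration.integral_sum Bochner_Integration.integrable_diff i1 i4)
      also have "\<dots> = (\<Sum>i<n. g (X (Suc i) \<omega>))"
      proof (rule sum.cong)
        fix i
        have "(\<integral>u. max (step \<omega> i u) (- \<beta>) - step \<omega> i u \<partial>unif_seq) = m i - (\<integral>u. step \<omega> i u \<partial>unif_seq)"
          using E1[of i] Bochner_Integration.integral_diff[OF i1[of i] i4[of i]] by simp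
        then show "(\<integral>u. max (step \<omega> i u) (- \<beta>) - step \<omega> i u \<partial>unif_seq) = g (X (Suc i) \<omega>)"
          using integral_step[OF w, of "\<lambda>z. z" i] by (simp add: g_def m_def)
      qed simp
      also have "\<dots> \<le> \<theta> * r" using good w by (simp add: bad2_def r_def not_less)
      finally have EW: "(\<integral>u. W u \<partial>unif_seq) \<le> \<theta> * r" .
      have PW: "unif_seq.prob {u \<in> space unif_seq. r \<le> W u} \<le> \<theta>"
      proof -
        have "unif_seq.prob {u \<in> space unif_seq. r \<le> W u} \<le> (\<integral>u. W u \<partial>unif_seq) / r"
          by (rule integral_Markov_inequality_measure[where A="{}"]) (use W_int W0 r in auto)
        also have "\<dots> \<le> \<theta> * r / r" using EW r by (intro divide_right_mono) auto
        finally show ?thesis using r by simp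
      qed
      have "unif_seq.prob {u \<in> space unif_seq. (\<Sum>i<n. step \<omega> i u) \<le> - (K1 + K2 + K3 + 1 + real n * a)}
        \<le> unif_seq.prob ({u \<in> space unif_seq. \<exists>k\<le>n. K1 + real k * (\<epsilon> / 2 + \<epsilon> / 2) < (\<Sum>i<k. \<zeta> i u)} \<union> {u \<in> space unif_seq. r \<le> W u})"
      proof (intro unif_seq.finite_measure_mono subsetI)
        fix u assume u: "u \<in> {u \<in> space unif_seq. (\<Sum>i<n. step \<omega> i u) \<le> - (K1 + K2 + K3 + 1 + real n * a)}"
        show "u \<in> {u \<in> space unif_seq. \<exists>k\<le>n. K1 + real k * (\<epsilon> / 2 + \<epsilon> / 2) < (\<Sum>i<k. \<zeta> i u)} \<union> {u \<in> space unif_seq. r \<le> W u}"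
        proof (rule ccontr)
          assume neg: "u \<notin> {u \<in> space unif_seq. \<exists>k\<le>n. K1 + real k * (\<epsilon> / 2 + \<epsilon> / 2) < (\<Sum>i<k. \<zeta> i u)} \<union> {u \<in> space unif_seq. r \<le> W u}"
          have z: "(\<Sum>i<n. \<zeta> i u) \<le> K1 + real n * \<epsilon>" using neg u by (auto simp: not_less)
          have Wu: "W u < r" using neg u by (auto simp: not_le)
          have "(\<Sum>i<n. f (X (Suc i) \<omega>)) \<le> K2" using good w by (auto simp: bad1_def not_less)
          moreover have "(\<Sum>i<n. f (X (Suc i) \<omega>)) = - (\<Sum>i<n. m i) - real n * (a - 3 * \<epsilon>)"
            by (simp add: f_def m_def sum_subtractf sum_negf)
          moreover have "(\<Sum>i<n. step \<omega> i u) = (\<Sum>i<n. m i) - (\<Sum>i<n. \<zeta> i u) - W u"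
            by (simp add: \<zeta>_def W_def sum_subtractf)
          moreover have "real n * (a - 3 * \<epsilon>) = real n * a - 3 * (real n * \<epsilon>)" by (simp add: algebra_simps)
          moreover have "0 \<le> real n * \<epsilon>" using eps by simp
          ultimately show False using z Wu u by (simp add: r_def)
        qed
      qed (simp add: \<zeta>_def)
      also have "\<dots> \<le> unif_seq.prob {u \<in> space unif_seq. \<exists>k\<le>n. K1 + real k * (\<epsilon> / 2 + \<epsilon> / 2) < (\<Sum>i<k. \<zeta> i u)}
          + unif_seq.prob {u \<in> space unif_seq. r \<le> W u}"
        unfolding \<zeta>_def by (rule measure_Un_le) measurable
      also have "\<dots> \<le> \<theta> + \<theta>" by (intro add_mono cross[OF ds] PW) simp
      finally show "emeasure unif_seq {u \<in> space unif_seq. (\<Sum>i<n. step \<omega> i u) \<le> - (K1 + K2 + K3 + 1 + real n * a)} \<le> ennreal (2 * \<theta>)"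
        by (simp add: unif_seq.emeasure_eq_measure ennreal_leI)
    qed (use th in \<open>auto intro: unif_seq.emeasure_le_1\<close>)
    also have "\<dots> \<le> ennreal e" using e by (intro ennreal_leI) (simp add: \<theta>_def)
    finally show "(\<integral>\<^sup>+\<omega>. emeasure unif_seq {u \<in> space unif_seq. (\<Sum>i<n. step \<omega> i u) \<le> - (K1 + K2 + K3 + 1 + real n * a)} \<partial>M) \<le> ennreal e" .
  qed
qed

end

section \<open>Asymptotics of the maximum\<close>

context modulated_walk
begin

text \<open>The decomposition is applied in each frozen environment with the uniform constant
  \<open>D\<close> and then averaged; only the average of the crossing probability along the line is
  small, not each value.\<close>

lemma prob_max_upper_bound:
  assumes kappa: "kappa SX Fx < 0" and int: "integrable \<pi> (\<lambda>x. \<integral>y. y \<partial>Fx x)"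
    and a: "0 < a" "a < - (\<integral>x. (\<integral>y. y \<partial>Fx x) \<partial>\<pi>)" and e: "0 < e"
  shows "eventually (\<lambda>y. \<forall>N. emeasure M {\<omega> \<in> space M. \<exists>n\<le>N. y < (\<Sum>i<n. \<xi> (Suc i) \<omega>)}
     \<le> ennreal ((C / a + e) * tail H y)) at_top"
proof -
  obtain \<beta> \<mu> where \<mu>: "\<mu> < 0" "\<And>x. x \<in> space SX \<Longrightarrow> trunc_mean (Fx x) \<beta> \<le> \<mu>"
    by (rule kappa_neg_imp_uniform[OF kappa]) (rule that)
  have ds: "dominated_steps F \<beta> \<mu> unif_seq (step \<omega>)" if "\<omega> \<in> space M" for \<omega>
    by (rule dominated_steps_step[OF that \<mu>(2)])
  obtain D where D: "1 \<le> D"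
    and Dbound: "\<And>(P :: (nat \<Rightarrow> real) measure) \<xi> N y. dominated_steps F \<beta> \<mu> P \<xi> \<Longrightarrow>
      measure P {\<omega> \<in> space P. \<exists>n\<le>N. y < (\<Sum>i<n. \<xi> i \<omega>)} \<le> min 1 (D * tail H y)"
    by (rule H.uniform_tail_bound[OF \<mu>(1), of \<beta>]) blast
  \<comment> \<open>Together with \<open>tail H (y - L) \<le> 2 * tail H y\<close>, the crossing
    term becomes \<open>2 * D * e1 = e / 4\<close>.\<close>
  define e1 where "e1 = e / (8 * D)"
  have e1: "0 < e1" using e D by (simp add: e1_def)
  obtain K where K: "0 < K"
    and line: "\<And>N. (\<integral>\<^sup>+\<omega>. emeasure unif_seq {u \<in> space unif_seq. \<exists>n\<le>N. K - real n * a < (\<Sum>i<n. step \<omega> i u)} \<partial>M) \<le> ennreal e1"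
    by (rule walk_rarely_above_line[OF int a(2) e1]) blast
  define r where "r = 2 / a"
  have r: "0 < r" using a by (simp add: r_def)
  obtain L1 where L1: "\<And>(P :: (nat \<Rightarrow> real) measure) \<xi> \<beta> \<mu> t N. dominated_steps F \<beta> \<mu> P \<xi> \<Longrightarrow> L1 \<le> t \<Longrightarrow>
     (\<Sum>n<N. measure P {\<omega> \<in> space P. t - K + real n * a < \<xi> n \<omega>}) \<le> 2 / a * tail H t"
    by (rule H.eventually_jumps_le[OF a(1), of K]) blast
  \<comment> \<open>The intermediate term becomes \<open>D * r * e2 = e / 4\<close>; with
    \<open>e / 4\<close> from the jump mass the total stays below \<open>e\<close>.\<close>
  define e2 where "e2 = e / (4 * D * r)"
  have e2: "0 < e2" using e D r by (simp add: e2_def)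
  obtain L2 where L2: "\<And>L. L2 \<le> L \<Longrightarrow> eventually (\<lambda>y. two_jumps H L y \<le> ennreal (e2 * tail H y)) at_top"
    by (rule H.two_jumps_small[OF e2]) blast
  define L where "L = max 0 (max L1 L2)"
  have L: "0 \<le> L" "L1 \<le> L" "L2 \<le> L" by (auto simp: L_def)
  have "eventually (\<lambda>y. tail H (y - L) / tail H y < 2) at_top"
    by (rule order_tendstoD(2)[OF H.long_tailed]) simp
  moreover have "eventually (\<lambda>y. two_jumps H L y \<le> ennreal (e2 * tail H y)) at_top" by (rule L2[OF L(3)])
  moreover have "eventually (\<lambda>y. jump_mass a (y + (- L - K)) \<le> ennreal ((C / a + e / 4) * tail H y)) at_top"
    using e by (intro eventually_jump_mass_le a) simp
  ultimately show ?thesis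
    using eventually_ge_at_top[of K]
  proof eventually_elim
    case (elim y)
    have t: "0 < tail H y" by (rule H.tail_pos)
    have tL: "tail H (y - L) \<le> 2 * tail H y" using elim(1) t by (simp add: divide_less_eq)
    show ?case
    proof
      fix N
      define cross where "cross = (\<lambda>\<omega>. emeasure unif_seq {u \<in> space unif_seq. \<exists>n\<le>N. K - real n * a < (\<Sum>i<n. step \<omega> i u)})"
      define jumps where "jumps = (\<lambda>\<omega>. \<Sum>n<N. ennreal (tail (Fx (X (Suc n) \<omega>)) (y - L - K + real n * a)))"
      have [measurable]: "cross \<in> borel_measurable M"
        unfolding cross_def by (rule measurable_prob_step) measurable
      have [measurable]: "jumps \<in> borel_measurable M" unfolding jumps_def by measurable
      have "emeasure M {\<omega> \<in> space M. \<exists>n\<le>N. y < (\<Sum>i<n. \<xi> (Suc i) \<omega>)}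
        = (\<integral>\<^sup>+\<omega>. emeasure unif_seq {u \<in> space unif_seq. \<exists>n\<le>N. y < (\<Sum>i<n. step \<omega> i u)} \<partial>M)"
        by (rule emeasure_max_transfer)
      also have "\<dots> \<le> (\<integral>\<^sup>+\<omega>. ennreal (D * tail H (y - L)) * cross \<omega> + ennreal D * (ennreal r * two_jumps H L y) + jumps \<omega> \<partial>M)"
      proof (rule nn_integral_mono)
        fix \<omega> assume w: "\<omega> \<in> space M"
        have "ennreal (unif_seq.prob {u \<in> space unif_seq. \<exists>n\<le>N. y < (\<Sum>i<n. step \<omega> i u)})
          \<le> ennreal (unif_seq.prob {u \<in> space unif_seq. \<exists>n\<le>N. K - real n * a < (\<Sum>i<n. step \<omega> i u)} * (D * tail H (y - L)))
            + ennreal D * (ennreal r * two_jumps H L y)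
            + ennreal (\<Sum>n<N. unif_seq.prob {u \<in> space unif_seq. y - L - K + real n * a < step \<omega> n u})"
        proof (rule H.big_jump_decomposition)
          show "unif_seq.indep_vars (\<lambda>_. borel) (step \<omega>) UNIV" by (rule indep_step[OF w])
          show "unif_seq.prob {u \<in> space unif_seq. \<exists>m\<le>N - n. t < (\<Sum>i<m. step \<omega> (n + i) u)} \<le> min 1 (D * tail H t)" for n t
            by (rule Dbound[OF dominated_steps_shift[OF ds[OF w]]])
          show "(\<Sum>n<N. unif_seq.prob {u \<in> space unif_seq. t - K + real n * a < step \<omega> n u}) \<le> r * tail H t" if "L \<le> t" for t
            unfolding r_def using that L by (intro L1[OF ds[OF w]]) simp
        qed (use K a L D r elim(4) unif_seq.prob_space_axioms in auto)
        then show "emeasure unif_seq {u \<in> space unif_seq. \<exists>n\<le>N. y < (\<Sum>i<n. step \<omega> i u)}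
          \<le> ennreal (D * tail H (y - L)) * cross \<omega> + ennreal D * (ennreal r * two_jumps H L y) + jumps \<omega>"
          unfolding cross_def jumps_def unif_seq.emeasure_eq_measure prob_step_greater[OF w]
          using D H.tail_bounds(1) integrable_dist.axioms(1)[OF Fx_X[OF w]]
          by (simp add: sum_ennreal real_distribution.tail_bounds ennreal_mult' mult.commute)
      qed
      also have "\<dots> = ennreal (D * tail H (y - L)) * (\<integral>\<^sup>+\<omega>. cross \<omega> \<partial>M) + ennreal D * (ennreal r * two_jumps H L y) + (\<integral>\<^sup>+\<omega>. jumps \<omega> \<partial>M)"
        by (simp add: nn_integral_add nn_integral_cmult emeasure_space_1)
      also have "\<dots> \<le> ennreal (D * (2 * tail H y)) * ennreal e1 + ennreal D * (ennreal r * ennreal (e2 * tail H y)) + ennreal ((C / a + e / 4) * tail H y)"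
      proof (intro add_mono mult_mono mult_left_mono)
        show "ennreal (D * tail H (y - L)) \<le> ennreal (D * (2 * tail H y))"
          using tL D by (intro ennreal_leI mult_left_mono) auto
        show "(\<integral>\<^sup>+\<omega>. cross \<omega> \<partial>M) \<le> ennreal e1" unfolding cross_def by (rule line)
        show "two_jumps H L y \<le> ennreal (e2 * tail H y)" by (rule elim(2))
        have "(\<integral>\<^sup>+\<omega>. jumps \<omega> \<partial>M) \<le> jump_mass a (y + (- L - K))"
          unfolding jumps_def jump_mass_def
          by (intro nn_integral_mono order_trans[OF sum_le_suminf[OF summableI]]) (simp_all add: algebra_simps)
        with elim(3) show "(\<integral>\<^sup>+\<omega>. jumps \<omega> \<partial>M) \<le> ennreal ((C / a + e / 4) * tail H y)" by (rule order_trans[rotated])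
      qed simp_all
      also have "\<dots> = ennreal (D * (2 * tail H y) * e1 + D * (r * (e2 * tail H y)) + (C / a + e / 4) * tail H y)"
        using D r e1 e2 t C_nonneg a e
        by (simp add: ennreal_mult'[symmetric] ennreal_plus[symmetric] del: ennreal_plus)
      also have "D * (2 * tail H y) * e1 + D * (r * (e2 * tail H y)) + (C / a + e / 4) * tail H y
        = (C / a + e * 3 / 4) * tail H y"
      proof -
        have "D * (2 * tail H y) * e1 = e / 4 * tail H y" using D by (simp add: e1_def)
        moreover have "D * (r * (e2 * tail H y)) = e / 4 * tail H y" using D r by (simp add: e2_def)
        ultimately have "D * (2 * tail H y) * e1 + D * (r * (e2 * tail H y)) + (C / a + e / 4) * tail H y
          = e / 4 * tail H y + e / 4 * tail H y + (C / a + e / 4) * tail H y" by (simp only:)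
        then show ?thesis by (simp add: algebra_simps)
      qed
      also have "ennreal \<dots> \<le> ennreal ((C / a + e) * tail H y)"
        using t e by (intro ennreal_leI mult_right_mono) auto
      finally show "emeasure M {\<omega> \<in> space M. \<exists>n\<le>N. y < (\<Sum>i<n. \<xi> (Suc i) \<omega>)} \<le> ennreal ((C / a + e) * tail H y)" .
    qed
  qed
qed

text \<open>In a fixed environment the chance of having dropped below the lower line need not be
  small; only its average is. It is therefore split off into a second sum, with the jump probability
  replaced by the tail of \<open>F\<close>, which is the same in all environments and passes through
  the later integration.\<close>

lemma sum_single_jumps_le:
  assumes w: "\<omega> \<in> space M" and e1: "0 \<le> e1" and y: "0 \<le> y" "0 \<le> K" "0 \<le> a"
    and small: "\<And>n. unif_seq.prob {u \<in> space unif_seq. \<exists>j\<le>n. y < (\<Sum>i<j. step \<omega> i u)} \<le> e1"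
  shows "(\<Sum>n<N. ennreal (1 - e1) * ennreal (tail (Fx (X (Suc n) \<omega>)) (y + K + real n * a)))
    \<le> emeasure unif_seq {u \<in> space unif_seq. \<exists>n\<le>N. y < (\<Sum>i<n. step \<omega> i u)}
      + (\<Sum>n<N. ennreal (tail F (y + K + real n * a)) * emeasure unif_seq {u \<in> space unif_seq. (\<Sum>i<n. step \<omega> i u) \<le> - (K + real n * a)})"
proof -
  define S where "S = (\<lambda>n u. \<Sum>i<n. step \<omega> i u)"
  have st [measurable]: "step \<omega> i \<in> borel_measurable unif_seq" for i by (rule measurable_step[OF w])
  have S_meas [measurable]: "S n \<in> borel_measurable unif_seq" for n unfolding S_def by measurable
  define b where "b = (\<lambda>n. y + K + real n * a)"
  \<comment> \<open>Started above the lower line at time \<open>n\<close>, a step larger than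
    \<open>b n\<close> lands above \<open>y\<close>. \<open>Gd n\<close> involves only the first
    \<open>n\<close> steps and is independent of \<open>J n\<close>.\<close>
  define Gd where "Gd = (\<lambda>n. {u \<in> space unif_seq. (\<forall>j\<le>n. S j u \<le> y) \<and> - (K + real n * a) < S n u})"
  define J where "J = (\<lambda>n. {u \<in> space unif_seq. b n < step \<omega> n u})"
  have [measurable]: "Gd n \<in> sets unif_seq" "J n \<in> sets unif_seq" for n unfolding Gd_def J_def by measurable
  have prod: "unif_seq.prob (Gd n \<inter> J n) = unif_seq.prob (Gd n) * unif_seq.prob (J n)" for n
  proof -
    define Xa where "Xa = {x \<in> space (PiM {..<n} (\<lambda>_. borel :: real measure)). (\<forall>j\<le>n. (\<Sum>i<j. x i) \<le> y) \<and> - (K + real n * a) < (\<Sum>i<n. x i)}"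
    define Xb where "Xb = {x \<in> space (PiM {n..} (\<lambda>_. borel :: real measure)). b n < x n}"
    have Xa: "Xa \<in> sets (PiM {..<n} (\<lambda>_. borel))"
      unfolding Xa_def using measurable_component_borel[measurable] by measurable
    have Xb: "Xb \<in> sets (PiM {n..} (\<lambda>_. borel))"
      unfolding Xb_def using measurable_component_borel[measurable] by measurable
    let ?A = "\<lambda>u. \<lambda>i\<in>{..<n}. step \<omega> i u" and ?B = "\<lambda>u. \<lambda>i\<in>{n..}. step \<omega> i u"
    have sum: "(\<Sum>i<j. ?A u i) = S j u" if "j \<le> n" for j u
      unfolding S_def using that by (intro sum.cong) auto
    have A_iff: "?A u \<in> Xa \<longleftrightarrow> (\<forall>j\<le>n. S j u \<le> y) \<and> - (K + real n * a) < S n u" for u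
    proof -
      have "?A u \<in> space (PiM {..<n} (\<lambda>_. borel :: real measure))" by (simp add: space_PiM)
      moreover have "(\<forall>j\<le>n. (\<Sum>i<j. ?A u i) \<le> y) \<longleftrightarrow> (\<forall>j\<le>n. S j u \<le> y)" using sum[of _ u] by metis
      ultimately show ?thesis unfolding Xa_def mem_Collect_eq sum[OF order_refl] by blast
    qed
    have B_iff: "?B u \<in> Xb \<longleftrightarrow> b n < step \<omega> n u" for u
      unfolding Xb_def by (simp add: space_PiM)
    have ind: "unif_seq.indep_var (PiM {..<n} (\<lambda>_. borel)) ?A (PiM {n..} (\<lambda>_. borel)) ?B"
      by (rule unif_seq.indep_vars_past_future[OF indep_step[OF w]])
    have "(\<lambda>u. (?A u, ?B u)) -` (Xa \<times> Xb) \<inter> space unif_seq = Gd n \<inter> J n"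
      "?A -` Xa \<inter> space unif_seq = Gd n" "?B -` Xb \<inter> space unif_seq = J n"
      unfolding Gd_def J_def set_eq_iff vimage_eq Int_iff mem_Times_iff fst_conv snd_conv A_iff B_iff mem_Collect_eq by blast+
    then show ?thesis
      using unif_seq.indep_varD[OF ind Xa Xb] by simp
  qed
  define q where "q = (\<lambda>n. unif_seq.prob {u \<in> space unif_seq. S n u \<le> - (K + real n * a)})"
  have Jn: "unif_seq.prob (J n) = tail (Fx (X (Suc n) \<omega>)) (b n)" for n
    unfolding J_def by (rule prob_step_greater[OF w])
  have one: "(1 - e1) * unif_seq.prob (J n) \<le> unif_seq.prob (Gd n \<inter> J n) + tail F (b n) * q n" for n
  proof -
    have "1 = unif_seq.prob (space unif_seq)" by (simp add: unif_seq.prob_space)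
    also have "\<dots> \<le> unif_seq.prob (Gd n \<union> ({u \<in> space unif_seq. \<exists>j\<le>n. y < S j u} \<union> {u \<in> space unif_seq. S n u \<le> - (K + real n * a)}))"
      by (rule unif_seq.finite_measure_mono) (auto simp: Gd_def not_less not_le)
    also have "\<dots> \<le> unif_seq.prob (Gd n) + unif_seq.prob ({u \<in> space unif_seq. \<exists>j\<le>n. y < S j u} \<union> {u \<in> space unif_seq. S n u \<le> - (K + real n * a)})"
      by (rule measure_Un_le) measurable
    also have "unif_seq.prob ({u \<in> space unif_seq. \<exists>j\<le>n. y < S j u} \<union> {u \<in> space unif_seq. S n u \<le> - (K + real n * a)})
      \<le> unif_seq.prob {u \<in> space unif_seq. \<exists>j\<le>n. y < S j u} + unif_seq.prob {u \<in> space unif_seq. S n u \<le> - (K + real n * a)}"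
      by (rule measure_Un_le) measurable
    finally have "1 - e1 \<le> unif_seq.prob (Gd n) + q n"
      using small[of n] by (simp add: q_def S_def)
    then have "(1 - e1) * unif_seq.prob (J n) \<le> (unif_seq.prob (Gd n) + q n) * unif_seq.prob (J n)"
      by (intro mult_right_mono) auto
    also have "\<dots> = unif_seq.prob (Gd n \<inter> J n) + unif_seq.prob (J n) * q n"
      by (simp add: prod algebra_simps)
    also have "\<dots> \<le> unif_seq.prob (Gd n \<inter> J n) + tail F (b n) * q n"
      unfolding Jn by (intro add_left_mono mult_right_mono tail_le measurable_space[OF measurable_X w]) (simp add: q_def)
    finally show ?thesis .
  qed
  have up: "y < S (Suc n) u" if "u \<in> Gd n \<inter> J n" for n u
  proof -
    have "S (Suc n) u = S n u + step \<omega> n u" by (simp add: S_def)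
    then show ?thesis using that by (auto simp: Gd_def J_def b_def)
  qed
  have disj: "disjoint_family_on (\<lambda>n. Gd n \<inter> J n) {..<N}"
    unfolding disjoint_family_on_def
  proof (intro ballI impI)
    fix m n :: nat assume "m \<noteq> n"
    have False if "k < l" "u \<in> Gd k \<inter> J k" "u \<in> Gd l \<inter> J l" for k l u
    proof -
      from that(3) have "\<forall>j\<le>l. S j u \<le> y" by (simp add: Gd_def)
      with that(1) have "S (Suc k) u \<le> y" by simp
      with up[OF that(2)] show False by simp
    qed
    with \<open>m \<noteq> n\<close> show "Gd m \<inter> J m \<inter> (Gd n \<inter> J n) = {}"
      by (metis (no_types, lifting) Int_iff ex_in_conv linorder_neqE_nat)
  qed
  have "(\<Sum>n<N. ennreal (1 - e1) * ennreal (tail (Fx (X (Suc n) \<omega>)) (b n)))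
    \<le> (\<Sum>n<N. emeasure unif_seq (Gd n \<inter> J n) + ennreal (tail F (b n)) * ennreal (q n))"
  proof (rule sum_mono)
    fix n
    have "ennreal (1 - e1) * ennreal (tail (Fx (X (Suc n) \<omega>)) (b n)) = ennreal ((1 - e1) * unif_seq.prob (J n))"
      unfolding Jn[symmetric] by (simp add: ennreal_mult'')
    also have "\<dots> \<le> ennreal (unif_seq.prob (Gd n \<inter> J n) + tail F (b n) * q n)" by (rule ennreal_leI[OF one])
    also have "\<dots> = emeasure unif_seq (Gd n \<inter> J n) + ennreal (tail F (b n)) * ennreal (q n)"
      by (simp add: unif_seq.emeasure_eq_measure ennreal_mult'' q_def H.F.tail_bounds)
    finally show "ennreal (1 - e1) * ennreal (tail (Fx (X (Suc n) \<omega>)) (b n))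
      \<le> emeasure unif_seq (Gd n \<inter> J n) + ennreal (tail F (b n)) * ennreal (q n)" .
  qed
  also have "\<dots> = (\<Sum>n<N. emeasure unif_seq (Gd n \<inter> J n)) + (\<Sum>n<N. ennreal (tail F (b n)) * ennreal (q n))"
    by (rule sum.distrib)
  also have "(\<Sum>n<N. emeasure unif_seq (Gd n \<inter> J n)) = emeasure unif_seq (\<Union>n<N. Gd n \<inter> J n)"
    using disj by (intro sum_emeasure) auto
  also have "\<dots> \<le> emeasure unif_seq {u \<in> space unif_seq. \<exists>n\<le>N. y < S n u}"
  proof (rule emeasure_mono)
    show "(\<Union>n<N. Gd n \<inter> J n) \<subseteq> {u \<in> space unif_seq. \<exists>n\<le>N. y < S n u}"
    proof
      fix u assume "u \<in> (\<Union>n<N. Gd n \<inter> J n)"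
      then obtain n where n: "n < N" "u \<in> Gd n \<inter> J n" by auto
      then have "y < S (Suc n) u" "Suc n \<le> N" "u \<in> space unif_seq" using up[OF n(2)] by (auto simp: Gd_def)
      then show "u \<in> {u \<in> space unif_seq. \<exists>n\<le>N. y < S n u}" by blast
    qed
  qed measurable
  finally show ?thesis
    by (simp add: b_def S_def q_def unif_seq.emeasure_eq_measure add_right_mono)
qed

text \<open>Staying below \<open>y\<close> costs at most \<open>D * tail H y\<close>, which tends to
  0 uniformly over the environments; the loss from dropping below the line is summed against tails
  of \<open>F\<close> and is a small multiple of \<open>tail H y\<close>.\<close>

lemma prob_max_lower_bound:
  assumes kappa: "kappa SX Fx < 0" and int: "integrable \<pi> (\<lambda>x. \<integral>y. y \<partial>Fx x)"
    and a: "0 < a" "- (\<integral>x. (\<integral>y. y \<partial>Fx x) \<partial>\<pi>) < a" and e: "0 < e"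
  shows "eventually (\<lambda>y. ennreal ((C / a - e) * tail H y)
     \<le> emeasure M {\<omega> \<in> space M. \<exists>n. y < (\<Sum>i<n. \<xi> (Suc i) \<omega>)}) at_top"
proof -
  obtain \<beta> \<mu> where \<mu>: "\<mu> < 0" "\<And>x. x \<in> space SX \<Longrightarrow> trunc_mean (Fx x) \<beta> \<le> \<mu>"
    by (rule kappa_neg_imp_uniform[OF kappa]) (rule that)
  obtain D where D: "1 \<le> D"
    and Dbound: "\<And>(P :: (nat \<Rightarrow> real) measure) \<xi> N y. dominated_steps F \<beta> \<mu> P \<xi> \<Longrightarrow>
      measure P {\<omega> \<in> space P. \<exists>n\<le>N. y < (\<Sum>i<n. \<xi> i \<omega>)} \<le> min 1 (D * tail H y)"
    by (rule H.uniform_tail_bound[OF \<mu>(1), of \<beta>]) blast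
  \<comment> \<open>Ensures \<open>e1 * (C / a) \<le> e / 4\<close>, also when \<open>C\<close> is
    0.\<close>
  define e1 where "e1 = min 1 (e / (4 * (C / a + 1)))"
  have Ca: "0 \<le> C / a" using C_nonneg a by simp
  have e1: "0 < e1" "e1 \<le> 1" using e Ca by (auto simp: e1_def)
  have e1C: "e1 * (C / a) \<le> e / 4"
  proof -
    have "e1 * (C / a) \<le> e / (4 * (C / a + 1)) * (C / a + 1)"
      using Ca e by (intro mult_mono) (auto simp: e1_def)
    also have "\<dots> = e / 4" using Ca by (simp add: field_simps)
    finally show ?thesis .
  qed
  \<comment> \<open>The second sum is at most \<open>e2 / a\<close> times a stop-loss value below
    \<open>2 * tail H y\<close>, that is \<open>e / 4\<close> times the tail.\<close>
  define e2 where "e2 = e * a / 8"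
  have e2: "0 < e2" using e a by (simp add: e2_def)
  obtain K where K: "0 < K"
    and line: "\<And>n. (\<integral>\<^sup>+\<omega>. emeasure unif_seq {u \<in> space unif_seq. (\<Sum>i<n. step \<omega> i u) \<le> - (K + real n * a)} \<partial>M) \<le> ennreal e2"
    by (rule walk_rarely_below_line[OF int a(2) e2]) blast
  have "((\<lambda>y. D * tail H y) \<longlongrightarrow> D * 0) at_top" by (intro tendsto_intros H.tendsto_tail)
  then have "eventually (\<lambda>y. D * tail H y < e1) at_top" using e1 by (intro order_tendstoD(2)) auto
  moreover have "eventually (\<lambda>y. ennreal ((C / a - e / 4) * tail H y) \<le> jump_mass a (y + K)) at_top"
    using e by (intro eventually_jump_mass_ge a) simp
  moreover have "eventually (\<lambda>y. stop_loss F (y + (K - a)) \<le> 2 * tail H y) at_top"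
    by (rule H.eventually_stop_loss_le) simp
  ultimately show ?thesis
    using eventually_ge_at_top[of 0]
  proof eventually_elim
    case (elim y)
    have t: "0 < tail H y" by (rule H.tail_pos)
    define p where "p = emeasure M {\<omega> \<in> space M. \<exists>n. y < (\<Sum>i<n. \<xi> (Suc i) \<omega>)}"
    define b where "b = (\<lambda>n. y + K + real n * a)"
    define q where "q = (\<lambda>n \<omega>. emeasure unif_seq {u \<in> space unif_seq. (\<Sum>i<n. step \<omega> i u) \<le> - (K + real n * a)})"
    have [measurable]: "q n \<in> borel_measurable M" for n
      unfolding q_def by (rule measurable_prob_step) measurable
    define P where "P = (\<lambda>N \<omega>. emeasure unif_seq {u \<in> space unif_seq. \<exists>n\<le>N. y < (\<Sum>i<n. step \<omega> i u)})"
    have [measurable]: "P N \<in> borel_measurable M" for N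
      unfolding P_def by (rule measurable_prob_step) measurable
    have "ennreal (1 - e1) * jump_mass a (y + K)
      = (\<Sum>n. ennreal (1 - e1) * (\<integral>\<^sup>+\<omega>. ennreal (tail (Fx (X (Suc n) \<omega>)) (b n)) \<partial>M))"
      unfolding jump_mass_def b_def by (subst nn_integral_suminf) simp_all
    also have "\<dots> \<le> p + ennreal (e2 * (stop_loss F (y + K - a) / a))"
    proof (rule suminf_le_const[OF summableI])
      fix N
      have "(\<Sum>n<N. ennreal (1 - e1) * (\<integral>\<^sup>+\<omega>. ennreal (tail (Fx (X (Suc n) \<omega>)) (b n)) \<partial>M))
        = (\<integral>\<^sup>+\<omega>. (\<Sum>n<N. ennreal (1 - e1) * ennreal (tail (Fx (X (Suc n) \<omega>)) (b n))) \<partial>M)"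
        by (simp add: nn_integral_sum nn_integral_cmult)
      also have "\<dots> \<le> (\<integral>\<^sup>+\<omega>. P N \<omega> + (\<Sum>n<N. ennreal (tail F (b n)) * q n \<omega>) \<partial>M)"
      proof (rule nn_integral_mono)
        fix \<omega> assume w: "\<omega> \<in> space M"
        show "(\<Sum>n<N. ennreal (1 - e1) * ennreal (tail (Fx (X (Suc n) \<omega>)) (b n)))
          \<le> P N \<omega> + (\<Sum>n<N. ennreal (tail F (b n)) * q n \<omega>)"
          unfolding P_def q_def b_def
        proof (rule sum_single_jumps_le[OF w])
          fix n
          have "unif_seq.prob {u \<in> space unif_seq. \<exists>j\<le>n. y < (\<Sum>i<j. step \<omega> i u)} \<le> min 1 (D * tail H y)"
            by (rule Dbound[OF dominated_steps_step[OF w \<mu>(2)]])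
          then show "unif_seq.prob {u \<in> space unif_seq. \<exists>j\<le>n. y < (\<Sum>i<j. step \<omega> i u)} \<le> e1"
            using elim(1) by linarith
        qed (use e1 elim(4) K a in auto)
      qed
      also have "\<dots> = (\<integral>\<^sup>+\<omega>. P N \<omega> \<partial>M) + (\<Sum>n<N. ennreal (tail F (b n)) * (\<integral>\<^sup>+\<omega>. q n \<omega> \<partial>M))"
        by (simp add: nn_integral_add nn_integral_sum nn_integral_cmult)
      also have "\<dots> \<le> p + (\<Sum>n<N. ennreal (tail F (b n)) * ennreal e2)"
      proof (intro add_mono sum_mono mult_left_mono)
        show "(\<integral>\<^sup>+\<omega>. P N \<omega> \<partial>M) \<le> p"
          unfolding P_def emeasure_max_transfer[symmetric] p_def
          by (rule emeasure_mono) auto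
        show "(\<integral>\<^sup>+\<omega>. q n \<omega> \<partial>M) \<le> ennreal e2" for n unfolding q_def by (rule line)
      qed simp
      also have "(\<Sum>n<N. ennreal (tail F (b n)) * ennreal e2) = ennreal ((\<Sum>n<N. tail F (b n)) * e2)"
        using e2 by (simp add: sum_distrib_right[symmetric] sum_ennreal H.F.tail_bounds ennreal_mult'' )
      also have "p + \<dots> \<le> p + ennreal (e2 * (stop_loss F (y + K - a) / a))"
      proof (intro add_left_mono ennreal_leI)
        have "(\<Sum>n<N. tail F (b n)) \<le> stop_loss F (y + K - a) / a"
          using H.F.sum_tail_le[OF a(1), where y="y + K - a" and N=N] by (simp add: b_def)
        then have "(\<Sum>n<N. tail F (b n)) * e2 \<le> stop_loss F (y + K - a) / a * e2"
          using e2 by (intro mult_right_mono) auto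
        then show "(\<Sum>n<N. tail F (b n)) * e2 \<le> e2 * (stop_loss F (y + K - a) / a)"
          by (simp only: mult.commute)
      qed
      finally show "(\<Sum>n<N. ennreal (1 - e1) * (\<integral>\<^sup>+\<omega>. ennreal (tail (Fx (X (Suc n) \<omega>)) (b n)) \<partial>M))
        \<le> p + ennreal (e2 * (stop_loss F (y + K - a) / a))" .
    qed
    also have "\<dots> \<le> p + ennreal (e / 4 * tail H y)"
    proof (intro add_left_mono ennreal_leI)
      have "e2 * (stop_loss F (y + K - a) / a) = e / 8 * stop_loss F (y + (K - a))"
        using a by (simp add: e2_def algebra_simps)
      also have "\<dots> \<le> e / 8 * (2 * tail H y)" using elim(3) e by (intro mult_left_mono) auto
      finally show "e2 * (stop_loss F (y + K - a) / a) \<le> e / 4 * tail H y" by simp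
    qed
    finally have 1: "ennreal (1 - e1) * jump_mass a (y + K) \<le> p + ennreal (e / 4 * tail H y)" .
    have "ennreal ((1 - e1) * ((C / a - e / 4) * tail H y)) = ennreal (1 - e1) * ennreal ((C / a - e / 4) * tail H y)"
      using e1 by (intro ennreal_mult') simp
    also have "\<dots> \<le> ennreal (1 - e1) * jump_mass a (y + K)" using elim(2) by (intro mult_left_mono) auto
    also note 1
    finally have 2: "ennreal ((1 - e1) * ((C / a - e / 4) * tail H y)) \<le> p + ennreal (e / 4 * tail H y)" .
    have p: "p = ennreal (measure M {\<omega> \<in> space M. \<exists>n. y < (\<Sum>i<n. \<xi> (Suc i) \<omega>)})"
      unfolding p_def by (rule emeasure_eq_measure)
    have "(1 - e1) * ((C / a - e / 4) * tail H y) \<le> measure M {\<omega> \<in> space M. \<exists>n. y < (\<Sum>i<n. \<xi> (Suc i) \<omega>)} + e / 4 * tail H y"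
    proof (subst ennreal_le_iff[symmetric])
      show "0 \<le> measure M {\<omega> \<in> space M. \<exists>n. y < (\<Sum>i<n. \<xi> (Suc i) \<omega>)} + e / 4 * tail H y"
        using e t by (intro add_nonneg_nonneg mult_nonneg_nonneg) auto
      show "ennreal ((1 - e1) * ((C / a - e / 4) * tail H y))
        \<le> ennreal (measure M {\<omega> \<in> space M. \<exists>n. y < (\<Sum>i<n. \<xi> (Suc i) \<omega>)} + e / 4 * tail H y)"
        using 2 e t unfolding p by (subst ennreal_plus) auto
    qed
    moreover have "(C / a - e) * tail H y \<le> (1 - e1) * ((C / a - e / 4) * tail H y) - e / 4 * tail H y"
    proof -
      have "C / a - e \<le> (1 - e1) * (C / a - e / 4) - e / 4"
      proof -
        have "(1 - e1) * (k - e / 4) = k - e1 * k - (1 - e1) * (e / 4)" for k by (simp add: algebra_simps)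
        note this[of "C / a"]
        moreover have "(1 - e1) * (e / 4) \<le> 1 * (e / 4)" using e1 e by (intro mult_right_mono) auto
        ultimately show ?thesis using e1C e by linarith
      qed
      then have "(C / a - e) * tail H y \<le> ((1 - e1) * (C / a - e / 4) - e / 4) * tail H y"
        using t by (intro mult_right_mono) auto
      then show ?thesis by (simp add: algebra_simps)
    qed
    ultimately show ?case unfolding p_def[symmetric] p by (intro ennreal_leI) linarith
  qed
qed

end

section \<open>Letting the slope tend to the stationary drift\<close>

context modulated_walk
begin

text \<open>The lower bound holds for slopes above \<open>a\<close>, the upper bound for slopes
  below; continuity of \<open>C / b\<close> at \<open>a\<close> closes the gap. One third of the
  distance to the limit goes to the slope, one third to the error of the bound, and the rest keeps
  the inequality strict.\<close>

lemma tendsto_prob_max: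
  assumes kappa: "kappa SX Fx < 0" and int: "integrable \<pi> (\<lambda>x. \<integral>y. y \<partial>Fx x)"
    and a: "a = - (\<integral>x. (\<integral>y. y \<partial>Fx x) \<partial>\<pi>)" "0 < a"
  shows "((\<lambda>y. prob {\<omega> \<in> space M. \<exists>n. y < (\<Sum>i<n. \<xi> (Suc i) \<omega>)} / tail H y) \<longlongrightarrow> C / a) at_top"
proof (rule order_tendstoI)
  fix l assume l: "l < C / a"
  define e where "e = (C / a - l) / 3"
  have e: "0 < e" using l by (simp add: e_def)
  have "((\<lambda>b. C / b) \<longlongrightarrow> C / a) (at_right a)" using a by (intro tendsto_intros) auto
  then have "eventually (\<lambda>b. C / a - e < C / b) (at_right a)" using e by (intro order_tendstoD(1)) auto
  from eventually_happens'[OF trivial_limit_at_right_real eventually_conj[OF this eventually_at_right_less]]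
  obtain b where b: "C / a - e < C / b" "a < b" by blast
  have "eventually (\<lambda>y. ennreal ((C / b - e) * tail H y)
     \<le> emeasure M {\<omega> \<in> space M. \<exists>n. y < (\<Sum>i<n. \<xi> (Suc i) \<omega>)}) at_top"
    using a b e by (intro prob_max_lower_bound kappa int) auto
  then show "eventually (\<lambda>y. l < prob {\<omega> \<in> space M. \<exists>n. y < (\<Sum>i<n. \<xi> (Suc i) \<omega>)} / tail H y) at_top"
  proof eventually_elim
    case (elim y)
    have t: "0 < tail H y" by (rule H.tail_pos)
    have "3 * e = C / a - l" by (simp add: e_def)
    then have "l < C / b - e" using b(1) e by linarith
    then have "l * tail H y < (C / b - e) * tail H y" using t by (rule mult_strict_right_mono)
    also have "\<dots> \<le> prob {\<omega> \<in> space M. \<exists>n. y < (\<Sum>i<n. \<xi> (Suc i) \<omega>)}"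
      using elim by (simp add: emeasure_eq_measure)
    finally show ?case using t by (simp add: less_divide_eq)
  qed
next
  fix l assume l: "C / a < l"
  define e where "e = (l - C / a) / 3"
  have e: "0 < e" using l by (simp add: e_def)
  have "((\<lambda>b. C / b) \<longlongrightarrow> C / a) (at_left a)" using a by (intro tendsto_intros) auto
  then have "eventually (\<lambda>b. C / b < C / a + e) (at_left a)" using e by (intro order_tendstoD(2)) auto
  moreover have "eventually (\<lambda>b. 0 < b \<and> b < a) (at_left a)"
    using eventually_at_left_real[OF a(2)] by (auto elim!: eventually_mono)
  ultimately have "eventually (\<lambda>b. C / b < C / a + e \<and> 0 < b \<and> b < a) (at_left a)"
    by (rule eventually_conj)
  from eventually_happens'[OF trivial_limit_at_left_real this]
  obtain b where b: "C / b < C / a + e" "0 < b" "b < a" by blast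
  have "eventually (\<lambda>y. \<forall>N. emeasure M {\<omega> \<in> space M. \<exists>n\<le>N. y < (\<Sum>i<n. \<xi> (Suc i) \<omega>)}
     \<le> ennreal ((C / b + e) * tail H y)) at_top"
    using a b e by (intro prob_max_upper_bound kappa int) auto
  then show "eventually (\<lambda>y. prob {\<omega> \<in> space M. \<exists>n. y < (\<Sum>i<n. \<xi> (Suc i) \<omega>)} / tail H y < l) at_top"
  proof eventually_elim
    case (elim y)
    have t: "0 < tail H y" by (rule H.tail_pos)
    have Cb: "0 \<le> C / b" using C_nonneg b by simp
    \<comment> \<open>The upper bound is uniform in the horizon \<open>N\<close> for each
      \<open>y\<close>, so it passes to the infinite horizon by continuity from below.\<close>
    define A where "A = (\<lambda>N. {\<omega> \<in> space M. \<exists>n\<le>N. y < (\<Sum>i<n. \<xi> (Suc i) \<omega>)})"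
    have A_meas: "range A \<subseteq> events" unfolding A_def by (rule image_subsetI) measurable
    have A_mono: "incseq A" unfolding A_def by (rule incseq_SucI) (auto intro: le_SucI)
    have A_Un: "{\<omega> \<in> space M. \<exists>n. y < (\<Sum>i<n. \<xi> (Suc i) \<omega>)} = (\<Union>N. A N)"
      unfolding A_def by auto
    have "emeasure M (\<Union>N. A N) = (SUP N. emeasure M (A N))"
      by (rule SUP_emeasure_incseq[OF A_meas A_mono, symmetric])
    also have "\<dots> \<le> ennreal ((C / b + e) * tail H y)"
      using elim unfolding A_def by (intro SUP_least) blast
    finally have "prob {\<omega> \<in> space M. \<exists>n. y < (\<Sum>i<n. \<xi> (Suc i) \<omega>)} \<le> (C / b + e) * tail H y"
      unfolding A_Un using t e Cb by (simp add: emeasure_eq_measure)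
    also have "\<dots> < l * tail H y"
    proof (rule mult_strict_right_mono[OF _ t])
      have "3 * e = l - C / a" by (simp add: e_def)
      then show "C / b + e < l" using b(1) e by linarith
    qed
    finally show ?case using t by (simp add: divide_less_eq)
  qed
qed

end

text \<open>Taking the positive part changes the tail only on the negative half line, where it
  becomes 1; subexponentiality of the integrated tail law is by definition a statement about this
  positive part.\<close>

lemma heavy_int_tail_positive_part:
  assumes F: "integrable_dist F" and subexp: "subexponential (int_tail_dist F)"
  shows "heavy_int_tail (distr (int_tail_dist F) borel (\<lambda>t. max t 0)) F"
proof -
  interpret F: integrable_dist F by fact
  interpret I: real_distribution "int_tail_dist F" by (rule F.real_distribution_int_tail_dist)
  let ?H = "distr (int_tail_dist F) borel (\<lambda>t. max t 0)"
  have m: "(\<lambda>t. max t 0) \<in> borel_measurable (int_tail_dist F)" by measurable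
  have H: "tail ?H y = measure (int_tail_dist F) {t. y < max t 0}" for y
    unfolding tail_def by (subst measure_distr[OF m]) (auto intro!: arg_cong[where f="measure (int_tail_dist F)"])
  have "tail ?H y = 1" if "y < 0" for y
  proof -
    have "{t. y < max t 0} = UNIV" using that by auto
    then show ?thesis unfolding H using I.prob_space by simp
  qed
  moreover have "tail ?H y = int_tail F y" if "0 \<le> y" for y
  proof -
    have "{t. y < max t 0} = {y<..}" using that by auto
    then have "tail ?H y = tail (int_tail_dist F) y" unfolding H by (simp add: tail_def)
    then show ?thesis by (simp add: F.tail_int_tail_dist)
  qed
  moreover have "((\<lambda>y. tail (?H \<star> ?H) y / tail ?H y) \<longlongrightarrow> 2) at_top"
    using subexp by (simp add: subexponential_def Let_def)
  moreover have "real_distribution ?H" by (rule I.real_distribution_distr[OF m])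
  ultimately show ?thesis
    using F by (simp add: heavy_int_tail_def heavy_int_tail_axioms_def subexp_dist_def subexp_dist_axioms_def)
qed

theorem theorem2p1:
  fixes M :: "'w measure" and SX :: "'x measure"
    and X :: "nat \<Rightarrow> 'w \<Rightarrow> 'x" and T :: "nat \<Rightarrow> 'w \<Rightarrow> nat"
    and Fx :: "'x \<Rightarrow> real measure" and \<xi> :: "nat \<Rightarrow> 'w \<Rightarrow> real"
    and F :: "real measure" and c :: "'x \<Rightarrow> real"
  defines "S \<equiv> (\<lambda>n \<omega>. \<Sum>i\<in>{1..n}. \<xi> i \<omega>)"
    and "a \<equiv> - (\<integral>x. (\<integral>y. y \<partial>Fx x) \<partial>stationary_measure M SX X T)"
    and "C \<equiv> (\<integral>x. c x \<partial>stationary_measure M SX X T)"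
  assumes M: "prob_space M"
    and regen: "regenerative M SX X T"
    and Etau: "integrable M (\<lambda>\<omega>. real (T 1 \<omega> - T 0 \<omega>))"
    and Fx_dist: "\<forall>x\<in>space SX. prob_space (Fx x) \<and> sets (Fx x) = sets borel \<and> integrable (Fx x) (\<lambda>y. y)"
    and Fx_meas: "\<forall>y. (\<lambda>x. measure (Fx x) {..y}) \<in> borel_measurable SX"
    and walk: "modulated_increments M SX X Fx \<xi>"
    and F_dist: "prob_space F" "sets F = sets borel" "integrable F (\<lambda>y. y)"
    and c_meas: "c \<in> borel_measurable SX" "\<forall>x\<in>space SX. 0 \<le> c x \<and> c x \<le> 1"
    and D1: "\<forall>x\<in>space SX. \<forall>y. tail (Fx x) y \<le> tail F y"
    and D2: "\<forall>x\<in>space SX. ((\<lambda>y. int_tail (Fx x) y / int_tail F y) \<longlongrightarrow> c x) at_top"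
    and D3: "integrable (stationary_measure M SX X T) (\<lambda>x. \<integral>y. y \<partial>Fx x)" "a > 0"
    and subexp: "subexponential (int_tail_dist F)"
    and kappa_neg: "kappa SX Fx < 0"
  shows "((\<lambda>y. prob_space.prob M {\<omega> \<in> space M. (SUP n. ereal (S n \<omega>)) > ereal y} / int_tail F y)
            \<longlongrightarrow> C / a) at_top"
proof -
  define H where "H = distr (int_tail_dist F) borel (\<lambda>t. max t 0)"
  have F: "integrable_dist F" by (rule integrable_distI[OF F_dist])
  have H: "heavy_int_tail H F"
    unfolding H_def by (rule heavy_int_tail_positive_part[OF F subexp])
  interpret M: prob_space M by (rule M)
  have rp: "regenerative_process M SX X T"
    using M regen Etau by (simp add: regenerative_process_def regenerative_process_axioms_def)
  have mt: "modulated_tails M SX X T H F Fx c"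
    using rp H Fx_dist Fx_meas c_meas D1 D2
    by (auto simp: modulated_tails_def modulated_tails_axioms_def intro!: integrable_distI)
  interpret W: modulated_walk M SX X T H F Fx c \<xi>
    using mt walk by (simp add: modulated_walk_def modulated_walk_axioms_def)
  have C: "C = W.C" by (simp add: C_def W.C_def)
  \<comment> \<open>The supremum exceeds \<open>y\<close> exactly when some partial sum does; the
    index range \<open>{1..n}\<close> is shifted to \<open>{..<n}\<close> to match the
    steps.\<close>
  have ev: "{\<omega> \<in> space M. (SUP n. ereal (S n \<omega>)) > ereal y} = {\<omega> \<in> space M. \<exists>n. y < (\<Sum>i<n. \<xi> (Suc i) \<omega>)}" for y
    by (auto simp: less_SUP_iff S_def sum.atLeast1_atMost_eq)
  have lim: "((\<lambda>y. M.prob {\<omega> \<in> space M. \<exists>n. y < (\<Sum>i<n. \<xi> (Suc i) \<omega>)} / tail H y) \<longlongrightarrow> C / a) at_top"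
    unfolding C using D3 kappa_neg by (intro W.tendsto_prob_max) (auto simp: a_def)
  have "eventually (\<lambda>y. M.prob {\<omega> \<in> space M. \<exists>n. y < (\<Sum>i<n. \<xi> (Suc i) \<omega>)} / tail H y
     = M.prob {\<omega> \<in> space M. (SUP n. ereal (S n \<omega>)) > ereal y} / int_tail F y) at_top"
    using eventually_ge_at_top[of 0] by eventually_elim (simp add: ev W.H.tail_H)
  from Lim_transform_eventually[OF lim this] show ?thesis .
qed

end
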